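(* Let $p$ be an odd prime and $n$ a positive integer not divisible by $p$ such that every group of order $np$ has a normal subgroup of order $p$ and $p\nmid\theta(n)$. (1) For a skew brace $B_n$ of size $n$, the number of additive structures over $B_n$ of skew braces of size $np$ is the number of orbits $|\mathrm{Hom}(B_n,\mathbf{Z}_p^* )/\mathrm{Aut}(B_n)|$ of the right action $(g,\sigma)\mapsto\sigma g$. Therefore the total number of additive structures is $$\sum_{B_n}\frac{1}{|\mathrm{Aut}(B_n)|}\sum_{\sigma\in\mathrm{Hom}(B_n,\mathbf{Z}_p^* )}|\mathrm{Stab}_{\mathrm{Aut}(B_n)}(\sigma)|,$$ where $B_n$ runs over the isomorphism classes of skew braces of size $n$. (2) For $\sigma\in\mathrm{Hom}(B_n,\mathbf{Z}_p^* )$ let $\Sigma_{B_n,\sigma}=\{g\in\mathrm{Aut}(B_n,\cdot):\sigma g=\sigma\}$ and $A_{B_n,\sigma}=\mathrm{Aut}(B_n)\cap\Sigma_{B_n,\sigma}$. Then the number of isomorphism classes of skew braces of size $np$ with the additive structure defined by $(B_n,\sigma)$ is obtained from the orbits of the action $(g,\tau)\mapsto\tau g$ of $A_{B_n,\sigma}$ on $\mathrm{Hom}((B_n,\circ),\mathbf{Z}_p^* )$: it equals the number of orbits if $\sigma=1$, and twice the number of orbits if $\sigma\neq1$. The total number of isomorphism classes of skew braces of size $np$ is $$\sum_{B_n}\left(\frac{1}{|A_{B_n,1}|}\sum_{\tau\in\mathrm{Hom}((B_n,\circ),\mathbf{Z}_p^* )}|\mathrm{Stab}_{A_{B_n,1}}(\tau)|+2\sum_{\sigma\neq1}\frac{1}{|A_{B_n,\sigma}|}\sum_{\tau\in\mathrm{Hom}((B_n,\circ),\mathbf{Z}_p^*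 )}|\mathrm{Stab}_{A_{B_n,\sigma}}(\tau)|\right),$$ where $B_n$ runs over the isomorphism classes of skew braces of size $n$ and, for each $B_n$, $\sigma$ runs over a system of representatives of the non-trivial orbits in $\mathrm{Hom}(B_n,\mathbf{Z}_p^* )/\mathrm{Aut}(B_n)$. The case $\sigma=1$ corresponds to the semidirect product of $B_n$ and the trivial brace of order $p$.
   Context: A skew brace is a triple $(B,\cdot,\circ)$ where $(B,\cdot)$ (additive group) and $(B,\circ)$ (multiplicative group) are groups on the same set and $a\circ(b\cdot c)=(a\circ b)\cdot a^{-1}\cdot(a\circ c)$ for all $a,b,c$, with $a^{-1}$ the inverse in $(B,\cdot)$. Homomorphisms preserve both operations; $\mathrm{Aut}(B_n)$ is the group of skew brace automorphisms and $\mathrm{Aut}(B_n,\cdot)$ the automorphism group of the additive group. $\mathrm{Hom}(B_n,\mathbf{Z}_p^* )$ is the set of skew brace homomorphisms, i.e. maps that are group homomorphisms from both $(B_n,\cdot)$ and $(B_n,\circ)$ to the multiplicative group $\mathbf{Z}_p^*$, while $\mathrm{Hom}((B_n,\circ),\mathbf{Z}_p^* )$ is the set of group homomorphisms from the multiplicative group. $\sigma g$ and $\tau g$ denote composition, and $1$ denotes the trivial homomorphism. The trivial brace of order $p$ is $\mathbf{Z}_p$ with both operations equal to addition. The semidirect product of the trivial brace $\mathbf{Z}_p$ and $B_n$ via $\tau\in\mathrm{Hom}((B_n,\circ),\mathbf{Z}_p^* )$ is $\mathbf{Z}_p\times B_n$ with $(m,a)\cdot(m',b)=(m+m',a\cdot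 b)$ and $(m,a)\circ(m',b)=(m+\tau(a)m',a\circ b)$. The function $\theta:\mathbf{Z}_{>0}\to\mathbf{Z}_{>0}$ is defined on prime powers by $\theta(q^m)=|\mathrm{GL}_m(\mathbf{F}_q)|$ and extended multiplicatively (to products of powers of distinct primes). Under the hypotheses, for every skew brace $B$ of size $np$ the unique subgroup $P$ of order $p$ of $(B,\cdot)$ is an ideal, $B/P$ is a skew brace of size $n$, and the conjugation action of $(B,\cdot)$ on $P\simeq\mathbf{Z}_p$ induces an element $\sigma_B\in\mathrm{Hom}(B/P,\mathbf{Z}_p^* )$. The additive structure of $B$ is the isomorphism class of the pair $(B/P,\sigma_B)$, where $(C,\sigma)$ and $(C',\sigma')$ are isomorphic if there is a skew brace isomorphism $f:C\to C'$ with $\sigma'f=\sigma$. An additive structure over $B_n$ is one with $B/P\simeq B_n$. *)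

theory Defs
  imports "HOL-Algebra.Bij" "HOL-Algebra.Group_Action" "HOL-Number_Theory.Residues"
begin

text \<open>The inherited monoid part of the record is the additive group. Both groups share the field
  \<open>one\<close>; this is no restriction, since the brace identity forces the two units to coincide.\<close>

record 'a skew_brace = "'a monoid" +
  circ :: "'a \<Rightarrow> 'a \<Rightarrow> 'a"  (infixl \<open>\<bullet>\<index>\<close> 70)

definition circ_group :: "('a, 'b) skew_brace_scheme \<Rightarrow> 'a monoid" where
  "circ_group B = \<lparr>carrier = carrier B, monoid.mult = circ B, one = one B\<rparr>"

locale skew_brace = group B for B :: "('a, 'b) skew_brace_scheme" (structure) +
  assumes circ_group: "group (circ_group B)"
    and circ_mult: "\<lbrakk>a \<in> carrier B; b \<in> carrier B; c \<in> carrier B\<rbrakk> \<Longrightarrow>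
      a \<bullet> (b \<otimes> c) = (a \<bullet> b) \<otimes> inv a \<otimes> (a \<bullet> c)"

text \<open>Every finite skew brace is isomorphic to one whose carrier is a set of natural numbers, so
  isomorphism classes are counted among these.\<close>

definition skew_braces :: "nat \<Rightarrow> nat skew_brace set" where
  "skew_braces m = {B. skew_brace B \<and> order B = m}"

definition brace_hom ::
    "('a, 'c) skew_brace_scheme \<Rightarrow> ('b, 'd) skew_brace_scheme \<Rightarrow> ('a \<Rightarrow> 'b) set" where
  "brace_hom B C = hom B C \<inter> hom (circ_group B) (circ_group C)"

definition brace_iso ::
    "('a, 'c) skew_brace_scheme \<Rightarrow> ('b, 'd) skew_brace_scheme \<Rightarrow> ('a \<Rightarrow> 'b) set" where
  "brace_iso B C = {f \<in> brace_hom B C. bij_betw f (carrier B) (carrier C)}"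

definition brace_isomorphic ::
    "('a, 'c) skew_brace_scheme \<Rightarrow> ('b, 'd) skew_brace_scheme \<Rightarrow> bool" where
  "brace_isomorphic B C \<longleftrightarrow> brace_iso B C \<noteq> {}"

definition iso_classes :: "('a \<Rightarrow> 'a \<Rightarrow> bool) \<Rightarrow> 'a set \<Rightarrow> 'a set set" where
  "iso_classes R S = S // {(x, y). x \<in> S \<and> y \<in> S \<and> R x y}"

definition representatives :: "'a set \<Rightarrow> 'a set set \<Rightarrow> bool" where
  "representatives R \<C> \<longleftrightarrow> R \<subseteq> \<Union>\<C> \<and> (\<forall>C\<in>\<C>. \<exists>!x. x \<in> C \<and> x \<in> R)"

text \<open>As for \<open>auto\<close> and \<open>Bij\<close> in the library, maps that are to be counted are taken extensional,
  that is, \<open>undefined\<close> outside the carrier.\<close>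

definition brace_aut :: "('a, 'c) skew_brace_scheme \<Rightarrow> ('a \<Rightarrow> 'a) set" where
  "brace_aut B = brace_hom B B \<inter> Bij (carrier B)"

abbreviation Zstar :: "nat \<Rightarrow> int monoid" where
  "Zstar p \<equiv> units_of (residue_ring (int p))"

definition Hom_circ :: "nat \<Rightarrow> ('a, 'c) skew_brace_scheme \<Rightarrow> ('a \<Rightarrow> int) set" where
  "Hom_circ p B = hom (circ_group B) (Zstar p) \<inter> extensional (carrier B)"

definition Hom_brace :: "nat \<Rightarrow> ('a, 'c) skew_brace_scheme \<Rightarrow> ('a \<Rightarrow> int) set" where
  "Hom_brace p B = hom B (Zstar p) \<inter> hom (circ_group B) (Zstar p) \<inter> extensional (carrier B)"

definition triv_hom :: "nat \<Rightarrow> ('a, 'c) skew_brace_scheme \<Rightarrow> 'a \<Rightarrow> int" where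
  "triv_hom p B = (\<lambda>a\<in>carrier B. \<one>\<^bsub>Zstar p\<^esub>)"

text \<open>The right action \<open>(g, \<sigma>) \<mapsto> \<sigma> g\<close>. The library constants \<open>orbits\<close> and \<open>stabilizer\<close> use only
  the carrier of the acting group, so they may be applied to right actions as well.\<close>

definition ract :: "('a, 'c) skew_brace_scheme \<Rightarrow> ('a \<Rightarrow> 'a) \<Rightarrow> ('a \<Rightarrow> int) \<Rightarrow> 'a \<Rightarrow> int" where
  "ract B g \<sigma> = compose (carrier B) \<sigma> g"

definition Aut_brace :: "('a, 'c) skew_brace_scheme \<Rightarrow> ('a \<Rightarrow> 'a) monoid" where
  "Aut_brace B = BijGroup (carrier B) \<lparr>carrier := brace_aut B\<rparr>"

definition Sigma_set :: "('a, 'c) skew_brace_scheme \<Rightarrow> ('a \<Rightarrow> int) \<Rightarrow> ('a \<Rightarrow> 'a) set" where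
  "Sigma_set B \<sigma> = {g \<in> auto B. ract B g \<sigma> = \<sigma>}"

definition A_group :: "('a, 'c) skew_brace_scheme \<Rightarrow> ('a \<Rightarrow> int) \<Rightarrow> ('a \<Rightarrow> 'a) monoid" where
  "A_group B \<sigma> = BijGroup (carrier B) \<lparr>carrier := brace_aut B \<inter> Sigma_set B \<sigma>\<rparr>"

definition sub_p :: "nat \<Rightarrow> ('a, 'c) skew_brace_scheme \<Rightarrow> 'a set" where
  "sub_p p B = (THE P. subgroup P B \<and> card P = p)"

text \<open>Both operations of the quotient are the setwise products of cosets. For an ideal \<open>I\<close> the
  cosets of \<open>I\<close> in the two groups are the same sets.\<close>

definition quot_brace :: "('a, 'c) skew_brace_scheme \<Rightarrow> 'a set \<Rightarrow> 'a set skew_brace" where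
  "quot_brace B I = \<lparr>carrier = rcosets\<^bsub>B\<^esub> I, monoid.mult = set_mult B, one = I,
     circ = set_mult (circ_group B)\<rparr>"

text \<open>The identification of the automorphism group of \<open>P\<close> with the units modulo \<open>p\<close> sends a unit
  \<open>k\<close> to \<open>x \<mapsto> x\<^sup>k\<close>; it does not depend on the choice of an isomorphism from \<open>P\<close> to the integers
  modulo \<open>p\<close>.\<close>

definition sigma_of :: "nat \<Rightarrow> ('a, 'c) skew_brace_scheme \<Rightarrow> 'a set \<Rightarrow> int" where
  "sigma_of p B = (\<lambda>X\<in>carrier (quot_brace B (sub_p p B)).
     THE k. k \<in> carrier (Zstar p) \<and>
       (\<forall>a\<in>X. \<forall>x\<in>sub_p p B. a \<otimes>\<^bsub>B\<^esub> x \<otimes>\<^bsub>B\<^esub> inv\<^bsub>B\<^esub> a = x [^]\<^bsub>B\<^esub> k))"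

definition additive_pair ::
    "nat \<Rightarrow> ('a, 'c) skew_brace_scheme \<Rightarrow> 'a set skew_brace \<times> ('a set \<Rightarrow> int)" where
  "additive_pair p B = (quot_brace B (sub_p p B), sigma_of p B)"

definition pair_isomorphic ::
    "'a skew_brace \<times> ('a \<Rightarrow> int) \<Rightarrow> 'b skew_brace \<times> ('b \<Rightarrow> int) \<Rightarrow> bool" where
  "pair_isomorphic = (\<lambda>(C, \<sigma>) (C', \<sigma>'). \<exists>f\<in>brace_iso C C'. \<forall>x\<in>carrier C. \<sigma>' (f x) = \<sigma> x)"

definition additive_structures ::
    "nat \<Rightarrow> nat \<Rightarrow> (nat set skew_brace \<times> (nat set \<Rightarrow> int)) set set" where
  "additive_structures p m = iso_classes pair_isomorphic (additive_pair p ` skew_braces m)"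

definition additive_structures_over ::
    "nat \<Rightarrow> nat \<Rightarrow> 'b skew_brace \<Rightarrow> (nat set skew_brace \<times> (nat set \<Rightarrow> int)) set set" where
  "additive_structures_over p m C = iso_classes pair_isomorphic
     (additive_pair p ` {B \<in> skew_braces m. brace_isomorphic (quot_brace B (sub_p p B)) C})"

definition semidirect_brace ::
    "nat \<Rightarrow> ('a \<Rightarrow> int) \<Rightarrow> ('a, 'c) skew_brace_scheme \<Rightarrow> (int \<times> 'a) skew_brace" where
  "semidirect_brace p \<tau> B = (let Z = residue_ring (int p) in
     \<lparr>carrier = carrier Z \<times> carrier B,
      monoid.mult = (\<lambda>(m, a) (m', b). (m \<oplus>\<^bsub>Z\<^esub> m', a \<otimes>\<^bsub>B\<^esub> b)),
      one = (\<zero>\<^bsub>Z\<^esub>, \<one>\<^bsub>B\<^esub>),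
      circ = (\<lambda>(m, a) (m', b). (m \<oplus>\<^bsub>Z\<^esub> (\<tau> a \<otimes>\<^bsub>Z\<^esub> m'), a \<bullet>\<^bsub>B\<^esub> b))\<rparr>)"

definition matrices :: "nat \<Rightarrow> ('a, 'c) ring_scheme \<Rightarrow> (nat \<Rightarrow> nat \<Rightarrow> 'a) set" where
  "matrices m R = {..<m} \<rightarrow>\<^sub>E ({..<m} \<rightarrow>\<^sub>E carrier R)"

definition matrix_mult :: "nat \<Rightarrow> ('a, 'c) ring_scheme \<Rightarrow>
    (nat \<Rightarrow> nat \<Rightarrow> 'a) \<Rightarrow> (nat \<Rightarrow> nat \<Rightarrow> 'a) \<Rightarrow> nat \<Rightarrow> nat \<Rightarrow> 'a" where
  "matrix_mult m R X Y =
     (\<lambda>i\<in>{..<m}. \<lambda>j\<in>{..<m}. \<Oplus>\<^bsub>R\<^esub>k\<in>{..<m}. X i k \<otimes>\<^bsub>R\<^esub> Y k j)"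

definition matrix_one :: "nat \<Rightarrow> ('a, 'c) ring_scheme \<Rightarrow> nat \<Rightarrow> nat \<Rightarrow> 'a" where
  "matrix_one m R = (\<lambda>i\<in>{..<m}. \<lambda>j\<in>{..<m}. if i = j then \<one>\<^bsub>R\<^esub> else \<zero>\<^bsub>R\<^esub>)"

definition GL :: "nat \<Rightarrow> ('a, 'c) ring_scheme \<Rightarrow> (nat \<Rightarrow> nat \<Rightarrow> 'a) set" where
  "GL m R = {X \<in> matrices m R. \<exists>Y\<in>matrices m R.
     matrix_mult m R X Y = matrix_one m R \<and> matrix_mult m R Y X = matrix_one m R}"

definition theta :: "nat \<Rightarrow> nat" where
  "theta n = (\<Prod>q\<in>prime_factors n. card (GL (multiplicity q n) (residue_ring (int q))))"

end

theory Submission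
  imports Defs
begin

text \<open>Let \<open>E\<close> be a skew brace of size \<open>np\<close>. Its subgroup \<open>P\<close> of order \<open>p\<close> is an ideal; put \<open>C = E/P\<close>, and let \<open>\<sigma>\<close> and
  \<open>\<tau>\<close> be the actions of \<open>C\<close> on \<open>P\<close> by conjugation in the additive and in the multiplicative group.
  For \<open>x\<close> in \<open>P\<close> the automorphism \<open>\<lambda>\<^sub>x\<close> is trivial on \<open>P\<close> and on \<open>E/P\<close>, hence a 1-cocycle of \<open>C\<close> with
  values in \<open>P\<close>, hence a coboundary since \<open>p\<close> does not divide the order of \<open>C\<close>. Comparing the
  two conjugations then leaves two cases: \<open>x \<circ> b = x b\<close> for all \<open>b\<close>, or \<open>x \<circ> b = b x\<close> for all \<open>b\<close>. They
  are exchanged by passing to the opposite brace and coincide exactly when \<open>\<sigma> = 1\<close>, whence the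
  factor 2.

  In the first case two averagings over \<open>C\<close>, one making a set-theoretic retraction \<open>E \<rightarrow> P\<close> an
  additive cocycle and one making it equivariant under \<open>\<lambda>\<close>, identify \<open>E\<close> with \<open>\<int>\<^sub>p \<times> C\<close>, where the additive
  group is the semidirect product by \<open>\<sigma>\<close> and the multiplicative group the one by \<open>\<tau>\<close>. So \<open>E\<close> is
  determined by \<open>C\<close>, \<open>\<sigma>\<close>, \<open>\<tau>\<close> and the case, up to isomorphisms of \<open>C\<close>, and the sums over stabilizers
  are orbit counts.\<close>

section \<open>Group extensions with kernel of prime order\<close>

text \<open>The obstacle is that a splitting of E over C has to serve both groups at once. Splitting
  the additive group alone is the classical argument for coprime orders, but the resulting
  complement is in general not stable under \<lambda>. Averaging over C under \<lambda> repairs this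
  only when \<lambda> factors through C, which is the first of the two cases; this is why the second
  case is never split directly but always handled through opposites. The order of the averages
  matters: the second one keeps what the first achieved because \<sigma> is invariant under
  \<lambda>. Elements of P are handled as integer exponents of one generator. Exponents are
  determined modulo \<open>p\<close> only, so most identities are congruences. The quotient C is
  presented by an arbitrary surjection with kernel P instead of the brace of cosets. An automorphism
  of C then acts by changing the surjection, and isomorphism of braces of size \<open>n * p\<close>
  becomes equality of orbits of the data on a fixed C.\<close>

lemma Zstar_mult [simp]: "x \<otimes>\<^bsub>Zstar p\<^esub> y = (x * y) mod int p"
  by (simp add: units_of_mult residue_ring_def)

lemma Zstar_one [simp]: "\<one>\<^bsub>Zstar p\<^esub> = 1"
  by (simp add: units_of_one residue_ring_def)

lemma Zstar_carrier:
  assumes "prime p"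
  shows "carrier (Zstar p) = {0<..<int p}"
proof -
  interpret residues_prime p "residue_ring (int p)"
    using assms by unfold_locales auto
  show ?thesis
    unfolding units_of_carrier res_prime_units_eq by auto
qed

lemma group_Zstar:
  assumes "prime p"
  shows "group (Zstar p)"
proof -
  interpret residues_prime p "residue_ring (int p)"
    using assms by unfold_locales auto
  show ?thesis
    by (rule units_group)
qed

lemma Zstar_cong_eq:
  assumes "prime p" "x \<in> carrier (Zstar p)" "y \<in> carrier (Zstar p)" "[x = y] (mod int p)"
  shows "x = y"
  using assms by (auto simp: Zstar_carrier cong_def)

lemma Zstar_coprime:
  assumes "prime p" "x \<in> carrier (Zstar p)"
  shows "coprime x (int p)"
proof -
  have "\<not> int p dvd x"
    using assms zdvd_not_zless by (auto simp: Zstar_carrier)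
  then show ?thesis
    using assms(1) by (metis coprime_commute prime_imp_coprime prime_nat_int_transfer)
qed

lemma Zstar_mod:
  assumes "prime p" "\<not> int p dvd x"
  shows "x mod int p \<in> carrier (Zstar p)"
  using assms by (auto simp: Zstar_carrier prime_gt_0_nat dvd_eq_mod_eq_0
      intro!: le_neq_trans)

lemma hom_ZstarI:
  assumes "prime p" "\<And>x. x \<in> carrier G \<Longrightarrow> f x \<in> carrier (Zstar p)"
    "\<And>x y. \<lbrakk>x \<in> carrier G; y \<in> carrier G\<rbrakk> \<Longrightarrow> f (x \<otimes>\<^bsub>G\<^esub> y) \<in> carrier (Zstar p) \<and>
       [f (x \<otimes>\<^bsub>G\<^esub> y) = f x * f y] (mod int p)"
  shows "f \<in> hom G (Zstar p)"
proof (rule homI)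
  fix x y assume xy: "x \<in> carrier G" "y \<in> carrier G"
  have "f (x \<otimes>\<^bsub>G\<^esub> y) = f (x \<otimes>\<^bsub>G\<^esub> y) mod int p"
    using assms(3)[OF xy] assms(1) by (simp add: Zstar_carrier)
  then show "f (x \<otimes>\<^bsub>G\<^esub> y) = f x \<otimes>\<^bsub>Zstar p\<^esub> f y"
    using assms(3)[OF xy] by (simp add: cong_def)
qed (use assms in auto)

lemma hom_Zstar_cong:
  assumes "f \<in> hom G (Zstar p)" "x \<in> carrier G" "y \<in> carrier G"
  shows "[f (x \<otimes>\<^bsub>G\<^esub> y) = f x * f y] (mod int p)"
  using hom_mult[OF assms] by (simp add: cong_def)

lemma (in group) cancel_inv_left:
  assumes "a \<in> carrier G" "x \<in> carrier G"
  shows "inv a \<otimes> (a \<otimes> x) = x" "a \<otimes> (inv a \<otimes> x) = x"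
  using assms by (simp_all flip: m_assoc)

text \<open>Each extension of skew braces instantiates this twice with the same projection, once per
  group. Since \<open>p\<close> does not divide \<open>order H\<close>, the kernel is the only
  subgroup of order \<open>p\<close>.\<close>

locale prime_kernel = group_hom G H h for G (structure) and H (structure) and h +
  fixes p :: nat
  assumes prime_p: "prime p"
    and finite_G: "finite (carrier G)"
    and surj_h: "h ` carrier G = carrier H"
    and card_kernel: "card (kernel G H h) = p"
    and p_ndvd: "\<not> p dvd order H"
begin

abbreviation P where "P \<equiv> kernel G H h"

lemma subgroup_P: "subgroup P G"
  by (rule subgroup_kernel)

lemma P_carrier: "x \<in> P \<Longrightarrow> x \<in> carrier G"
  by (simp add: kernel_def)

lemma P_iff: "x \<in> P \<longleftrightarrow> x \<in> carrier G \<and> h x = \<one>\<^bsub>H\<^esub>"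
  by (simp add: kernel_def)

lemma finite_P: "finite P"
  using finite_G by (auto simp: kernel_def)

lemma h_E:
  assumes "c \<in> carrier H"
  obtains a where "a \<in> carrier G" "h a = c"
  using assms unfolding surj_h[symmetric] by (elim imageE) simp

definition gen where "gen = (SOME g. g \<in> P \<and> g \<noteq> \<one>)"

lemma gen: "gen \<in> P" "gen \<noteq> \<one>"
proof -
  have "\<not> P \<subseteq> {\<one>}"
    using card_kernel prime_p prime_ge_2_nat[of p] card_mono[of "{\<one>}" P] by auto
  then have "\<exists>g. g \<in> P \<and> g \<noteq> \<one>"
    by blast
  then have "gen \<in> P \<and> gen \<noteq> \<one>"
    unfolding gen_def by (rule someI_ex)
  then show "gen \<in> P" "gen \<noteq> \<one>" by auto
qed

lemma gen_carrier [simp]: "gen \<in> carrier G"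
  using gen P_carrier by blast

lemma pow_p_P:
  assumes "x \<in> P"
  shows "x [^] p = \<one>"
proof -
  have "group (G\<lparr>carrier := P\<rparr>)"
    using subgroup_P by (simp add: subgroup.subgroup_is_group)
  then have "x [^]\<^bsub>G\<lparr>carrier := P\<rparr>\<^esub> order (G\<lparr>carrier := P\<rparr>) = \<one>\<^bsub>G\<lparr>carrier := P\<rparr>\<^esub>"
    by (rule group.pow_order_eq_1) (use assms in simp)
  then show ?thesis
    by (simp add: order_def card_kernel nat_pow_def)
qed

lemma ord_gen: "G.ord gen = p"
proof -
  have "G.ord gen dvd p"
    using pow_p_P[OF gen(1)] G.pow_eq_id[OF gen_carrier] by simp
  moreover have "G.ord gen \<noteq> 1"
    using gen(2) G.ord_eq_1[OF gen_carrier] by simp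
  ultimately show ?thesis
    using prime_p prime_nat_iff by auto
qed

text \<open>A map from the integers onto the kernel. It depends on an arbitrary generator; the
  factors by which automorphisms of the kernel scale exponents do not.\<close>

definition e :: "int \<Rightarrow> 'a" where "e k = gen [^] k"

lemma e_P: "e k \<in> P"
  unfolding e_def using gen(1) subgroup_P by (intro G.subgroup_int_pow_closed)

lemma e_carrier [simp]: "e k \<in> carrier G"
  using e_P P_carrier by blast

lemma e_add: "e (j + k) = e j \<otimes> e k"
  by (simp add: e_def G.int_pow_mult)

lemma e_0 [simp]: "e 0 = \<one>"
  by (simp add: e_def)

lemma e_minus: "e (- k) = inv (e k)"
  by (simp add: e_def G.int_pow_neg)

lemma e_pow: "e j [^] (k::int) = e (j * k)"
  by (simp add: e_def G.int_pow_pow)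

lemma e_eq_one: "e k = \<one> \<longleftrightarrow> int p dvd k"
  by (simp add: e_def G.int_pow_eq_id ord_gen)

lemma e_eq: "e j = e k \<longleftrightarrow> [j = k] (mod int p)"
proof -
  have "e j = e (j - k) \<otimes> e k"
    by (simp flip: e_add)
  then have "e j = e k \<longleftrightarrow> e (j - k) = \<one>"
    using G.r_cancel_one[of "e k" "e (j - k)"] by simp
  then show ?thesis
    by (simp add: e_eq_one cong_iff_dvd_diff)
qed

lemma P_eq: "P = range e"
proof -
  have "inj_on e {0..<int p}"
    by (auto simp: inj_on_def e_eq cong_def)
  then have "card (e ` {0..<int p}) = card P"
    by (simp add: card_image card_kernel)
  then have "e ` {0..<int p} = P"
    using finite_P e_P by (intro card_subset_eq) auto
  then show ?thesis
    using e_P by blast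
qed

lemma P_E:
  assumes "x \<in> P"
  obtains k where "x = e k"
  using assms P_eq by auto

lemma h_e [simp]: "h (e k) = \<one>\<^bsub>H\<^esub>"
  using e_P[of k] by (simp add: kernel_def)

lemma h_eqE:
  assumes "a \<in> carrier G" "b \<in> carrier G" "h a = h b"
  obtains k where "a = e k \<otimes> b"
proof -
  have "a \<otimes> inv b \<in> P"
    using assms by (simp add: kernel_def)
  then obtain k where "a \<otimes> inv b = e k"
    by (rule P_E)
  then have "a = e k \<otimes> b"
    using assms by (metis e_carrier G.inv_solve_right)
  then show ?thesis by (rule that)
qed

lemma e_comm: "e j \<otimes> e k = e k \<otimes> e j"
  by (simp add: add.commute flip: e_add)

text \<open>Conjugation is an injective endomorphism of a cyclic group of order \<open>p\<close>, so
  it scales exponents by a number prime to \<open>p\<close>.\<close>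

lemma conj_exponent:
  assumes "a \<in> carrier G"
  shows "\<exists>k\<in>carrier (Zstar p). \<forall>j. a \<otimes> e j \<otimes> inv a = e (k * j)"
proof -
  have *: "a \<otimes> e j \<otimes> inv a \<in> P" for j
    using assms e_P[of j] by (simp add: kernel_def)
  obtain k where k: "a \<otimes> e 1 \<otimes> inv a = e k"
    using P_E[OF *] by blast
  have "\<not> int p dvd k"
  proof
    assume "int p dvd k"
    then have "a \<otimes> e 1 \<otimes> inv a = \<one>"
      using k e_eq_one by simp
    then have "e 1 = \<one>"
      using assms G.inv_solve_right'[of \<one> "a \<otimes> e 1" a] G.l_cancel_one'[of a "e 1"] by auto
    then show False
      using prime_p by (simp add: e_eq_one)
  qed
  moreover have "a \<otimes> e j \<otimes> inv a = e ((k mod int p) * j)" for j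
  proof -
    have "(\<lambda>x. a \<otimes> x \<otimes> inv a) \<in> hom G G"
      using assms by (auto intro!: homI simp: G.m_assoc G.cancel_inv_left)
    then have "a \<otimes> (e 1 [^] j) \<otimes> inv a = (a \<otimes> e 1 \<otimes> inv a) [^] j"
      using Group.hom_int_pow[of _ G G "e 1" j] by simp
    then have "a \<otimes> e j \<otimes> inv a = (a \<otimes> e 1 \<otimes> inv a) [^] j"
      by (simp add: e_pow)
    also have "\<dots> = e (k * j)"
      by (simp add: k e_pow)
    also have "\<dots> = e ((k mod int p) * j)"
      by (simp add: e_eq cong_def mod_mult_left_eq)
    finally show ?thesis .
  qed
  ultimately show ?thesis
    using Zstar_mod[OF prime_p] by blast
qed

text \<open>Quantified over the whole fibre of \<open>c\<close>, so that for the projection onto the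
  quotient brace it has the same shape as \<open>sigma_of\<close>.\<close>

definition sig :: "'c \<Rightarrow> int" where
  "sig = (\<lambda>c\<in>carrier H. THE k. k \<in> carrier (Zstar p) \<and>
     (\<forall>a\<in>{a \<in> carrier G. h a = c}. \<forall>x\<in>P. a \<otimes> x \<otimes> inv a = x [^] k))"

lemma sig_ex1:
  assumes "c \<in> carrier H"
  shows "\<exists>!k. k \<in> carrier (Zstar p) \<and>
     (\<forall>a\<in>{a \<in> carrier G. h a = c}. \<forall>x\<in>P. a \<otimes> x \<otimes> inv a = x [^] k)"
proof -
  obtain a where a: "a \<in> carrier G" "h a = c"
    using h_E[OF assms] .
  obtain k where k: "k \<in> carrier (Zstar p)" "\<And>j. a \<otimes> e j \<otimes> inv a = e (k * j)"
    using conj_exponent[OF a(1)] by blast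
  show ?thesis
  proof (rule ex1I, intro conjI ballI)
    fix b x assume b: "b \<in> {a \<in> carrier G. h a = c}" and x: "x \<in> P"
    obtain i where i: "b = e i \<otimes> a"
      using h_eqE[of b a] a b by auto
    obtain j where j: "x = e j"
      using x by (rule P_E)
    \<comment> \<open>Two lifts of \<open>c\<close> differ by an element of the kernel, which is
      abelian, so they conjugate it alike.\<close>
    have "b \<otimes> x \<otimes> inv b = e i \<otimes> (a \<otimes> e j \<otimes> inv a) \<otimes> inv (e i)"
      using a(1) by (simp add: i j G.inv_mult_group G.m_assoc)
    also have "\<dots> = e (k * j)"
      by (simp add: k flip: e_minus e_add)
    finally show "b \<otimes> x \<otimes> inv b = x [^] k"
      by (simp add: j e_pow mult.commute)
  next
    fix l assume l: "l \<in> carrier (Zstar p) \<and>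
     (\<forall>a\<in>{a \<in> carrier G. h a = c}. \<forall>x\<in>P. a \<otimes> x \<otimes> inv a = x [^] l)"
    then have "e k = e l"
      using k(2)[of 1] a e_P[of 1] by (auto simp: e_pow)
    then show "l = k"
      using l k(1) Zstar_cong_eq[OF prime_p] by (metis e_eq)
  qed (use k in auto)
qed

lemma sig_spec:
  assumes "c \<in> carrier H"
  shows "sig c \<in> carrier (Zstar p) \<and>
     (\<forall>a\<in>{a \<in> carrier G. h a = c}. \<forall>x\<in>P. a \<otimes> x \<otimes> inv a = x [^] sig c)"
  unfolding sig_def restrict_apply'[OF assms] by (rule theI'[OF sig_ex1[OF assms]])

lemma sig_mem: "c \<in> carrier H \<Longrightarrow> sig c \<in> carrier (Zstar p)"
  using sig_spec by blast

lemma sig_conj: "\<lbrakk>a \<in> carrier G; x \<in> P\<rbrakk> \<Longrightarrow> a \<otimes> x \<otimes> inv a = x [^] sig (h a)"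
  using sig_spec[of "h a"] by auto

lemma sig_extensional: "sig \<in> extensional (carrier H)"
  by (simp add: sig_def)

lemma conj_e: "a \<in> carrier G \<Longrightarrow> a \<otimes> e j = e (sig (h a) * j) \<otimes> a"
proof -
  assume a: "a \<in> carrier G"
  then have "a \<otimes> e j \<otimes> inv a = e (sig (h a) * j)"
    using sig_conj[OF a e_P] by (simp add: e_pow mult.commute)
  then show ?thesis
    using a by (simp add: G.inv_solve_right')
qed

lemma sig_cong:
  assumes "a \<in> carrier G" "a \<otimes> e 1 = e k \<otimes> a"
  shows "[sig (h a) = k] (mod int p)"
  using assms conj_e[OF assms(1), of 1] by (simp add: e_eq)

lemma sig_unique:
  assumes "a \<in> carrier G" "k \<in> carrier (Zstar p)" "a \<otimes> e 1 = e k \<otimes> a"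
  shows "sig (h a) = k"
  using assms by (intro Zstar_cong_eq[OF prime_p] sig_cong sig_mem) auto

lemma sig_hom: "sig \<in> hom H (Zstar p)"
proof (rule hom_ZstarI[OF prime_p])
  fix c d assume "c \<in> carrier H" "d \<in> carrier H"
  then obtain a b where ab: "a \<in> carrier G" "h a = c" "b \<in> carrier G" "h b = d"
    by (elim h_E)
  have "a \<otimes> b \<otimes> e 1 = a \<otimes> e (sig d) \<otimes> b"
    using ab conj_e[of b 1] by (simp add: G.m_assoc)
  also have "\<dots> = e (sig c * sig d) \<otimes> (a \<otimes> b)"
    using ab conj_e[of a "sig d"] by (simp add: G.m_assoc)
  finally have "a \<otimes> b \<otimes> e 1 = e (sig c * sig d) \<otimes> (a \<otimes> b)" .
  then have "[sig (h (a \<otimes> b)) = sig c * sig d] (mod int p)"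
    using ab by (intro sig_cong) auto
  then show "sig (c \<otimes>\<^bsub>H\<^esub> d) \<in> carrier (Zstar p) \<and>
      [sig (c \<otimes>\<^bsub>H\<^esub> d) = sig c * sig d] (mod int p)"
    using ab sig_mem by auto
qed (rule sig_mem)

text \<open>The image in \<open>H\<close> of an element of \<open>Q\<close> has order dividing both
  \<open>p\<close> and \<open>order H\<close>, hence is trivial.\<close>

lemma subgroup_order_p:
  assumes "subgroup Q G" "card Q = p"
  shows "Q = P"
proof (rule card_subset_eq[OF finite_P])
  show "Q \<subseteq> P"
  proof
    fix x assume x: "x \<in> Q"
    have xG: "x \<in> carrier G"
      using assms(1) x by (rule subgroup.mem_carrier)
    have "group (G\<lparr>carrier := Q\<rparr>)"
      using assms(1) by (simp add: subgroup.subgroup_is_group)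
    then have "x [^]\<^bsub>G\<lparr>carrier := Q\<rparr>\<^esub> order (G\<lparr>carrier := Q\<rparr>) = \<one>\<^bsub>G\<lparr>carrier := Q\<rparr>\<^esub>"
      by (rule group.pow_order_eq_1) (use x in simp)
    then have "x [^] p = \<one>"
      by (simp add: order_def assms(2) nat_pow_def)
    then have "h x [^]\<^bsub>H\<^esub> p = \<one>\<^bsub>H\<^esub>"
      using hom_nat_pow[OF xG, of p] by simp
    then have "H.ord (h x) dvd p"
      using xG by (simp add: H.pow_eq_id)
    moreover have "H.ord (h x) dvd order H"
      using xG by (simp add: H.ord_dvd_group_order)
    ultimately have "H.ord (h x) = 1"
      using prime_p p_ndvd prime_nat_iff by blast
    then show "x \<in> P"
      using xG H.ord_eq_1[of "h x"] by (simp add: P_iff)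
  qed
qed (use assms card_kernel in simp)

lemma order_G: "order G = p * order H"
proof -
  interpret N: normal P G by (rule normal_kernel)
  have "order (G Mod P) = order H"
    using FactGroup_iso_set[OF surj_h] unfolding order_def iso_def by (auto dest: bij_betw_same_card)
  moreover have "card P * order (G Mod P) = order G"
    using G.lagrange[OF subgroup_P] by (simp add: order_def FactGroup_def mult.commute)
  ultimately show ?thesis
    by (simp add: card_kernel)
qed

end

section \<open>Skew braces with an ideal of prime order\<close>

lemma circ_group_simps [simp]:
  "carrier (circ_group B) = carrier B"
  "a \<otimes>\<^bsub>circ_group B\<^esub> b = a \<bullet>\<^bsub>B\<^esub> b"
  "\<one>\<^bsub>circ_group B\<^esub> = \<one>\<^bsub>B\<^esub>"
  by (simp_all add: circ_group_def)

lemma order_circ_group [simp]: "order (circ_group B) = order B"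
  by (simp add: order_def)

lemma kernel_circ_group [simp]: "kernel (circ_group B) (circ_group C) f = kernel B C f"
  by (simp add: kernel_def)

context skew_brace
begin

sublocale circ: group "circ_group B"
  by (rule circ_group)

lemma circ_closed [simp]: "\<lbrakk>a \<in> carrier B; b \<in> carrier B\<rbrakk> \<Longrightarrow> a \<bullet> b \<in> carrier B"
  using circ.m_closed by simp

lemma circ_assoc:
  "\<lbrakk>a \<in> carrier B; b \<in> carrier B; c \<in> carrier B\<rbrakk> \<Longrightarrow> (a \<bullet> b) \<bullet> c = a \<bullet> (b \<bullet> c)"
  using circ.m_assoc by simp

lemma circ_one [simp]: "a \<in> carrier B \<Longrightarrow> a \<bullet> \<one> = a" "a \<in> carrier B \<Longrightarrow> \<one> \<bullet> a = a"
  using circ.r_one circ.l_one by simp_all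

lemma circ_inv_closed [simp]: "a \<in> carrier B \<Longrightarrow> inv\<^bsub>circ_group B\<^esub> a \<in> carrier B"
  using circ.inv_closed by simp

text \<open>The lambda map, by which the multiplicative group acts on the additive one through
  automorphisms.\<close>

definition lam :: "'a \<Rightarrow> 'a \<Rightarrow> 'a" where
  "lam a b = inv a \<otimes> (a \<bullet> b)"

lemma lam_closed [simp]: "\<lbrakk>a \<in> carrier B; b \<in> carrier B\<rbrakk> \<Longrightarrow> lam a b \<in> carrier B"
  by (simp add: lam_def)

lemma circ_eq: "\<lbrakk>a \<in> carrier B; b \<in> carrier B\<rbrakk> \<Longrightarrow> a \<bullet> b = a \<otimes> lam a b"
  by (simp add: lam_def cancel_inv_left)

lemma lam_mult:
  "\<lbrakk>a \<in> carrier B; b \<in> carrier B; c \<in> carrier B\<rbrakk> \<Longrightarrow> lam a (b \<otimes> c) = lam a b \<otimes> lam a c"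
  by (simp add: lam_def circ_mult m_assoc)

lemma lam_hom: "a \<in> carrier B \<Longrightarrow> lam a \<in> hom B B"
  by (rule homI) (simp_all add: lam_mult)

lemma lam_one [simp]: "a \<in> carrier B \<Longrightarrow> lam a \<one> = \<one>"
  by (simp add: lam_def)

lemma one_lam [simp]: "a \<in> carrier B \<Longrightarrow> lam \<one> a = a"
  by (simp add: lam_def)

lemma lam_inv: "\<lbrakk>a \<in> carrier B; b \<in> carrier B\<rbrakk> \<Longrightarrow> lam a (inv b) = inv (lam a b)"
  using lam_mult[of a "inv b" b] inv_equality[of "lam a (inv b)" "lam a b"] by simp

lemma lam_circ:
  assumes "a \<in> carrier B" "b \<in> carrier B" "c \<in> carrier B"
  shows "lam (a \<bullet> b) c = lam a (lam b c)"
proof -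
  have "lam a (lam b c) = inv (lam a b) \<otimes> lam a (b \<bullet> c)"
    using assms by (simp add: lam_def[of b] lam_mult lam_inv)
  also have "\<dots> = inv (lam a b) \<otimes> (inv a \<otimes> (a \<bullet> b \<bullet> c))"
    using assms by (simp add: lam_def[of a "b \<bullet> c"] circ_assoc)
  also have "\<dots> = inv (a \<otimes> lam a b) \<otimes> (a \<bullet> b \<bullet> c)"
    using assms by (simp add: inv_mult_group m_assoc)
  also have "\<dots> = lam (a \<bullet> b) c"
    unfolding lam_def[of "a \<bullet> b"] circ_eq[OF assms(1,2), symmetric] ..
  finally show ?thesis ..
qed

lemma lam_inj:
  assumes "a \<in> carrier B" "b \<in> carrier B" "c \<in> carrier B" "lam a b = lam a c"
  shows "b = c"
proof -
  have "a \<bullet> b = a \<bullet> c"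
    using assms by (simp add: circ_eq)
  then show ?thesis
    using assms circ.Units_l_cancel[of a b c] by simp
qed

end

text \<open>For an ideal \<open>P\<close>: \<open>\<lambda>\<close> is trivial on \<open>P\<close>, in \<open>B\<close> and in the opposite brace, respectively.\<close>

definition plain :: "('a, 'c) skew_brace_scheme \<Rightarrow> 'a set \<Rightarrow> bool" where
  "plain B P \<longleftrightarrow> (\<forall>x\<in>P. \<forall>b\<in>carrier B. x \<bullet>\<^bsub>B\<^esub> b = x \<otimes>\<^bsub>B\<^esub> b)"

definition twisted :: "('a, 'c) skew_brace_scheme \<Rightarrow> 'a set \<Rightarrow> bool" where
  "twisted B P \<longleftrightarrow> (\<forall>x\<in>P. \<forall>b\<in>carrier B. x \<bullet>\<^bsub>B\<^esub> b = b \<otimes>\<^bsub>B\<^esub> x)"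

text \<open>The quotient is any brace that receives a surjection with kernel of order
  \<open>p\<close>, not the brace of cosets. Thus one fixed \<open>C\<close> can serve many
  \<open>E\<close>, and isomorphisms of \<open>C\<close> can be absorbed into \<pi>.\<close>

locale brace_ext =
  fixes E :: "('a, 'c) skew_brace_scheme" (structure) and C :: "('b, 'd) skew_brace_scheme"
    and \<pi> :: "'a \<Rightarrow> 'b" and p :: nat
  assumes brace_E: "skew_brace E" and brace_C: "skew_brace C"
    and hom_pi: "\<pi> \<in> brace_hom E C"
    and surj_pi: "\<pi> ` carrier E = carrier C"
    and prime_p: "prime p"
    and finite_E: "finite (carrier E)"
    and card_ker: "card (kernel E C \<pi>) = p"
    and p_ndvd: "\<not> p dvd order C"

sublocale brace_ext \<subseteq> E: skew_brace E
  by (rule brace_E)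

sublocale brace_ext \<subseteq> C: skew_brace C
  by (rule brace_C)

sublocale brace_ext \<subseteq> add: prime_kernel E C \<pi> p
  using hom_pi surj_pi prime_p finite_E card_ker p_ndvd
  by unfold_locales (simp_all add: brace_hom_def)

sublocale brace_ext \<subseteq> circ: prime_kernel "circ_group E" "circ_group C" \<pi> p
  using hom_pi surj_pi prime_p finite_E card_ker p_ndvd
  by unfold_locales (simp_all add: brace_hom_def)

context brace_ext
begin

abbreviation P where "P \<equiv> kernel E C \<pi>"
abbreviation e where "e \<equiv> add.e"
abbreviation lam where "lam \<equiv> E.lam"
abbreviation \<sigma> where "\<sigma> c \<equiv> add.sig c"
abbreviation \<tau> where "\<tau> c \<equiv> circ.sig c"

lemma pi_closed [simp]: "a \<in> carrier E \<Longrightarrow> \<pi> a \<in> carrier C"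
  by (rule add.hom_closed)

lemma pi_mult [simp]: "\<lbrakk>a \<in> carrier E; b \<in> carrier E\<rbrakk> \<Longrightarrow> \<pi> (a \<otimes> b) = \<pi> a \<otimes>\<^bsub>C\<^esub> \<pi> b"
  by (rule add.hom_mult)

lemma pi_circ [simp]: "\<lbrakk>a \<in> carrier E; b \<in> carrier E\<rbrakk> \<Longrightarrow> \<pi> (a \<bullet> b) = \<pi> a \<bullet>\<^bsub>C\<^esub> \<pi> b"
  using circ.hom_mult by simp

lemma pi_lam [simp]: "\<lbrakk>a \<in> carrier E; b \<in> carrier E\<rbrakk> \<Longrightarrow> \<pi> (lam a b) = C.lam (\<pi> a) (\<pi> b)"
  by (simp add: E.lam_def C.lam_def)

lemma prime_int: "prime (int p)"
  using prime_p by simp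

text \<open>The factor by which \<open>lam a\<close> scales exponents in the kernel. It is
  meaningful modulo \<open>p\<close> only, hence the choice.\<close>

definition \<mu> :: "'a \<Rightarrow> int" where
  "\<mu> a = (SOME m. lam a (e 1) = e m)"

lemma lam_e:
  assumes "a \<in> carrier E"
  shows "lam a (e k) = e (\<mu> a * k)"
proof -
  have "lam a (e 1) \<in> P"
    using assms by (simp add: kernel_def)
  then obtain m where "lam a (e 1) = e m"
    by (rule add.P_E)
  then have 1: "lam a (e 1) = e (\<mu> a)"
    unfolding \<mu>_def by (rule someI)
  have "lam a (e 1 [^] k) = lam a (e 1) [^] k"
    using assms by (intro Group.hom_int_pow[OF E.lam_hom]) auto
  then show ?thesis
    by (simp add: 1 add.e_pow)
qed

lemma mu_ndvd:
  assumes "a \<in> carrier E"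
  shows "\<not> int p dvd \<mu> a"
proof
  assume "int p dvd \<mu> a"
  then have "lam a (e 1) = lam a \<one>"
    using assms lam_e[of a 1] add.e_eq_one[of "\<mu> a"] by simp
  then have "e 1 = \<one>"
    using assms E.lam_inj[of a "e 1" \<one>] by simp
  then show False
    using prime_int by (simp add: add.e_eq_one)
qed

lemma mu_circ:
  assumes "a \<in> carrier E" "b \<in> carrier E"
  shows "[\<mu> (a \<bullet> b) = \<mu> a * \<mu> b] (mod int p)"
proof -
  have "e (\<mu> (a \<bullet> b)) = e (\<mu> a * \<mu> b)"
    using assms E.lam_circ[of a b "e 1"] by (simp add: lam_e)
  then show ?thesis
    by (simp only: add.e_eq)
qed

lemma mu_one: "[\<mu> \<one> = 1] (mod int p)"
  using lam_e[of \<one> 1] by (simp add: add.e_eq cong_sym_eq)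

text \<open>The order of an element of \<open>P\<close> in the multiplicative group divides \<open>p\<close>, hence is prime to
  that of the automorphism group of \<open>P\<close>.\<close>

lemma mu_P:
  assumes "x \<in> P"
  shows "[\<mu> x = 1] (mod int p)"
proof -
  have x: "x \<in> carrier E"
    using assms by (rule add.P_carrier)
  have "[\<mu> (x [^]\<^bsub>circ_group E\<^esub> n) = \<mu> x ^ n] (mod int p)" for n :: nat
  proof (induction n)
    case (Suc n)
    have "x [^]\<^bsub>circ_group E\<^esub> n \<in> carrier E"
      using x E.circ.nat_pow_closed[of x n] by simp
    then show ?case
      using cong_trans[OF mu_circ[OF _ x] cong_scalar_right[OF Suc]] by (simp add: mult.commute)
  qed (simp add: mu_one)
  from this[of p] have "[\<mu> x ^ p = 1] (mod int p)"
    using circ.pow_p_P[of x] assms mu_one by simp (meson cong_sym cong_trans)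
  moreover have "[\<mu> x ^ p = \<mu> x] (mod int p)"
  proof -
    interpret residues "int p" "residue_ring (int p)"
      using prime_gt_1_nat[OF prime_p] by unfold_locales auto
    have "coprime (\<mu> x) (int p)"
      using mu_ndvd[OF x] prime_int prime_imp_coprime coprime_commute by blast
    then have "[\<mu> x ^ totient p * \<mu> x = 1 * \<mu> x] (mod int p)"
      using euler_theorem[of "\<mu> x"] by (intro cong_scalar_right) auto
    then have "[\<mu> x ^ (p - 1) * \<mu> x = \<mu> x] (mod int p)"
      by (simp add: totient_prime[OF prime_p])
    then show ?thesis
      using power_minus_mult[OF prime_gt_0_nat[OF prime_p], of "\<mu> x"] by simp
  qed
  ultimately show ?thesis
    using cong_trans cong_sym by blast
qed

text \<open>By \<open>mu_P\<close> the kernel acts trivially on itself through \<open>lam\<close>,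
  so it is a trivial brace.\<close>

lemma e_circ: "e j \<bullet> e k = e (j + k)"
proof -
  have "lam (e j) (e k) = e (\<mu> (e j) * k)"
    by (simp add: lam_e)
  also have "\<dots> = e k"
    using cong_scalar_right[OF mu_P[OF add.e_P[of j]], of k] by (simp add: add.e_eq)
  finally show ?thesis
    by (simp add: E.circ_eq add.e_add)
qed

text \<open>Lets one parametrisation of the kernel serve both groups, as powers in either of them
  agree there.\<close>

lemma e_circ_pow: "e j [^]\<^bsub>circ_group E\<^esub> k = e (j * k)" for k :: int
proof -
  have nat: "e j [^]\<^bsub>circ_group E\<^esub> n = e (j * int n)" for n :: nat
    by (induction n) (simp_all add: e_circ algebra_simps)
  have inv: "inv\<^bsub>circ_group E\<^esub> (e i) = e (- i)" for i
    using E.circ.inv_equality[of "e (- i)" "e i"] by (simp add: e_circ)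
  show ?thesis
    by (cases "k \<ge> 0") (simp_all add: int_pow_def2 nat inv)
qed

lemma sigma_e: "a \<in> carrier E \<Longrightarrow> a \<otimes> e k = e (\<sigma> (\<pi> a) * k) \<otimes> a"
  by (rule add.conj_e)

lemma tau_e:
  assumes "a \<in> carrier E"
  shows "a \<bullet> e k = e (\<tau> (\<pi> a) * k) \<bullet> a"
proof -
  have "a \<bullet> e k \<bullet> inv\<^bsub>circ_group E\<^esub> a = e (\<tau> (\<pi> a) * k)"
    using circ.sig_conj[of a "e k"] assms add.e_P by (simp add: e_circ_pow mult.commute)
  then show ?thesis
    using assms E.circ.inv_solve_right'[of "e (\<tau> (\<pi> a) * k)" "a \<bullet> e k" a] by simp
qed

lemma tau_cong:
  assumes "a \<in> carrier E" "a \<bullet> e 1 = e k \<bullet> a"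
  shows "[\<tau> (\<pi> a) = k] (mod int p)"
proof -
  have "e (\<tau> (\<pi> a)) = e k"
    using assms tau_e[of a 1] E.circ.right_cancel[of a "e (\<tau> (\<pi> a))" "e k"] by simp
  then show ?thesis
    by (simp only: add.e_eq)
qed

lemma circ_e: "a \<in> carrier E \<Longrightarrow> a \<bullet> e k = e (\<sigma> (\<pi> a) * \<mu> a * k) \<otimes> a"
  by (simp add: E.circ_eq lam_e sigma_e mult.assoc)

text \<open>Apply \<open>lam a\<close> to
  \<open>b \<otimes> e 1 = e (\<sigma> (\<pi> b)) \<otimes> b\<close>. The factor
  \<open>\<mu> a\<close> appears on both sides and cancels, since automorphisms of the kernel are
  commuting scalars.\<close>

lemma sigma_lam:
  assumes "a \<in> carrier E" "b \<in> carrier E"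
  shows "\<sigma> (\<pi> (lam a b)) = \<sigma> (\<pi> b)"
proof -
  have "lam a b \<otimes> lam a (e 1) = lam a (e (\<sigma> (\<pi> b))) \<otimes> lam a b"
    using assms sigma_e[of b 1] by (simp flip: E.lam_mult)
  then have "e (\<sigma> (\<pi> (lam a b)) * \<mu> a) \<otimes> lam a b = e (\<mu> a * \<sigma> (\<pi> b)) \<otimes> lam a b"
    using assms by (simp add: lam_e sigma_e del: pi_lam)
  then have "[\<sigma> (\<pi> (lam a b)) * \<mu> a = \<mu> a * \<sigma> (\<pi> b)] (mod int p)"
    using assms by (simp add: add.e_eq del: pi_lam)
  moreover have "coprime (\<mu> a) (int p)"
    using mu_ndvd[OF assms(1)] prime_int prime_imp_coprime coprime_commute by blast
  ultimately have "[\<sigma> (\<pi> (lam a b)) = \<sigma> (\<pi> b)] (mod int p)"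
    by (simp add: mult.commute cong_mult_lcancel del: pi_lam)
  then show ?thesis
    using assms by (intro Zstar_cong_eq[OF prime_p] add.sig_mem) simp_all
qed

text \<open>The product \<open>c \<bullet> d\<close> arises from \<open>c \<otimes> d\<close> by
  applying \<lambda> to the second factor, which \<sigma> does not see.\<close>

lemma sigma_circ_hom: "add.sig \<in> hom (circ_group C) (Zstar p)"
proof (rule hom_ZstarI[OF prime_p])
  fix c d assume "c \<in> carrier (circ_group C)" "d \<in> carrier (circ_group C)"
  then obtain a b where ab: "a \<in> carrier E" "\<pi> a = c" "b \<in> carrier E" "\<pi> b = d"
    by (auto elim!: add.h_E)
  have "c \<bullet>\<^bsub>C\<^esub> d = c \<otimes>\<^bsub>C\<^esub> \<pi> (lam a b)"
    using ab C.circ_eq[of c d] pi_closed[of a] pi_closed[of b] by simp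
  then have "[\<sigma> (c \<bullet>\<^bsub>C\<^esub> d) = \<sigma> c * \<sigma> (\<pi> (lam a b))] (mod int p)"
    using hom_Zstar_cong[OF add.sig_hom, of c "\<pi> (lam a b)"] ab by (metis E.lam_closed pi_closed)
  then show "\<sigma> (c \<otimes>\<^bsub>circ_group C\<^esub> d) \<in> carrier (Zstar p) \<and>
      [\<sigma> (c \<otimes>\<^bsub>circ_group C\<^esub> d) = \<sigma> c * \<sigma> d] (mod int p)"
    using ab by (metis C.circ_closed sigma_lam add.sig_mem circ_group_simps(2) pi_closed)
qed (use add.sig_mem in simp)

lemma sigma_Hom_brace: "add.sig \<in> Hom_brace p C"
  using add.sig_hom sigma_circ_hom add.sig_extensional by (simp add: Hom_brace_def)

lemma tau_Hom_circ: "circ.sig \<in> Hom_circ p C"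
  using circ.sig_hom circ.sig_extensional by (simp add: Hom_circ_def)

end

section \<open>The action of the ideal\<close>

lemma (in group) bij_betw_mult_right:
  assumes "a \<in> carrier G"
  shows "bij_betw (\<lambda>x. x \<otimes> a) (carrier G) (carrier G)"
proof (rule bij_betw_byWitness[where f' = "\<lambda>x. x \<otimes> inv a"])
qed (use assms in \<open>auto simp: m_assoc\<close>)

context brace_ext
begin

text \<open>Sums over \<open>C\<close> are taken over coset representatives in \<open>E\<close>; for functions that are constant
  on cosets modulo \<open>p\<close> the choice is immaterial modulo \<open>p\<close>.\<close>

definition sec :: "'b \<Rightarrow> 'a" where
  "sec c = (SOME a. a \<in> carrier E \<and> \<pi> a = c)"

lemma sec:
  assumes "c \<in> carrier C"
  shows "sec c \<in> carrier E" "\<pi> (sec c) = c"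
proof -
  have "\<exists>a. a \<in> carrier E \<and> \<pi> a = c"
    using add.h_E[OF assms] by blast
  then have "sec c \<in> carrier E \<and> \<pi> (sec c) = c"
    unfolding sec_def by (rule someI_ex)
  then show "sec c \<in> carrier E" "\<pi> (sec c) = c" by auto
qed

definition invariant :: "('a \<Rightarrow> int) \<Rightarrow> bool" where
  "invariant f \<longleftrightarrow> (\<forall>j. \<forall>b\<in>carrier E. [f (e j \<otimes> b) = f b] (mod int p))"

definition total :: "('a \<Rightarrow> int) \<Rightarrow> int" where
  "total f = (\<Sum>c\<in>carrier C. f (sec c))"

lemma invariantD:
  assumes "invariant f" "a \<in> carrier E" "b \<in> carrier E" "\<pi> a = \<pi> b"
  shows "[f a = f b] (mod int p)"
  using add.h_eqE[OF assms(2-4)] assms by (auto simp: invariant_def)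

lemma total_cong:
  assumes "\<And>a. a \<in> carrier E \<Longrightarrow> [f a = g a] (mod int p)"
  shows "[total f = total g] (mod int p)"
  unfolding total_def using assms sec by (intro cong_sum) auto

text \<open>The elements \<open>\<phi> (sec c)\<close> need not be chosen representatives;
  invariance of \<open>f\<close> absorbs the difference.\<close>

lemma total_reindex:
  assumes f: "invariant f"
    and \<phi>: "\<And>a. a \<in> carrier E \<Longrightarrow> \<phi> a \<in> carrier E"
    and bij: "bij_betw \<psi> (carrier C) (carrier C)"
    and \<psi>: "\<And>a. a \<in> carrier E \<Longrightarrow> \<pi> (\<phi> a) = \<psi> (\<pi> a)"
  shows "[total (\<lambda>x. f (\<phi> x)) = total f] (mod int p)"
proof -
  have "[total (\<lambda>x. f (\<phi> x)) = (\<Sum>c\<in>carrier C. f (sec (\<psi> c)))] (mod int p)"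
    unfolding total_def
  proof (rule cong_sum)
    fix c assume c: "c \<in> carrier C"
    then have "\<psi> c \<in> carrier C"
      using bij bij_betwE by blast
    then show "[f (\<phi> (sec c)) = f (sec (\<psi> c))] (mod int p)"
      using c sec \<phi> \<psi> by (intro invariantD[OF f]) auto
  qed
  also have "(\<Sum>c\<in>carrier C. f (sec (\<psi> c))) = total f"
    unfolding total_def by (rule sum.reindex_bij_betw[OF bij])
  finally show ?thesis .
qed

lemma total_mult:
  assumes "invariant f" "a \<in> carrier E"
  shows "[total (\<lambda>x. f (a \<otimes> x)) = total f] (mod int p)"
proof (rule total_reindex[OF assms(1), where \<psi> = "\<lambda>c. \<pi> a \<otimes>\<^bsub>C\<^esub> c"])
  show "bij_betw ((\<otimes>\<^bsub>C\<^esub>) (\<pi> a)) (carrier C) (carrier C)"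
    using assms(2) C.inj_on_cmult C.surj_const_mult by (auto simp: bij_betw_def)
qed (use assms in auto)

lemma total_circ:
  assumes "invariant f" "a \<in> carrier E"
  shows "[total (\<lambda>x. f (x \<bullet> a)) = total f] (mod int p)"
proof (rule total_reindex[OF assms(1), where \<psi> = "\<lambda>c. c \<bullet>\<^bsub>C\<^esub> \<pi> a"])
  show "bij_betw (\<lambda>c. c \<bullet>\<^bsub>C\<^esub> \<pi> a) (carrier C) (carrier C)"
    using C.circ.bij_betw_mult_right[of "\<pi> a"] assms(2) by simp
qed (use assms in auto)

lemma total_const: "total (\<lambda>x. k) = int (order C) * k"
  by (simp add: total_def order_def)

lemma total_add: "total (\<lambda>x. f x + g x) = total f + total g"
  by (simp add: total_def sum.distrib)

lemma total_scale: "total (\<lambda>x. k * f x) = k * total f"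
  by (simp add: total_def sum_distrib_left)

lemma coprime_order: "coprime (int (order C)) (int p)"
  using p_ndvd prime_p by (metis coprime_commute coprime_int_iff prime_imp_coprime)

text \<open>Turns \<open>total\<close> into an average modulo \<open>p\<close>.\<close>

definition oinv :: int where
  "oinv = (SOME m. [int (order C) * m = 1] (mod int p))"

lemma oinv: "[int (order C) * oinv = 1] (mod int p)"
proof -
  have "\<exists>m. [int (order C) * m = 1] (mod int p)"
    using coprime_order by (rule cong_solve_coprime_int)
  then show ?thesis
    unfolding oinv_def by (rule someI_ex)
qed

lemma coprime_tau: "c \<in> carrier C \<Longrightarrow> coprime (\<tau> c) (int p)"
  using Zstar_coprime[OF prime_p circ.sig_mem] by simp

text \<open>The cocycle given by \<lambda> at the generator of the kernel, with values read as
  exponents. It vanishes modulo \<open>p\<close> exactly in the plain case.\<close>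

definition \<delta> :: "'a \<Rightarrow> int" where
  "\<delta> b = (SOME m. lam (e 1) b = e m \<otimes> b)"

lemma lam_e1:
  assumes "b \<in> carrier E"
  shows "lam (e 1) b = e (\<delta> b) \<otimes> b"
proof -
  obtain m where "lam (e 1) b = e m \<otimes> b"
    using assms by (rule_tac add.h_eqE[of "lam (e 1) b" b]) auto
  then show ?thesis
    unfolding \<delta>_def by (rule someI)
qed

lemma lam_e_e: "lam (e j) (e k) = e k"
proof -
  have "lam (e j) (e k) = e (\<mu> (e j) * k)"
    by (simp add: lam_e)
  then show ?thesis
    using cong_scalar_right[OF mu_P[OF add.e_P[of j]], of k] by (simp add: add.e_eq)
qed

text \<open>The kernel acts trivially on itself through \<open>lam\<close>, so each further
  application of \<open>lam (e 1)\<close> adds the same displacement.\<close>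

lemma lam_e_left:
  assumes "b \<in> carrier E"
  shows "lam (e k) b = e (k * \<delta> b) \<otimes> b"
proof -
  have nat: "lam (e (int n)) b = e (int n * \<delta> b) \<otimes> b" for n
  proof (induction n)
    case (Suc n)
    have "lam (e (int (Suc n))) b = lam (e (int n) \<bullet> e 1) b"
      by (simp add: e_circ add.commute)
    also have "\<dots> = lam (e (int n)) (e (\<delta> b) \<otimes> b)"
      using assms by (simp add: E.lam_circ lam_e1)
    also have "\<dots> = e (\<delta> b) \<otimes> (e (int n * \<delta> b) \<otimes> b)"
      using assms by (simp add: E.lam_mult lam_e_e Suc)
    also have "\<dots> = e (int (Suc n) * \<delta> b) \<otimes> b"
      using assms by (simp add: E.m_assoc add.e_add distrib_right)
    finally show ?case .
  qed (use assms in simp)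
  \<comment> \<open>The induction covers natural exponents only; since \<open>e\<close> depends on
    the residue alone, it reaches all integers.\<close>
  obtain n where n: "k mod int p = int n"
    using prime_gt_0_nat[OF prime_p] by (metis pos_mod_sign of_nat_0_less_iff zero_le_imp_eq_int)
  have "[k = int n] (mod int p)"
    by (simp add: cong_def flip: n)
  then have "e k = e (int n)" "e (k * \<delta> b) = e (int n * \<delta> b)"
    by (simp_all add: add.e_eq cong_scalar_right)
  then show ?thesis
    using nat by simp
qed

lemma delta_cong:
  assumes "b \<in> carrier E" "lam (e 1) b = e k \<otimes> b"
  shows "[\<delta> b = k] (mod int p)"
proof -
  have "e (\<delta> b) = e k"
    using assms lam_e1[of b] by simp
  then show ?thesis
    by (simp only: add.e_eq)
qed

lemma delta_mult:
  assumes "a \<in> carrier E" "b \<in> carrier E"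
  shows "[\<delta> (a \<otimes> b) = \<delta> a + \<sigma> (\<pi> a) * \<delta> b] (mod int p)"
proof (rule delta_cong)
  have "lam (e 1) (a \<otimes> b) = e (\<delta> a) \<otimes> (a \<otimes> e (\<delta> b)) \<otimes> b"
    using assms by (simp add: E.lam_mult lam_e1 E.m_assoc)
  also have "\<dots> = e (\<delta> a + \<sigma> (\<pi> a) * \<delta> b) \<otimes> (a \<otimes> b)"
    using assms unfolding sigma_e[OF assms(1)] by (simp add: E.m_assoc add.e_add)
  finally show "lam (e 1) (a \<otimes> b) = e (\<delta> a + \<sigma> (\<pi> a) * \<delta> b) \<otimes> (a \<otimes> b)" .
qed (use assms in auto)

lemma delta_invariant: "invariant \<delta>"
  unfolding invariant_def
proof (intro allI ballI delta_cong)
  fix j b assume b: "b \<in> carrier E"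
  have "lam (e 1) (e j \<otimes> b) = (e j \<otimes> e (\<delta> b)) \<otimes> b"
    using b by (simp add: E.lam_mult lam_e1 lam_e_e E.m_assoc)
  also have "\<dots> = e (\<delta> b) \<otimes> (e j \<otimes> b)"
    using b by (subst add.e_comm) (simp add: E.m_assoc)
  finally show "lam (e 1) (e j \<otimes> b) = e (\<delta> b) \<otimes> (e j \<otimes> b)" .
qed auto

text \<open>\<open>\<delta>\<close> is a 1-cocycle of a group of order prime to \<open>p\<close>, hence a coboundary.\<close>

lemma delta_coboundary:
  assumes "a \<in> carrier E"
  shows "[int (order C) * \<delta> a = (1 - \<sigma> (\<pi> a)) * total \<delta>] (mod int p)"
proof -
  have "[total \<delta> = total (\<lambda>x. \<delta> (a \<otimes> x))] (mod int p)"
    using total_mult[OF delta_invariant assms] by (rule cong_sym)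
  also have "[total (\<lambda>x. \<delta> (a \<otimes> x)) = total (\<lambda>x. \<delta> a + \<sigma> (\<pi> a) * \<delta> x)] (mod int p)"
    using assms by (intro total_cong delta_mult)
  finally have "[total \<delta> = int (order C) * \<delta> a + \<sigma> (\<pi> a) * total \<delta>] (mod int p)"
    by (simp add: total_add total_const total_scale)
  then have "[total \<delta> - \<sigma> (\<pi> a) * total \<delta> = int (order C) * \<delta> a] (mod int p)"
    by (metis add_diff_cancel_right' cong_diff cong_refl)
  then show ?thesis
    by (simp add: cong_sym left_diff_distrib)
qed

text \<open>By the coboundary formula \<delta> is modulo \<open>p\<close> a function of \<sigma>
  alone, and \<sigma> is invariant under \<lambda>.\<close>

lemma delta_lam:
  assumes "a \<in> carrier E" "b \<in> carrier E"
  shows "[\<delta> (lam a b) = \<delta> b] (mod int p)"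
proof -
  have "[int (order C) * \<delta> (lam a b) = (1 - \<sigma> (\<pi> b)) * total \<delta>] (mod int p)"
    using delta_coboundary[of "lam a b"] assms sigma_lam[OF assms] by simp
  then have "[int (order C) * \<delta> (lam a b) = int (order C) * \<delta> b] (mod int p)"
    using delta_coboundary[OF assms(2)] cong_trans cong_sym by blast
  then show ?thesis
    using coprime_order by (simp add: cong_mult_lcancel)
qed

text \<open>Two expansions of \<open>a \<bullet> e 1\<close>: through \<open>lam a\<close> on the
  kernel, and after moving the kernel element to the left by multiplicative conjugation.\<close>

lemma sigma_mu_tau:
  assumes "a \<in> carrier E"
  shows "[\<sigma> (\<pi> a) * \<mu> a = \<tau> (\<pi> a) * (1 + \<delta> a)] (mod int p)"
proof -
  have "e (\<sigma> (\<pi> a) * \<mu> a) \<otimes> a = e (\<tau> (\<pi> a)) \<bullet> a"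
    using assms circ_e[of a 1] tau_e[of a 1] by simp
  also have "\<dots> = e (\<tau> (\<pi> a) * (1 + \<delta> a)) \<otimes> a"
    using assms by (simp add: E.circ_eq lam_e_left distrib_left add.e_add E.m_assoc)
  finally show ?thesis
    using assms by (simp add: add.e_eq)
qed

text \<open>Compares how the two sides of
  \<open>a \<bullet> e 1 = e (\<tau> (\<pi> a)) \<bullet> a\<close> act on \<open>b\<close> through
  \<lambda>; \<open>delta_lam\<close> removes the remaining \<lambda>.\<close>

lemma mu_delta_tau:
  assumes "a \<in> carrier E" "b \<in> carrier E"
  shows "[\<mu> a * \<delta> b = \<tau> (\<pi> a) * \<delta> b] (mod int p)"
proof -
  have "lam a (lam (e 1) b) = lam (e (\<tau> (\<pi> a))) (lam a b)"
    using assms tau_e[of a 1] by (simp flip: E.lam_circ)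
  then have "e (\<mu> a * \<delta> b) \<otimes> lam a b = e (\<tau> (\<pi> a) * \<delta> (lam a b)) \<otimes> lam a b"
    using assms by (simp add: lam_e1 lam_e_left E.lam_mult lam_e)
  then have "[\<mu> a * \<delta> b = \<tau> (\<pi> a) * \<delta> (lam a b)] (mod int p)"
    using assms by (simp add: add.e_eq)
  then show ?thesis
    using cong_scalar_left[OF delta_lam[OF assms], of "\<tau> (\<pi> a)"] cong_trans by blast
qed

text \<open>A value of \<delta> that is nonzero modulo \<open>p\<close> can be cancelled in
  \<open>mu_delta_tau\<close>. So either \<delta> vanishes, or \<mu> and \<tau> agree everywhere;
  then \<open>sigma_mu_tau\<close> gives \<sigma> = 1 + \<delta>, which says that moving a kernel
  element across \<open>b\<close> additively has the same effect as \<lambda>.\<close>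

theorem plain_or_twisted: "plain E P \<or> twisted E P"
proof (cases "\<forall>b\<in>carrier E. [\<delta> b = 0] (mod int p)")
  case True
  have "plain E P"
    unfolding plain_def
  proof (intro ballI)
    fix x b assume x: "x \<in> P" and b: "b \<in> carrier E"
    obtain k where k: "x = e k"
      using x by (rule add.P_E)
    have "e (k * \<delta> b) = \<one>"
      using True b by (simp add: add.e_eq_one cong_0_iff)
    then show "x \<bullet> b = x \<otimes> b"
      using b by (simp add: k E.circ_eq lam_e_left)
  qed
  then show ?thesis ..
next
  case False
  then obtain c where c: "c \<in> carrier E" "\<not> int p dvd \<delta> c"
    by (auto simp: cong_0_iff)
  then have cop: "coprime (\<delta> c) (int p)"
    using prime_int prime_imp_coprime coprime_commute by blast
  have "twisted E P"
    unfolding twisted_def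
  proof (intro ballI)
    fix x b assume x: "x \<in> P" and b: "b \<in> carrier E"
    obtain k where k: "x = e k"
      using x by (rule add.P_E)
    have "[\<mu> b = \<tau> (\<pi> b)] (mod int p)"
      using mu_delta_tau[OF b c(1)] cop by (simp add: cong_mult_rcancel)
    then have "[\<sigma> (\<pi> b) * \<tau> (\<pi> b) = \<sigma> (\<pi> b) * \<mu> b] (mod int p)"
      by (intro cong_scalar_left) (rule cong_sym)
    then have "[\<tau> (\<pi> b) * \<sigma> (\<pi> b) = \<tau> (\<pi> b) * (1 + \<delta> b)] (mod int p)"
      using cong_trans[OF _ sigma_mu_tau[OF b]] by (simp only: mult.commute)
    then have "[\<sigma> (\<pi> b) = 1 + \<delta> b] (mod int p)"
      using coprime_tau b by (simp add: cong_mult_lcancel)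
    then have "[\<sigma> (\<pi> b) * k = k + k * \<delta> b] (mod int p)"
      using cong_scalar_right[of "\<sigma> (\<pi> b)" "1 + \<delta> b" "int p" k] by (simp add: algebra_simps)
    then have "b \<otimes> e k = e (k + k * \<delta> b) \<otimes> b"
      using b by (simp add: sigma_e add.e_eq)
    then show "x \<bullet> b = b \<otimes> x"
      using b by (simp add: k E.circ_eq lam_e_left add.e_add E.m_assoc)
  qed
  then show ?thesis ..
qed

text \<open>Both conditions together make the kernel additively central. So for \<sigma> \<noteq> 1
  the two cases exclude each other.\<close>

lemma plain_twisted_trivial:
  assumes "plain E P" "twisted E P"
  shows "add.sig = triv_hom p C"
proof (rule extensionalityI[OF add.sig_extensional])
  fix c assume c: "c \<in> carrier C"
  then obtain a where a: "a \<in> carrier E" "\<pi> a = c"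
    by (rule add.h_E)
  have "a \<otimes> e 1 = e 1 \<otimes> a"
    using assms a add.e_P[of 1] unfolding plain_def twisted_def by metis
  then have "\<sigma> (\<pi> a) = 1"
    using a prime_gt_1_nat[OF prime_p] by (intro add.sig_unique) (auto simp: Zstar_carrier[OF prime_p])
  then show "\<sigma> c = triv_hom p C c"
    using a c by (simp add: triv_hom_def)
qed (simp add: triv_hom_def)

lemma trivial_plain:
  assumes "add.sig = triv_hom p C"
  shows "plain E P"
proof -
  have "x \<otimes> b = b \<otimes> x" if "x \<in> P" "b \<in> carrier E" for x b
    using that assms by (elim add.P_E) (simp add: sigma_e triv_hom_def)
  then have "twisted E P \<Longrightarrow> plain E P"
    unfolding plain_def twisted_def by metis
  then show ?thesis
    using plain_or_twisted by blast
qed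

end

section \<open>Double semidirect products\<close>

lemma group_cong:
  assumes "group G" "carrier H = carrier G" "monoid.mult H = monoid.mult G" "one H = one G"
  shows "group H"
proof -
  interpret G: group G by fact
  show ?thesis
    by (rule groupI) (use G.l_inv_ex in \<open>auto simp: assms G.m_assoc\<close>)
qed

definition semi_group :: "nat \<Rightarrow> ('a \<Rightarrow> int) \<Rightarrow> ('a, 'c) monoid_scheme \<Rightarrow> (int \<times> 'a) monoid" where
  "semi_group p \<sigma> G =
    \<lparr>carrier = {0..<int p} \<times> carrier G,
     monoid.mult = (\<lambda>(m, a) (m', b). ((m + \<sigma> a * m') mod int p, a \<otimes>\<^bsub>G\<^esub> b)),
     one = (0, \<one>\<^bsub>G\<^esub>)\<rparr>"

lemma semi_group_simps [simp]:
  "carrier (semi_group p \<sigma> G) = {0..<int p} \<times> carrier G"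
  "(m, a) \<otimes>\<^bsub>semi_group p \<sigma> G\<^esub> (m', b) = ((m + \<sigma> a * m') mod int p, a \<otimes>\<^bsub>G\<^esub> b)"
  "\<one>\<^bsub>semi_group p \<sigma> G\<^esub> = (0, \<one>\<^bsub>G\<^esub>)"
  by (simp_all add: semi_group_def)

lemma mod_add_mult_eq:
  fixes p :: int
  shows "(m + s * (x mod p)) mod p = (m + s * x) mod p"
    and "(m + (s mod p) * x) mod p = (m + s * x) mod p"
  by (metis mod_add_right_eq mod_mult_right_eq) (metis mod_add_right_eq mod_mult_left_eq)

lemma (in group) hom_Zstar_simps:
  assumes "prime p" "\<sigma> \<in> hom G (Zstar p)"
  shows "\<lbrakk>a \<in> carrier G; b \<in> carrier G\<rbrakk> \<Longrightarrow> \<sigma> (a \<otimes> b) = (\<sigma> a * \<sigma> b) mod int p"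
    and "\<sigma> \<one> = 1"
  using hom_mult[OF assms(2)] hom_one[OF assms(2) is_group group_Zstar[OF assms(1)]] by auto

lemma (in group) hom_Zstar_inv:
  assumes "prime p" "\<sigma> \<in> hom G (Zstar p)" "a \<in> carrier G"
  shows "(\<sigma> (inv a) * \<sigma> a) mod int p = 1" "(\<sigma> a * \<sigma> (inv a)) mod int p = 1"
  using assms hom_Zstar_simps(1)[OF assms(1,2), of "inv a" a]
    hom_Zstar_simps(1)[OF assms(1,2), of a "inv a"] hom_Zstar_simps(2)[OF assms(1,2)]
  by simp_all

lemma (in group) group_semi_group:
  assumes p: "prime p" and \<sigma>: "\<sigma> \<in> hom G (Zstar p)"
  shows "group (semi_group p \<sigma> G)"
proof (rule groupI)
  note [simp] = hom_Zstar_simps[OF p \<sigma>]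
  have p0: "int p > 0"
    using prime_gt_0_nat[OF p] by simp
  fix x assume x: "x \<in> carrier (semi_group p \<sigma> G)"
  then obtain m a where [simp]: "x = (m, a)" and a: "a \<in> carrier G" "0 \<le> m" "m < int p"
    by auto
  show "\<one>\<^bsub>semi_group p \<sigma> G\<^esub> \<otimes>\<^bsub>semi_group p \<sigma> G\<^esub> x = x"
    using a by simp
  show "\<exists>y\<in>carrier (semi_group p \<sigma> G).
      y \<otimes>\<^bsub>semi_group p \<sigma> G\<^esub> x = \<one>\<^bsub>semi_group p \<sigma> G\<^esub>"
    using a p0 by (intro bexI[of _ "((- (\<sigma> (inv a) * m)) mod int p, inv a)"]) (simp_all add: mod_simps)
  fix y assume y: "y \<in> carrier (semi_group p \<sigma> G)"
  then obtain k b where [simp]: "y = (k, b)" and b: "b \<in> carrier G"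
    by auto
  show "x \<otimes>\<^bsub>semi_group p \<sigma> G\<^esub> y \<in> carrier (semi_group p \<sigma> G)"
    using a b p0 by simp
  fix z assume z: "z \<in> carrier (semi_group p \<sigma> G)"
  then obtain l c where [simp]: "z = (l, c)" and c: "c \<in> carrier G"
    by auto
  show "x \<otimes>\<^bsub>semi_group p \<sigma> G\<^esub> y \<otimes>\<^bsub>semi_group p \<sigma> G\<^esub> z =
      x \<otimes>\<^bsub>semi_group p \<sigma> G\<^esub> (y \<otimes>\<^bsub>semi_group p \<sigma> G\<^esub> z)"
    using a b c by (simp add: mod_add_mult_eq mod_simps m_assoc) (simp add: algebra_simps)
qed (use prime_gt_0_nat[OF p] in auto)

definition model :: "nat \<Rightarrow> ('a \<Rightarrow> int) \<Rightarrow> ('a \<Rightarrow> int) \<Rightarrow> ('a, 'c) skew_brace_scheme \<Rightarrow>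
    (int \<times> 'a) skew_brace" where
  "model p \<sigma> \<tau> C = \<lparr>carrier = {0..<int p} \<times> carrier C,
     monoid.mult = monoid.mult (semi_group p \<sigma> C), one = (0, \<one>\<^bsub>C\<^esub>),
     circ = monoid.mult (semi_group p \<tau> (circ_group C))\<rparr>"

lemma model_simps [simp]:
  "carrier (model p \<sigma> \<tau> C) = {0..<int p} \<times> carrier C"
  "(m, a) \<otimes>\<^bsub>model p \<sigma> \<tau> C\<^esub> (m', b) = ((m + \<sigma> a * m') mod int p, a \<otimes>\<^bsub>C\<^esub> b)"
  "(m, a) \<bullet>\<^bsub>model p \<sigma> \<tau> C\<^esub> (m', b) = ((m + \<tau> a * m') mod int p, a \<bullet>\<^bsub>C\<^esub> b)"
  "\<one>\<^bsub>model p \<sigma> \<tau> C\<^esub> = (0, \<one>\<^bsub>C\<^esub>)"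
  by (simp_all add: model_def)

lemma order_model: "order (model p \<sigma> \<tau> C) = p * order C"
  by (simp add: order_def card_cartesian_product)

lemma semidirect_brace_eq_model: "semidirect_brace p \<tau> C = model p (\<lambda>_. 1) \<tau> C"
proof -
  have "{0..int p - 1} = {0..<int p}"
    by auto
  then show ?thesis
    by (simp add: semidirect_brace_def model_def residue_ring_def semi_group_def fun_eq_iff mod_simps)
qed

lemma kernel_model: "kernel (model p \<sigma> \<tau> C) C snd = {0..<int p} \<times> ({\<one>\<^bsub>C\<^esub>} \<inter> carrier C)"
  by (auto simp: kernel_def)

locale model_data = skew_brace C for C :: "('b, 'd) skew_brace_scheme" (structure) +
  fixes \<sigma> \<tau> :: "'b \<Rightarrow> int" and p :: nat
  assumes p: "prime p" and p_ndvd: "\<not> p dvd order C" and finite_C: "finite (carrier C)"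
    and \<sigma>_hom: "\<sigma> \<in> hom C (Zstar p)" and \<sigma>_circ: "\<sigma> \<in> hom (circ_group C) (Zstar p)"
    and \<tau>_hom: "\<tau> \<in> hom (circ_group C) (Zstar p)"
begin

abbreviation M where "M \<equiv> model p \<sigma> \<tau> C"

lemma group_M: "group M"
  by (rule group_cong[OF group_semi_group[OF p \<sigma>_hom]]) (simp_all add: model_def)

lemma circ_group_M: "circ_group M = semi_group p \<tau> (circ_group C)"
  by (simp add: circ_group_def model_def semi_group_def)

lemma inv_M:
  assumes "m \<in> {0..<int p}" "a \<in> carrier C"
  shows "inv\<^bsub>M\<^esub> (m, a) = ((- (\<sigma> (inv a) * m)) mod int p, inv a)"
  using assms prime_gt_0_nat[OF p]
  by (intro group.inv_equality[OF group_M]) (simp_all add: mod_simps)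

text \<open>The value of \<sigma> at \<open>a \<bullet> b\<close> enters the first coordinate of the
  brace identity, so \<sigma> must be multiplicative for both operations.\<close>

lemma skew_brace_M: "skew_brace M"
proof (intro skew_brace.intro[OF group_M] skew_brace_axioms.intro)
  show "group (circ_group M)"
    unfolding circ_group_M by (rule circ.group_semi_group[OF p \<tau>_hom])
  fix x y z
  assume "x \<in> carrier M" "y \<in> carrier M" "z \<in> carrier M"
  then obtain m a k b l c where xyz: "x = (m, a)" "y = (k, b)" "z = (l, c)"
    and abc: "a \<in> carrier C" "b \<in> carrier C" "c \<in> carrier C" and m: "m \<in> {0..<int p}"
    by (cases x, cases y, cases z) auto
  define u v w t where "u = \<sigma> a" and "v = \<sigma> b" and "w = \<sigma> (inv a)" and "t = \<tau> a"
  have \<sigma>: "\<sigma> (a \<bullet> b) = (u * v) mod int p" "\<sigma> ((a \<bullet> b) \<otimes> inv a) = (u * v * w) mod int p"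
    using circ.hom_Zstar_simps(1)[OF p \<sigma>_circ, of a b] hom_Zstar_simps(1)[OF p \<sigma>_hom] abc
    by (simp_all add: u_def v_def w_def mod_simps)
  have "int p dvd u * w - 1"
    using hom_Zstar_inv(2)[OF p \<sigma>_hom abc(1)] prime_gt_1_nat[OF p]
    by (simp add: u_def w_def flip: mod_eq_dvd_iff)
  \<comment> \<open>This multiple of \<open>u * w - 1\<close> is exactly the difference of the two
    first coordinates.\<close>
  then have "int p dvd t * v * l * (u * w - 1)"
    by simp
  then have *: "(m + t * k + u * v * - (w * m) + u * v * w * (m + t * l)) mod int p =
      (m + t * (k + v * l)) mod int p"
    by (simp add: mod_eq_dvd_iff algebra_simps)
  have "x \<bullet>\<^bsub>M\<^esub> y \<otimes>\<^bsub>M\<^esub> inv\<^bsub>M\<^esub> x =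
      ((m + t * k + u * v * - (w * m)) mod int p, (a \<bullet> b) \<otimes> inv a)"
    unfolding xyz inv_M[OF m abc(1)] model_simps \<sigma>
    by (simp only: w_def t_def mod_add_mult_eq mod_add_left_eq)
  then have "x \<bullet>\<^bsub>M\<^esub> y \<otimes>\<^bsub>M\<^esub> inv\<^bsub>M\<^esub> x \<otimes>\<^bsub>M\<^esub> (x \<bullet>\<^bsub>M\<^esub> z) =
      ((m + t * k + u * v * - (w * m) + u * v * w * (m + t * l)) mod int p,
        (a \<bullet> b) \<otimes> inv a \<otimes> (a \<bullet> c))"
    by (simp only: xyz model_simps \<sigma> t_def mod_add_mult_eq mod_add_left_eq)
  also have "\<dots> = x \<bullet>\<^bsub>M\<^esub> (y \<otimes>\<^bsub>M\<^esub> z)"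
    unfolding * using abc by (simp add: xyz circ_mult t_def v_def mod_add_mult_eq)
  finally show "x \<bullet>\<^bsub>M\<^esub> (y \<otimes>\<^bsub>M\<^esub> z) = x \<bullet>\<^bsub>M\<^esub> y \<otimes>\<^bsub>M\<^esub> inv\<^bsub>M\<^esub> x \<otimes>\<^bsub>M\<^esub> (x \<bullet>\<^bsub>M\<^esub> z)" ..
qed

lemma ext_M: "brace_ext M C snd p"
proof (rule brace_ext.intro)
  show "skew_brace M" by (rule skew_brace_M)
  show "skew_brace C" by unfold_locales
  show "snd \<in> brace_hom M C"
    by (auto simp: brace_hom_def hom_def)
  show "snd ` carrier M = carrier C"
    using prime_gt_0_nat[OF p] by force
  show "prime p" by (rule p)
  show "finite (carrier M)"
    using finite_C by simp
  show "card (kernel M C snd) = p"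
    by (simp add: kernel_model)
  show "\<not> p dvd order C" by (rule p_ndvd)
qed

sublocale M: brace_ext M C snd p
  by (rule ext_M)

lemma M_P_E:
  assumes "x \<in> M.P"
  obtains m where "x = (m, \<one>)" "0 \<le> m" "m < int p"
  using assms by (auto simp: kernel_model)

lemma plain_M: "plain M M.P"
  unfolding plain_def
proof (intro ballI)
  fix x b assume x: "x \<in> M.P" and b: "b \<in> carrier M"
  obtain m where "x = (m, \<one>)"
    using x by (rule M_P_E)
  moreover obtain k c where "b = (k, c)" "c \<in> carrier C"
    using b by auto
  ultimately show "x \<bullet>\<^bsub>M\<^esub> b = x \<otimes>\<^bsub>M\<^esub> b"
    using hom_Zstar_simps(2)[OF p \<sigma>_hom] circ.hom_Zstar_simps(2)[OF p \<tau>_hom] by simp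
qed

lemma pow_M: "(m, \<one>) [^]\<^bsub>M\<^esub> n = ((int n * m) mod int p, \<one>)" for n :: nat
proof (induction n)
  case (Suc n)
  then show ?case
    using hom_Zstar_simps(2)[OF p \<sigma>_hom] by (simp add: mod_simps algebra_simps)
qed simp

lemma add_sig_M:
  assumes "c \<in> carrier C"
  shows "M.add.sig c = \<sigma> c"
proof -
  have s: "\<sigma> c \<in> carrier (Zstar p)"
    using hom_in_carrier[OF \<sigma>_hom assms] .
  then obtain n where n: "\<sigma> c = int n"
    by (auto simp: Zstar_carrier[OF p] elim!: nonneg_int_cases[OF less_imp_le])
  obtain m where m: "M.e 1 = (m, \<one>)" "0 \<le> m" "m < int p"
    using M.add.e_P by (rule M_P_E)
  have "(0, c) \<otimes>\<^bsub>M\<^esub> M.e 1 = (M.e 1 [^]\<^bsub>M\<^esub> \<sigma> c) \<otimes>\<^bsub>M\<^esub> (0, c)"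
    using assms by (simp add: m n int_pow_int pow_M)
  then have "M.add.sig (snd (0 :: int, c)) = \<sigma> c"
    using s assms prime_gt_0_nat[OF p] by (intro M.add.sig_unique) (simp_all add: M.add.e_pow)
  then show ?thesis by simp
qed

lemma circ_sig_M:
  assumes "c \<in> carrier C"
  shows "M.circ.sig c = \<tau> c"
proof -
  have s: "\<tau> c \<in> carrier (Zstar p)"
    using hom_in_carrier[OF \<tau>_hom] assms by simp
  then obtain n where n: "\<tau> c = int n"
    by (auto simp: Zstar_carrier[OF p] elim!: nonneg_int_cases[OF less_imp_le])
  obtain m where m: "M.e 1 = (m, \<one>)" "0 \<le> m" "m < int p"
    using M.add.e_P by (rule M_P_E)
  have "(0, c) \<bullet>\<^bsub>M\<^esub> M.e 1 = (M.e 1 [^]\<^bsub>M\<^esub> \<tau> c) \<bullet>\<^bsub>M\<^esub> (0, c)"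
    using assms circ.hom_Zstar_simps(2)[OF p \<tau>_hom] by (simp add: m n int_pow_int pow_M)
  then have "[M.circ.sig (snd (0 :: int, c)) = \<tau> c] (mod int p)"
    using s assms prime_gt_0_nat[OF p] by (intro M.tau_cong) (simp_all add: M.add.e_pow)
  then show ?thesis
    using s assms M.circ.sig_mem by (intro Zstar_cong_eq[OF p]) simp_all
qed

end

section \<open>A retraction onto the kernel compatible with both operations\<close>

context brace_ext
begin

text \<open>\<open>r0\<close> is a retraction onto \<open>P\<close>, read as exponents; \<open>r1\<close> and \<open>r\<close> are its successive averages.\<close>

definition r0 :: "'a \<Rightarrow> int" where
  "r0 b = (SOME k. b = e k \<otimes> sec (\<pi> b))"

lemma r0: "b \<in> carrier E \<Longrightarrow> b = e (r0 b) \<otimes> sec (\<pi> b)"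
proof -
  assume b: "b \<in> carrier E"
  then obtain k where "b = e k \<otimes> sec (\<pi> b)"
    using add.h_eqE[of b "sec (\<pi> b)"] sec[of "\<pi> b"] by auto
  then show ?thesis
    unfolding r0_def by (rule someI)
qed

lemma r0_e:
  assumes "b \<in> carrier E"
  shows "[r0 (e j \<otimes> b) = j + r0 b] (mod int p)"
proof -
  have s: "sec (\<pi> b) \<in> carrier E"
    using assms sec by simp
  have "e (r0 (e j \<otimes> b)) \<otimes> sec (\<pi> b) = e j \<otimes> b"
    using r0[of "e j \<otimes> b"] assms by simp
  also have "\<dots> = e j \<otimes> (e (r0 b) \<otimes> sec (\<pi> b))"
    using r0[OF assms] by simp
  also have "\<dots> = e (j + r0 b) \<otimes> sec (\<pi> b)"
    using s by (simp add: add.e_add E.m_assoc)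
  finally show ?thesis
    using s by (simp add: add.e_eq)
qed

text \<open>Were \<open>r0\<close> already an additive cocycle, every summand would be congruent to
  \<open>r0 b\<close>; this dictates the form of the average.\<close>

definition r1 :: "'a \<Rightarrow> int" where
  "r1 b = oinv * total (\<lambda>x. r0 (b \<otimes> x) - \<sigma> (\<pi> b) * r0 x)"

lemma oinv_cancel: "[oinv * (int (order C) * k + x) = k + oinv * x] (mod int p)"
proof -
  have "oinv * (int (order C) * k + x) = (int (order C) * oinv) * k + oinv * x"
    by (simp add: algebra_simps)
  also have "[\<dots> = 1 * k + oinv * x] (mod int p)"
    using oinv by (intro cong_add cong_mult cong_refl)
  finally show ?thesis
    by simp
qed

lemma r1_e:
  assumes b: "b \<in> carrier E"
  shows "[r1 (e j \<otimes> b) = j + r1 b] (mod int p)"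
proof -
  have "[total (\<lambda>x. r0 (e j \<otimes> b \<otimes> x) - \<sigma> (\<pi> (e j \<otimes> b)) * r0 x) =
      total (\<lambda>x. j + (r0 (b \<otimes> x) - \<sigma> (\<pi> b) * r0 x))] (mod int p)"
  proof (rule total_cong)
    fix x assume x: "x \<in> carrier E"
    have "[r0 (e j \<otimes> (b \<otimes> x)) - \<sigma> (\<pi> b) * r0 x = (j + r0 (b \<otimes> x)) - \<sigma> (\<pi> b) * r0 x] (mod int p)"
      using b x by (intro cong_diff cong_refl r0_e) simp
    then show "[r0 (e j \<otimes> b \<otimes> x) - \<sigma> (\<pi> (e j \<otimes> b)) * r0 x =
        j + (r0 (b \<otimes> x) - \<sigma> (\<pi> b) * r0 x)] (mod int p)"
      using b x by (simp add: E.m_assoc add_diff_eq)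
  qed
  then have "[r1 (e j \<otimes> b) = oinv * total (\<lambda>x. j + (r0 (b \<otimes> x) - \<sigma> (\<pi> b) * r0 x))] (mod int p)"
    unfolding r1_def by (rule cong_scalar_left)
  also have "[oinv * total (\<lambda>x. j + (r0 (b \<otimes> x) - \<sigma> (\<pi> b) * r0 x)) = j + r1 b] (mod int p)"
    unfolding total_add total_const r1_def by (rule oinv_cancel)
  finally show ?thesis .
qed

text \<open>Shifting \<open>x\<close> by \<open>e j\<close> changes both terms by
  \<open>\<sigma> (\<pi> b) * j\<close>.\<close>

lemma r1_invariant:
  assumes b: "b \<in> carrier E"
  shows "invariant (\<lambda>x. r0 (b \<otimes> x) - \<sigma> (\<pi> b) * r0 x)"
  unfolding invariant_def
proof (intro allI ballI)
  fix j x assume x: "x \<in> carrier E"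
  have "b \<otimes> (e j \<otimes> x) = e (\<sigma> (\<pi> b) * j) \<otimes> (b \<otimes> x)"
    using b x sigma_e[OF b, of j] by (simp flip: E.m_assoc)
  then have "[r0 (b \<otimes> (e j \<otimes> x)) - \<sigma> (\<pi> b) * r0 (e j \<otimes> x) =
      (\<sigma> (\<pi> b) * j + r0 (b \<otimes> x)) - \<sigma> (\<pi> b) * (j + r0 x)] (mod int p)"
    using b x by (simp only:) (intro cong_diff cong_mult cong_refl r0_e; simp)
  then show "[r0 (b \<otimes> (e j \<otimes> x)) - \<sigma> (\<pi> b) * r0 (e j \<otimes> x) =
      r0 (b \<otimes> x) - \<sigma> (\<pi> b) * r0 x] (mod int p)"
    by (simp add: algebra_simps)
qed

lemma sigma_mult:
  "\<lbrakk>a \<in> carrier E; b \<in> carrier E\<rbrakk> \<Longrightarrow> [\<sigma> (\<pi> (a \<otimes> b)) = \<sigma> (\<pi> a) * \<sigma> (\<pi> b)] (mod int p)"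
  using hom_Zstar_cong[OF add.sig_hom, of "\<pi> a" "\<pi> b"] by simp

text \<open>The summands satisfy the identity with \<open>b \<otimes> x\<close> in place of
  \<open>x\<close> in one term; summing over all cosets undoes this translation.\<close>

lemma r1_mult:
  assumes a: "a \<in> carrier E" and b: "b \<in> carrier E"
  shows "[r1 (a \<otimes> b) = r1 a + \<sigma> (\<pi> a) * r1 b] (mod int p)"
proof -
  let ?f = "\<lambda>b x. r0 (b \<otimes> x) - \<sigma> (\<pi> b) * r0 x"
  have "[total (?f (a \<otimes> b)) = total (\<lambda>x. ?f a (b \<otimes> x) + \<sigma> (\<pi> a) * ?f b x)] (mod int p)"
  proof (rule total_cong)
    fix x assume x: "x \<in> carrier E"
    have "[?f (a \<otimes> b) x = r0 (a \<otimes> (b \<otimes> x)) - (\<sigma> (\<pi> a) * \<sigma> (\<pi> b)) * r0 x] (mod int p)"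
      using E.m_assoc[OF a b x] by (simp only:) (intro cong_diff cong_mult cong_refl sigma_mult a b)
    then show "[?f (a \<otimes> b) x = ?f a (b \<otimes> x) + \<sigma> (\<pi> a) * ?f b x] (mod int p)"
      by (simp add: algebra_simps)
  qed
  also have "total (\<lambda>x. ?f a (b \<otimes> x) + \<sigma> (\<pi> a) * ?f b x) =
      total (\<lambda>x. ?f a (b \<otimes> x)) + \<sigma> (\<pi> a) * total (?f b)"
    by (simp only: total_add total_scale)
  also have "[\<dots> = total (?f a) + \<sigma> (\<pi> a) * total (?f b)] (mod int p)"
    by (intro cong_add cong_refl total_mult[OF r1_invariant[OF a] b])
  finally have "[r1 (a \<otimes> b) = oinv * (total (?f a) + \<sigma> (\<pi> a) * total (?f b))] (mod int p)"
    unfolding r1_def by (rule cong_scalar_left)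
  then show ?thesis
    by (simp add: r1_def algebra_simps)
qed

abbreviation \<nu> where "\<nu> x \<equiv> \<mu> (inv\<^bsub>circ_group E\<^esub> x)"

lemma nu_mu:
  assumes "x \<in> carrier E"
  shows "[\<nu> x * \<mu> x = 1] (mod int p)"
proof -
  have "inv\<^bsub>circ_group E\<^esub> x \<bullet> x = \<one>"
    using E.circ.l_inv[of x] assms by simp
  then have "[\<mu> \<one> = \<nu> x * \<mu> x] (mod int p)"
    using mu_circ[of "inv\<^bsub>circ_group E\<^esub> x" x] assms by simp
  then show ?thesis
    using mu_one by (rule cong_trans[OF cong_sym])
qed

lemma nu_circ:
  assumes "x \<in> carrier E" "a \<in> carrier E"
  shows "[\<nu> (x \<bullet> a) * \<mu> a = \<nu> x] (mod int p)"
proof -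
  have "[\<nu> (x \<bullet> a) * \<mu> a = \<nu> a * \<nu> x * \<mu> a] (mod int p)"
    using mu_circ[of "inv\<^bsub>circ_group E\<^esub> a" "inv\<^bsub>circ_group E\<^esub> x"]
      E.circ.inv_mult_group[of x a] assms by (intro cong_scalar_right) simp
  also have "\<nu> a * \<nu> x * \<mu> a = \<nu> a * \<mu> a * \<nu> x"
    by simp
  also have "[\<dots> = 1 * \<nu> x] (mod int p)"
    using assms(2) by (intro cong_scalar_right nu_mu)
  finally show ?thesis
    by simp
qed

text \<open>Were \<open>r1\<close> already equivariant under \<lambda>, every summand would be
  congruent to \<open>r1 b\<close>, because \<nu> inverts \<mu>.\<close>

definition r :: "'a \<Rightarrow> int" where
  "r b = oinv * total (\<lambda>x. \<nu> x * r1 (lam x b))"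

lemma r_e:
  assumes b: "b \<in> carrier E"
  shows "[r (e j \<otimes> b) = j + r b] (mod int p)"
proof -
  have "[total (\<lambda>x. \<nu> x * r1 (lam x (e j \<otimes> b))) = total (\<lambda>x. j + \<nu> x * r1 (lam x b))] (mod int p)"
  proof (rule total_cong)
    fix x assume x: "x \<in> carrier E"
    have "[\<nu> x * r1 (e (\<mu> x * j) \<otimes> lam x b) = \<nu> x * (\<mu> x * j + r1 (lam x b))] (mod int p)"
      using b x by (intro cong_scalar_left r1_e) simp
    also have "\<nu> x * (\<mu> x * j + r1 (lam x b)) = (\<nu> x * \<mu> x) * j + \<nu> x * r1 (lam x b)"
      by (simp add: algebra_simps)
    also have "[\<dots> = 1 * j + \<nu> x * r1 (lam x b)] (mod int p)"
      using x by (intro cong_add cong_mult cong_refl nu_mu)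
    finally show "[\<nu> x * r1 (lam x (e j \<otimes> b)) = j + \<nu> x * r1 (lam x b)] (mod int p)"
      using x b by (simp add: E.lam_mult lam_e)
  qed
  then have "[r (e j \<otimes> b) = oinv * total (\<lambda>x. j + \<nu> x * r1 (lam x b))] (mod int p)"
    unfolding r_def by (rule cong_scalar_left)
  also have "[oinv * total (\<lambda>x. j + \<nu> x * r1 (lam x b)) = j + r b] (mod int p)"
    unfolding total_add total_const r_def by (rule oinv_cancel)
  finally show ?thesis .
qed

text \<open>The second average does not spoil the additive cocycle identity: \<lambda> is additive
  and leaves \<sigma> unchanged, so every summand satisfies it.\<close>

lemma r_mult:
  assumes a: "a \<in> carrier E" and b: "b \<in> carrier E"
  shows "[r (a \<otimes> b) = r a + \<sigma> (\<pi> a) * r b] (mod int p)"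
proof -
  let ?g = "\<lambda>b x. \<nu> x * r1 (lam x b)"
  have "[total (?g (a \<otimes> b)) = total (\<lambda>x. ?g a x + \<sigma> (\<pi> a) * ?g b x)] (mod int p)"
  proof (rule total_cong)
    fix x assume x: "x \<in> carrier E"
    have "[r1 (lam x (a \<otimes> b)) = r1 (lam x a) + \<sigma> (\<pi> a) * r1 (lam x b)] (mod int p)"
      using r1_mult[of "lam x a" "lam x b"] sigma_lam[OF x a] x a b by (simp add: E.lam_mult)
    then show "[?g (a \<otimes> b) x = ?g a x + \<sigma> (\<pi> a) * ?g b x] (mod int p)"
      using cong_scalar_left[of _ _ _ "\<nu> x"] by (fastforce simp: algebra_simps)
  qed
  also have "total (\<lambda>x. ?g a x + \<sigma> (\<pi> a) * ?g b x) = total (?g a) + \<sigma> (\<pi> a) * total (?g b)"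
    by (simp only: total_add total_scale)
  finally have "[r (a \<otimes> b) = oinv * (total (?g a) + \<sigma> (\<pi> a) * total (?g b))] (mod int p)"
    unfolding r_def by (rule cong_scalar_left)
  then show ?thesis
    by (simp add: r_def algebra_simps)
qed

context
  assumes plain: "plain E P"
begin

lemma e_circ_eq: "b \<in> carrier E \<Longrightarrow> e j \<bullet> b = e j \<otimes> b"
  using plain add.e_P unfolding plain_def by blast

lemma tau_eq_sigma_mu:
  assumes "a \<in> carrier E"
  shows "[\<tau> (\<pi> a) = \<sigma> (\<pi> a) * \<mu> a] (mod int p)"
proof (rule tau_cong)
  show "a \<bullet> e 1 = e (\<sigma> (\<pi> a) * \<mu> a) \<bullet> a"
    using assms by (simp add: circ_e e_circ_eq)
qed (rule assms)

lemma lam_e_plain: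
  assumes "b \<in> carrier E"
  shows "lam (e j) b = b"
  using assms e_circ_eq[OF assms, of j] by (simp add: E.lam_def E.cancel_inv_left)

text \<open>It is here that the averaging relies on the plain case: \<lambda> then factors through
  \<open>C\<close>, so the sum over coset representatives is well defined modulo
  \<open>p\<close>.\<close>

lemma r_invariant:
  assumes b: "b \<in> carrier E"
  shows "invariant (\<lambda>x. \<nu> x * r1 (lam x b))"
  unfolding invariant_def
proof (intro allI ballI)
  fix j x assume x: "x \<in> carrier E"
  have "e j \<otimes> x = e j \<bullet> x"
    using x by (simp add: e_circ_eq)
  then have lam: "lam (e j \<otimes> x) b = lam x b"
    using b x by (simp add: E.lam_circ lam_e_plain)
  have "inv\<^bsub>circ_group E\<^esub> (e j) = e (- j)"
    using E.circ.inv_equality[of "e (- j)" "e j"] by (simp add: e_circ)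
  then have "\<nu> (e j \<otimes> x) = \<mu> (inv\<^bsub>circ_group E\<^esub> x \<bullet> e (- j))"
    using x \<open>e j \<otimes> x = e j \<bullet> x\<close> E.circ.inv_mult_group[of "e j" x] by simp
  also have "[\<dots> = \<nu> x * \<mu> (e (- j))] (mod int p)"
    using x by (intro mu_circ) auto
  also have "[\<nu> x * \<mu> (e (- j)) = \<nu> x * 1] (mod int p)"
    by (intro cong_scalar_left mu_P add.e_P)
  finally show "[\<nu> (e j \<otimes> x) * r1 (lam (e j \<otimes> x) b) = \<nu> x * r1 (lam x b)] (mod int p)"
    unfolding lam by (simp add: cong_scalar_right)
qed

text \<open>Replacing \<open>x\<close> by \<open>x \<bullet> a\<close> permutes the cosets, and
  \<open>nu_circ\<close> supplies the factor \<open>\<mu> a\<close>.\<close>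

lemma r_lam:
  assumes a: "a \<in> carrier E" and b: "b \<in> carrier E"
  shows "[r (lam a b) = \<mu> a * r b] (mod int p)"
proof -
  have "[total (\<lambda>x. \<nu> x * r1 (lam x (lam a b))) =
      total (\<lambda>x. \<mu> a * (\<nu> (x \<bullet> a) * r1 (lam (x \<bullet> a) b)))] (mod int p)"
  proof (rule total_cong)
    fix x assume x: "x \<in> carrier E"
    have "[\<nu> (x \<bullet> a) * \<mu> a * r1 (lam (x \<bullet> a) b) = \<nu> x * r1 (lam (x \<bullet> a) b)] (mod int p)"
      using nu_circ[OF x a] by (rule cong_scalar_right)
    then show "[\<nu> x * r1 (lam x (lam a b)) = \<mu> a * (\<nu> (x \<bullet> a) * r1 (lam (x \<bullet> a) b))] (mod int p)"
      using x a b by (simp add: E.lam_circ cong_sym mult.commute mult.left_commute)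
  qed
  also have "[total (\<lambda>x. \<mu> a * (\<nu> (x \<bullet> a) * r1 (lam (x \<bullet> a) b))) =
      \<mu> a * total (\<lambda>x. \<nu> x * r1 (lam x b))] (mod int p)"
    unfolding total_scale using total_circ[OF r_invariant[OF b] a] by (rule cong_scalar_left)
  finally have "[r (lam a b) = oinv * (\<mu> a * total (\<lambda>x. \<nu> x * r1 (lam x b)))] (mod int p)"
    unfolding r_def by (rule cong_scalar_left)
  then show ?thesis
    by (simp add: r_def mult.left_commute)
qed

text \<open>Combines \<open>a \<bullet> b = a \<otimes> lam a b\<close> with the relation \<tau> =
  \<sigma> \<mu>, which holds in the plain case.\<close>

lemma r_circ:
  assumes a: "a \<in> carrier E" and b: "b \<in> carrier E"
  shows "[r (a \<bullet> b) = r a + \<tau> (\<pi> a) * r b] (mod int p)"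
proof -
  have "[r (a \<bullet> b) = r a + \<sigma> (\<pi> a) * r (lam a b)] (mod int p)"
    using r_mult[OF a, of "lam a b"] a b by (simp add: E.circ_eq)
  also have "[r a + \<sigma> (\<pi> a) * r (lam a b) = r a + \<sigma> (\<pi> a) * (\<mu> a * r b)] (mod int p)"
    using a b by (intro cong_add cong_scalar_left cong_refl r_lam)
  also have "r a + \<sigma> (\<pi> a) * (\<mu> a * r b) = r a + (\<sigma> (\<pi> a) * \<mu> a) * r b"
    by simp
  also have "[\<dots> = r a + \<tau> (\<pi> a) * r b] (mod int p)"
    using tau_eq_sigma_mu[OF a] by (intro cong_add cong_scalar_right cong_refl) (rule cong_sym)
  finally show ?thesis .
qed

text \<open>Only agreement on the carrier is asked of \<open>s\<close> and \<open>t\<close>, since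
  they are also instantiated by functions that are not extensional, such as the constant 1.\<close>

theorem iso_model:
  assumes "\<And>c. c \<in> carrier C \<Longrightarrow> s c = \<sigma> c" "\<And>c. c \<in> carrier C \<Longrightarrow> t c = \<tau> c"
  shows "(\<lambda>b. (r b mod int p, \<pi> b)) \<in> brace_iso E (model p s t C)"
proof -
  let ?\<Phi> = "\<lambda>b. (r b mod int p, \<pi> b)"
  have p0: "int p > 0"
    using prime_gt_0_nat[OF prime_p] by simp
  have "?\<Phi> \<in> brace_hom E (model p s t C)"
    unfolding brace_hom_def
  proof (intro IntI homI)
    fix a b
    assume ab: "a \<in> carrier E" "b \<in> carrier E"
    then show "?\<Phi> (a \<otimes> b) = ?\<Phi> a \<otimes>\<^bsub>model p s t C\<^esub> ?\<Phi> b"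
      using r_mult[OF ab] by (simp add: assms cong_def mod_simps mod_add_mult_eq)
  next
    fix a b
    assume ab: "a \<in> carrier (circ_group E)" "b \<in> carrier (circ_group E)"
    then show "?\<Phi> (a \<otimes>\<^bsub>circ_group E\<^esub> b) = ?\<Phi> a \<otimes>\<^bsub>circ_group (model p s t C)\<^esub> ?\<Phi> b"
      using r_circ[of a b] by (simp add: assms cong_def mod_simps mod_add_mult_eq)
  qed (use p0 in simp_all)
  moreover have "bij_betw ?\<Phi> (carrier E) (carrier (model p s t C))"
    unfolding bij_betw_def
  proof (intro conjI)
    show "inj_on ?\<Phi> (carrier E)"
    proof (rule inj_onI)
      fix a b assume ab: "a \<in> carrier E" "b \<in> carrier E" "?\<Phi> a = ?\<Phi> b"
      then obtain k where k: "a = e k \<otimes> b"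
        using add.h_eqE[of a b] by auto
      have "[k + r b = r b] (mod int p)"
        using r_e[OF ab(2), of k] ab(3) by (simp add: k cong_def)
      then have "int p dvd k"
        by (simp add: cong_iff_dvd_diff)
      then show "a = b"
        using ab add.e_eq_one by (simp add: k)
    qed
    show "?\<Phi> ` carrier E = carrier (model p s t C)"
    proof
      show "?\<Phi> ` carrier E \<subseteq> carrier (model p s t C)"
        using p0 by auto
      show "carrier (model p s t C) \<subseteq> ?\<Phi> ` carrier E"
      proof
        fix y assume "y \<in> carrier (model p s t C)"
        then obtain m c where y: "y = (m, c)" "0 \<le> m" "m < int p" "c \<in> carrier C"
          by (cases y) auto
        obtain b where b: "b \<in> carrier E" "\<pi> b = c"
          using y(4) by (rule add.h_E)
        \<comment> \<open>Translation by \<open>e j\<close> shifts \<open>r\<close> by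
          \<open>j\<close> within a fibre, so this translate of \<open>b\<close> attains the
          prescribed residue \<open>m\<close>.\<close>
        have "y = ?\<Phi> (e (m - r b) \<otimes> b)"
          using r_e[OF b(1), of "m - r b"] b y by (simp add: cong_def)
        then show "y \<in> ?\<Phi> ` carrier E"
          using b by (intro image_eqI[where x = "e (m - r b) \<otimes> b"]) simp_all
      qed
    qed
  qed
  ultimately show ?thesis
    by (simp add: brace_iso_def)
qed

end

end

section \<open>Transport along homomorphisms and isomorphisms\<close>

context prime_kernel
begin

lemma sig_eqI:
  assumes "a \<in> carrier G" "k \<in> carrier (Zstar p)" "x \<in> P" "x \<noteq> \<one>" "a \<otimes> x = x [^] k \<otimes> a"
  shows "sig (h a) = k"
proof -
  obtain j where j: "x = e j"
    using assms(3) by (rule P_E)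
  have "[sig (h a) * j = k * j] (mod int p)"
    using assms conj_e[OF assms(1), of j] by (simp add: j e_pow e_eq mult.commute)
  moreover have "coprime j (int p)"
    using assms(4) prime_p by (metis coprime_commute e_eq_one j prime_imp_coprime prime_nat_int_transfer)
  ultimately have "[sig (h a) = k] (mod int p)"
    by (simp add: cong_mult_rcancel)
  then show ?thesis
    using assms sig_mem by (intro Zstar_cong_eq[OF prime_p]) simp_all
qed

text \<open>Conjugation exponents are intrinsic, so an injective homomorphism that maps kernel into
  kernel preserves them. It is applied to isomorphisms, to the identity with two different
  projections, and to inversion on the opposite group.\<close>

lemma sig_transfer:
  assumes "prime_kernel G' H' h' p" "f \<in> hom G G'" "inj_on f (carrier G)"
    and "\<And>x. x \<in> P \<Longrightarrow> f x \<in> kernel G' H' h'" "a \<in> carrier G"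
    and "h' (f a) \<in> carrier H'"
  shows "sig (h a) = prime_kernel.sig G' H' h' p (h' (f a))"
proof -
  interpret G': prime_kernel G' H' h' p by fact
  interpret f: group_hom G G' f
    using assms(2) by unfold_locales
  let ?k = "G'.sig (h' (f a))"
  have eq: "f (a \<otimes> gen) = f (gen [^] ?k \<otimes> a)"
  proof -
    have fg: "f gen \<in> G'.P"
      using assms(4) gen by blast
    have "f a \<otimes>\<^bsub>G'\<^esub> f gen \<otimes>\<^bsub>G'\<^esub> inv\<^bsub>G'\<^esub> f a = f gen [^]\<^bsub>G'\<^esub> ?k"
      using assms(5) fg by (intro G'.sig_conj) auto
    then have "f a \<otimes>\<^bsub>G'\<^esub> f gen = f gen [^]\<^bsub>G'\<^esub> ?k \<otimes>\<^bsub>G'\<^esub> f a"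
      using assms(5) by (simp add: G'.G.inv_solve_right')
    then show ?thesis
      using assms(5) by (simp add: f.hom_int_pow)
  qed
  have "a \<otimes> gen = gen [^] ?k \<otimes> a"
    by (rule inj_onD[OF assms(3) eq]) (use assms(5) in simp_all)
  then show ?thesis
    using assms(5,6) gen G'.sig_mem by (intro sig_eqI[of a _ gen]) auto
qed

text \<open>The same description holds in both groups of a brace, so additive and multiplicative
  cosets of the kernel coincide.\<close>

lemma coset_P:
  assumes "a \<in> carrier G"
  shows "P #> a = {b \<in> carrier G. h b = h a}"
proof
  show "P #> a \<subseteq> {b \<in> carrier G. h b = h a}"
    using assms by (auto simp: r_coset_def kernel_def)
  show "{b \<in> carrier G. h b = h a} \<subseteq> P #> a"
  proof
    fix b assume "b \<in> {b \<in> carrier G. h b = h a}"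
    then obtain k where "b = e k \<otimes> a"
      using h_eqE[of b a] assms by auto
    then show "b \<in> P #> a"
      using e_P unfolding r_coset_def by blast
  qed
qed

end

lemma brace_homD:
  assumes "f \<in> brace_hom B C"
  shows "\<And>a. a \<in> carrier B \<Longrightarrow> f a \<in> carrier C"
    and "\<And>a b. \<lbrakk>a \<in> carrier B; b \<in> carrier B\<rbrakk> \<Longrightarrow> f (a \<otimes>\<^bsub>B\<^esub> b) = f a \<otimes>\<^bsub>C\<^esub> f b"
    and "\<And>a b. \<lbrakk>a \<in> carrier B; b \<in> carrier B\<rbrakk> \<Longrightarrow> f (a \<bullet>\<^bsub>B\<^esub> b) = f a \<bullet>\<^bsub>C\<^esub> f b"
  using assms by (auto simp: brace_hom_def hom_def)

lemma brace_homI: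
  assumes "\<And>a. a \<in> carrier B \<Longrightarrow> f a \<in> carrier C"
    and "\<And>a b. \<lbrakk>a \<in> carrier B; b \<in> carrier B\<rbrakk> \<Longrightarrow> f (a \<otimes>\<^bsub>B\<^esub> b) = f a \<otimes>\<^bsub>C\<^esub> f b"
    and "\<And>a b. \<lbrakk>a \<in> carrier B; b \<in> carrier B\<rbrakk> \<Longrightarrow> f (a \<bullet>\<^bsub>B\<^esub> b) = f a \<bullet>\<^bsub>C\<^esub> f b"
  shows "f \<in> brace_hom B C"
  using assms by (auto simp: brace_hom_def hom_def)

lemma brace_hom_compose:
  assumes "f \<in> brace_hom B C" "g \<in> brace_hom C D"
  shows "(\<lambda>a. g (f a)) \<in> brace_hom B D"
  using brace_homD[OF assms(1)] brace_homD[OF assms(2)] by (intro brace_homI) auto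

lemma brace_isoD:
  assumes "f \<in> brace_iso B C"
  shows "f \<in> brace_hom B C" "bij_betw f (carrier B) (carrier C)" "inj_on f (carrier B)"
    "f ` carrier B = carrier C"
  using assms by (auto simp: brace_iso_def bij_betw_def)

lemma brace_iso_id: "(\<lambda>a. a) \<in> brace_iso B B"
  by (auto simp: brace_iso_def intro!: brace_homI bij_betwI)

lemma brace_iso_compose:
  assumes "f \<in> brace_iso B C" "g \<in> brace_iso C D"
  shows "(\<lambda>a. g (f a)) \<in> brace_iso B D"
  using brace_hom_compose[OF brace_isoD(1)[OF assms(1)] brace_isoD(1)[OF assms(2)]]
    bij_betw_trans[OF brace_isoD(2)[OF assms(1)] brace_isoD(2)[OF assms(2)]]
  by (simp add: brace_iso_def comp_def)

lemma brace_iso_inverse: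
  assumes "skew_brace B" "f \<in> brace_iso B C"
  shows "inv_into (carrier B) f \<in> brace_iso C B"
proof -
  interpret B: skew_brace B by fact
  note f = brace_isoD[OF assms(2)]
  note hom = brace_homD[OF f(1)]
  have *: "inv_into (carrier B) f c \<in> carrier B" "f (inv_into (carrier B) f c) = c"
    if "c \<in> carrier C" for c
    using that unfolding f(4)[symmetric] by (simp_all add: inv_into_into f_inv_into_f)
  have "inv_into (carrier B) f \<in> brace_hom C B"
  proof (rule brace_homI)
    fix a b assume ab: "a \<in> carrier C" "b \<in> carrier C"
    show "inv_into (carrier B) f (a \<otimes>\<^bsub>C\<^esub> b) =
        inv_into (carrier B) f a \<otimes>\<^bsub>B\<^esub> inv_into (carrier B) f b"
      using ab * f(3) by (intro inv_into_f_eq) (simp_all add: hom)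
    show "inv_into (carrier B) f (a \<bullet>\<^bsub>C\<^esub> b) =
        inv_into (carrier B) f a \<bullet>\<^bsub>B\<^esub> inv_into (carrier B) f b"
      using ab * f(3) by (intro inv_into_f_eq) (simp_all add: hom)
  qed (rule *)
  then show ?thesis
    using bij_betw_inv_into[OF f(2)] by (simp add: brace_iso_def)
qed

lemma brace_isomorphic_refl: "brace_isomorphic B B"
  using brace_iso_id unfolding brace_isomorphic_def by blast

lemma brace_isomorphic_sym: "\<lbrakk>skew_brace B; brace_isomorphic B C\<rbrakk> \<Longrightarrow> brace_isomorphic C B"
  using brace_iso_inverse unfolding brace_isomorphic_def by blast

lemma brace_isomorphic_trans:
  "\<lbrakk>brace_isomorphic B C; brace_isomorphic C D\<rbrakk> \<Longrightarrow> brace_isomorphic B D"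
  using brace_iso_compose unfolding brace_isomorphic_def by blast

lemma brace_isomorphic_order: "brace_isomorphic B C \<Longrightarrow> order B = order C"
  using brace_isoD(2) bij_betw_same_card unfolding brace_isomorphic_def order_def by fast

lemma skew_brace_image:
  assumes "skew_brace B" "f \<in> brace_hom B C" "f ` carrier B = carrier C" "\<one>\<^bsub>C\<^esub> = f \<one>\<^bsub>B\<^esub>"
  shows "skew_brace C"
proof -
  interpret B: skew_brace B by fact
  note hom = brace_homD[OF assms(2)]
  have gr: "group C"
    by (rule group_cong[OF B.hom_imp_img_group[of f C]]) (use assms in \<open>auto simp: brace_hom_def\<close>)
  have gr': "group (circ_group C)"
    by (rule group_cong[OF B.circ.hom_imp_img_group[of f "circ_group C"]])
      (use assms in \<open>auto simp: brace_hom_def circ_group_def\<close>)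
  interpret f: group_hom B C f
    using gr assms(2) by (simp add: group_hom_def group_hom_axioms_def brace_hom_def)
  show ?thesis
  proof (intro skew_brace.intro[OF gr] skew_brace_axioms.intro gr')
    fix x y z assume "x \<in> carrier C" "y \<in> carrier C" "z \<in> carrier C"
    then obtain a b c where xyz: "x = f a" "y = f b" "z = f c"
      and abc: "a \<in> carrier B" "b \<in> carrier B" "c \<in> carrier B"
      unfolding assms(3)[symmetric] by (elim imageE)
    have "f (a \<bullet>\<^bsub>B\<^esub> (b \<otimes>\<^bsub>B\<^esub> c)) =
        f (a \<bullet>\<^bsub>B\<^esub> b \<otimes>\<^bsub>B\<^esub> inv\<^bsub>B\<^esub> a \<otimes>\<^bsub>B\<^esub> (a \<bullet>\<^bsub>B\<^esub> c))"
      using B.circ_mult[of a b c] abc by simp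
    then show "x \<bullet>\<^bsub>C\<^esub> (y \<otimes>\<^bsub>C\<^esub> z) = x \<bullet>\<^bsub>C\<^esub> y \<otimes>\<^bsub>C\<^esub> inv\<^bsub>C\<^esub> x \<otimes>\<^bsub>C\<^esub> (x \<bullet>\<^bsub>C\<^esub> z)"
      using abc by (simp add: xyz hom)
  qed
qed

definition image_brace :: "('a \<Rightarrow> 'b) \<Rightarrow> ('a, 'c) skew_brace_scheme \<Rightarrow> 'b skew_brace" where
  "image_brace f B = (let g = inv_into (carrier B) f in
     \<lparr>carrier = f ` carrier B, monoid.mult = (\<lambda>x y. f (g x \<otimes>\<^bsub>B\<^esub> g y)), one = f \<one>\<^bsub>B\<^esub>,
      circ = (\<lambda>x y. f (g x \<bullet>\<^bsub>B\<^esub> g y))\<rparr>)"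

lemma image_brace:
  assumes "skew_brace B" "inj_on f (carrier B)"
  shows "f \<in> brace_iso B (image_brace f B)" "skew_brace (image_brace f B)"
proof -
  have hom: "f \<in> brace_hom B (image_brace f B)"
    using assms(2) by (intro brace_homI) (simp_all add: image_brace_def Let_def)
  then show "f \<in> brace_iso B (image_brace f B)"
    using assms(2) by (simp add: brace_iso_def bij_betw_def image_brace_def Let_def)
  show "skew_brace (image_brace f B)"
    by (rule skew_brace_image[OF assms(1) hom]) (simp_all add: image_brace_def Let_def)
qed

text \<open>Models live on pairs and quotients on sets of cosets, whereas isomorphism classes are
  counted among braces on natural numbers.\<close>

lemma ex_nat_brace:
  fixes B :: "('a, 'c) skew_brace_scheme"
  assumes "skew_brace B" "finite (carrier B)"
  obtains B' :: "nat skew_brace" and f where "B' \<in> skew_braces (order B)" "f \<in> brace_iso B B'"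
proof -
  obtain f :: "'a \<Rightarrow> nat" where f: "inj_on f (carrier B)"
    using finite_imp_inj_to_nat_seg[OF assms(2)] by blast
  note im = image_brace[OF assms(1) f]
  have "order (image_brace f B) = order B"
    using im(1) brace_isomorphic_order unfolding brace_isomorphic_def by fastforce
  then show ?thesis
    using that[of "image_brace f B" f] im by (simp add: skew_braces_def)
qed

section \<open>Opposite braces\<close>

definition op_brace :: "'a skew_brace \<Rightarrow> 'a skew_brace" where
  "op_brace B = B\<lparr>monoid.mult := \<lambda>x y. y \<otimes>\<^bsub>B\<^esub> x\<rparr>"

lemma op_brace_simps [simp]:
  "carrier (op_brace B) = carrier B"
  "x \<otimes>\<^bsub>op_brace B\<^esub> y = y \<otimes>\<^bsub>B\<^esub> x"
  "\<one>\<^bsub>op_brace B\<^esub> = \<one>\<^bsub>B\<^esub>"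
  "x \<bullet>\<^bsub>op_brace B\<^esub> y = x \<bullet>\<^bsub>B\<^esub> y"
  "circ_group (op_brace B) = circ_group B"
  "op_brace (op_brace B) = B"
  "kernel (op_brace B) (op_brace C) f = kernel B C f"
  "order (op_brace B) = order B"
  by (simp_all add: op_brace_def circ_group_def kernel_def order_def)

lemma brace_hom_op [simp]: "brace_hom (op_brace B) (op_brace C) = brace_hom B C"
  by (auto simp: brace_hom_def hom_def)

lemma brace_iso_op [simp]: "brace_iso (op_brace B) (op_brace C) = brace_iso B C"
  by (simp add: brace_iso_def)

lemma brace_isomorphic_op [simp]:
  "brace_isomorphic (op_brace B) (op_brace C) = brace_isomorphic B C"
  by (simp add: brace_isomorphic_def)

context skew_brace
begin

end

lemma group_op_brace:
  assumes "skew_brace B"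
  shows "group (op_brace B)"
proof -
  interpret skew_brace B by fact
  show ?thesis
    by (rule groupI) (use r_inv_ex in \<open>auto simp: m_assoc\<close>)
qed

lemma inv_op_brace:
  assumes "skew_brace B" "x \<in> carrier B"
  shows "inv\<^bsub>op_brace B\<^esub> x = inv\<^bsub>B\<^esub> x"
proof -
  interpret skew_brace B by fact
  show ?thesis
    using assms(2) by (intro group.inv_equality[OF group_op_brace[OF assms(1)]]) simp_all
qed

lemma skew_brace_op_brace:
  assumes "skew_brace B"
  shows "skew_brace (op_brace B)"
proof -
  interpret skew_brace B by fact
  show ?thesis
    by (intro skew_brace.intro[OF group_op_brace[OF assms]] skew_brace_axioms.intro)
      (simp_all add: circ.is_group circ_mult inv_op_brace[OF assms] m_assoc)
qed

lemma brace_ext_op_brace: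
  assumes "brace_ext E C \<pi> p"
  shows "brace_ext (op_brace E) (op_brace C) \<pi> p"
proof -
  interpret brace_ext E C \<pi> p by fact
  show ?thesis
    by (rule brace_ext.intro)
      (simp_all add: skew_brace_op_brace brace_E brace_C hom_pi surj_pi prime_p finite_E card_ker p_ndvd)
qed

lemma plain_op_brace [simp]: "plain (op_brace E) P = twisted E P"
  by (simp add: plain_def twisted_def)

lemma twisted_op_brace [simp]: "twisted (op_brace E) P = plain E P"
  by (simp add: plain_def twisted_def)

text \<open>Conjugation by \<open>a\<close> in the opposite group is conjugation by the inverse of
  \<open>a\<close>; formally, inversion is an injective homomorphism back to the original
  group.\<close>

lemma sig_op_brace:
  assumes "brace_ext E C \<pi> p" "c \<in> carrier C"
  shows "prime_kernel.sig (op_brace E) (op_brace C) \<pi> p c =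
    prime_kernel.sig E C \<pi> p (inv\<^bsub>C\<^esub> c)"
proof -
  interpret brace_ext E C \<pi> p by fact
  interpret op: brace_ext "op_brace E" "op_brace C" \<pi> p
    by (rule brace_ext_op_brace) fact
  obtain a where a: "a \<in> carrier E" "\<pi> a = c"
    using assms(2) by (rule add.h_E)
  have hom: "m_inv E \<in> hom (op_brace E) E"
    by (rule homI) (simp_all add: E.inv_mult_group)
  have "op.add.sig (\<pi> a) = \<sigma> (\<pi> (inv\<^bsub>E\<^esub> a))"
    using a(1) by (intro op.add.sig_transfer[of E C \<pi>] hom)
      (auto simp: add.prime_kernel_axioms kernel_def E.inv_inj)
  then show ?thesis
    using a by simp
qed

section \<open>Classification by quotient and actions\<close>

text \<open>For given \<open>E\<close> and \<open>C\<close> the projection may vary by an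
  automorphism of \<open>C\<close>, and \<sigma> and \<tau> vary with it; hence a relation and not a
  function.\<close>

definition ext_of where
  "ext_of p E C \<pi> \<sigma> \<tau> \<longleftrightarrow> brace_ext E C \<pi> p \<and> prime_kernel.sig E C \<pi> p = \<sigma> \<and>
     prime_kernel.sig (circ_group E) (circ_group C) \<pi> p = \<tau>"

definition plain_p :: "nat \<Rightarrow> ('a, 'c) skew_brace_scheme \<Rightarrow> bool" where
  "plain_p p E \<longleftrightarrow> plain E (sub_p p E)"

lemma (in brace_ext) sub_p_eq: "sub_p p E = P"
  unfolding sub_p_def
proof (rule the_equality)
  show "Q = P" if "subgroup Q E \<and> card Q = p" for Q
    using that add.subgroup_order_p by blast
qed (use add.subgroup_P card_ker in blast)

lemma (in brace_ext) ext_of: "ext_of p E C \<pi> add.sig circ.sig"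
  using brace_ext_axioms by (simp add: ext_of_def)

lemma ext_of_Hom:
  assumes "ext_of p E C \<pi> \<sigma> \<tau>"
  shows "\<sigma> \<in> Hom_brace p C" "\<tau> \<in> Hom_circ p C"
proof -
  interpret brace_ext E C \<pi> p using assms by (simp add: ext_of_def)
  show "\<sigma> \<in> Hom_brace p C" "\<tau> \<in> Hom_circ p C"
    using assms sigma_Hom_brace tau_Hom_circ by (simp_all add: ext_of_def)
qed

lemma ext_of_transfer:
  assumes "ext_of p E C \<pi> \<sigma> \<tau>" "brace_ext E' C' \<pi>' p" "f \<in> brace_iso E' E" "g \<in> brace_iso C' C"
    and "\<And>a. a \<in> carrier E' \<Longrightarrow> \<pi> (f a) = g (\<pi>' a)"
    and "\<sigma>' \<in> extensional (carrier C')" "\<tau>' \<in> extensional (carrier C')"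
    and "\<And>c. c \<in> carrier C' \<Longrightarrow> \<sigma>' c = \<sigma> (g c)" "\<And>c. c \<in> carrier C' \<Longrightarrow> \<tau>' c = \<tau> (g c)"
  shows "ext_of p E' C' \<pi>' \<sigma>' \<tau>'"
proof -
  interpret E: brace_ext E C \<pi> p using assms(1) by (simp add: ext_of_def)
  interpret E': brace_ext E' C' \<pi>' p by fact
  note f = brace_isoD[OF assms(3)] and g = brace_isoD[OF assms(4)]
  have \<sigma>: "E.add.sig = \<sigma>" and \<tau>: "E.circ.sig = \<tau>"
    using assms(1) by (simp_all add: ext_of_def)
  have hom: "f \<in> hom E' E" "f \<in> hom (circ_group E') (circ_group E)"
    "g \<in> hom C' C"
    using f(1) g(1) by (simp_all add: brace_hom_def)
  have g1: "g \<one>\<^bsub>C'\<^esub> = \<one>\<^bsub>C\<^esub>"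
    using hom_one[OF hom(3)] E.C.is_group E'.C.is_group by blast
  have ker: "f x \<in> E.P" if "x \<in> E'.P" for x
    using that brace_homD(1)[OF f(1)] by (auto simp: kernel_def assms(5) g1)
  have "E'.add.sig c = \<sigma>' c \<and> E'.circ.sig c = \<tau>' c" if c: "c \<in> carrier C'" for c
  proof -
    obtain a where a: "a \<in> carrier E'" "\<pi>' a = c"
      using c by (rule E'.add.h_E)
    have fa: "f a \<in> carrier E" "\<pi> (f a) = g c"
      using a brace_homD(1)[OF f(1)] assms(5) by auto
    have "E'.add.sig (\<pi>' a) = E.add.sig (\<pi> (f a))"
      using a f(3) hom(1) ker fa(1)
      by (intro E'.add.sig_transfer E.add.prime_kernel_axioms E.pi_closed) auto
    moreover have "E'.circ.sig (\<pi>' a) = E.circ.sig (\<pi> (f a))"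
      using a f(3) hom(2) ker fa(1)
      by (intro E'.circ.sig_transfer E.circ.prime_kernel_axioms) (auto intro: E.pi_closed)
    ultimately show ?thesis
      using a fa c assms(8,9) by (simp add: \<sigma> \<tau>)
  qed
  then have "E'.add.sig = \<sigma>'" "E'.circ.sig = \<tau>'"
    using E'.add.sig_extensional E'.circ.sig_extensional assms(6,7)
    by (auto intro!: extensionalityI[of _ "carrier C'"])
  then show ?thesis
    using assms(2) by (simp add: ext_of_def)
qed

text \<open>Composing the projection with the inverse of \<open>g\<close> realises the pulled back
  actions on the same \<open>E\<close>. This is how automorphisms of the quotient come to act on the
  data.\<close>

lemma ext_of_iso_quotient:
  assumes "ext_of p E C \<pi> \<sigma> \<tau>" "skew_brace C'" "g \<in> brace_iso C' C"
    and "\<sigma>' \<in> extensional (carrier C')" "\<tau>' \<in> extensional (carrier C')"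
    and "\<And>c. c \<in> carrier C' \<Longrightarrow> \<sigma>' c = \<sigma> (g c)" "\<And>c. c \<in> carrier C' \<Longrightarrow> \<tau>' c = \<tau> (g c)"
  shows "\<exists>\<pi>'. ext_of p E C' \<pi>' \<sigma>' \<tau>'"
proof -
  interpret E: brace_ext E C \<pi> p using assms(1) by (simp add: ext_of_def)
  interpret C': skew_brace C' by fact
  note g = brace_isoD[OF assms(3)]
  let ?g' = "inv_into (carrier C') g"
  let ?\<pi>' = "\<lambda>a. ?g' (\<pi> a)"
  have g': "?g' \<in> brace_iso C C'"
    using assms(2,3) by (rule brace_iso_inverse)
  have g1: "g \<one>\<^bsub>C'\<^esub> = \<one>\<^bsub>C\<^esub>"
    using hom_one[of g C' C] g(1) E.C.is_group C'.is_group by (simp add: brace_hom_def)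
  have gg': "g (?g' c) = c" "?g' c \<in> carrier C'" if "c \<in> carrier C" for c
    using that unfolding g(4)[symmetric] by (simp_all add: f_inv_into_f inv_into_into)
  have g'1: "?g' c = \<one>\<^bsub>C'\<^esub> \<longleftrightarrow> c = \<one>\<^bsub>C\<^esub>" if "c \<in> carrier C" for c
    using gg'[OF that] g1 inv_into_f_f[OF g(3) C'.one_closed] by auto
  have "brace_ext E C' ?\<pi>' p"
  proof (rule brace_ext.intro)
    show "?\<pi>' \<in> brace_hom E C'"
      by (rule brace_hom_compose[OF E.hom_pi brace_isoD(1)[OF g']])
    show "?\<pi>' ` carrier E = carrier C'"
      using brace_isoD(4)[OF g'] by (simp only: image_image[symmetric] E.surj_pi)
    show "card (kernel E C' ?\<pi>') = p"
      using E.card_ker g'1 by (simp add: kernel_def cong: conj_cong)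
    show "\<not> p dvd order C'"
      using E.p_ndvd bij_betw_same_card[OF g(2)] by (simp add: order_def)
  qed (use assms(2) E.brace_E E.prime_p E.finite_E in auto)
  then have "ext_of p E C' ?\<pi>' \<sigma>' \<tau>'"
    using gg' assms by (intro ext_of_transfer[OF assms(1) _ brace_iso_id assms(3)]) auto
  then show ?thesis by blast
qed

lemma ext_of_iso:
  assumes "ext_of p E C \<pi> \<sigma> \<tau>" "skew_brace E'" "f \<in> brace_iso E' E"
  shows "\<exists>\<pi>'. ext_of p E' C \<pi>' \<sigma> \<tau>"
proof -
  interpret E: brace_ext E C \<pi> p using assms(1) by (simp add: ext_of_def)
  interpret E': skew_brace E' by fact
  note f = brace_isoD[OF assms(3)]
  have "brace_ext E' C (\<lambda>a. \<pi> (f a)) p"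
  proof (rule brace_ext.intro)
    show "(\<lambda>a. \<pi> (f a)) \<in> brace_hom E' C"
      by (rule brace_hom_compose[OF f(1) E.hom_pi])
    show "(\<lambda>a. \<pi> (f a)) ` carrier E' = carrier C"
      using f(4) E.surj_pi by (simp only: image_image[symmetric])
    show "finite (carrier E')"
      using E.finite_E f(2) bij_betw_finite by blast
    have "f ` kernel E' C (\<lambda>a. \<pi> (f a)) = E.P"
      using f(4) by (auto simp: kernel_def)
    moreover have "inj_on f (kernel E' C (\<lambda>a. \<pi> (f a)))"
      using f(3) by (rule inj_on_subset) (auto simp: kernel_def)
    ultimately show "card (kernel E' C (\<lambda>a. \<pi> (f a))) = p"
      using E.card_ker card_image by metis
  qed (use assms(2) E.brace_C E.prime_p E.p_ndvd in auto)
  then have "ext_of p E' C (\<lambda>a. \<pi> (f a)) \<sigma> \<tau>"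
    using ext_of_Hom[OF assms(1)]
    by (intro ext_of_transfer[OF assms(1) _ assms(3) brace_iso_id])
      (auto simp: Hom_brace_def Hom_circ_def)
  then show ?thesis by blast
qed

text \<open>Both projections have the unique subgroup of order \<open>p\<close> as kernel.\<close>

lemma ext_of_unique:
  assumes "ext_of p E C \<pi> \<sigma> \<tau>" "ext_of p E C' \<pi>' \<sigma>' \<tau>'"
  shows "\<exists>f\<in>brace_iso C C'. \<forall>c\<in>carrier C. \<sigma>' (f c) = \<sigma> c \<and> \<tau>' (f c) = \<tau> c"
proof -
  interpret E: brace_ext E C \<pi> p using assms(1) by (simp add: ext_of_def)
  interpret E': brace_ext E C' \<pi>' p using assms(2) by (simp add: ext_of_def)
  have P: "E.P = E'.P"
    using E.sub_p_eq E'.sub_p_eq by simp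
  have eq: "\<pi> a = \<pi> b \<longleftrightarrow> \<pi>' a = \<pi>' b" if "a \<in> carrier E" "b \<in> carrier E" for a b
  proof -
    have "\<pi> a = \<pi> b \<longleftrightarrow> a \<in> E.P #>\<^bsub>E\<^esub> b" "\<pi>' a = \<pi>' b \<longleftrightarrow> a \<in> E'.P #>\<^bsub>E\<^esub> b"
      using that by (simp_all add: E.add.coset_P E'.add.coset_P)
    then show ?thesis
      by (simp add: P)
  qed
  define f where "f c = \<pi>' (E.sec c)" for c
  have f: "f (\<pi> a) = \<pi>' a" if "a \<in> carrier E" for a
    using that eq[of "E.sec (\<pi> a)" a] E.sec by (simp add: f_def)
  have "f \<in> brace_hom C C'"
  proof (rule brace_homI)
    fix c d assume "c \<in> carrier C" "d \<in> carrier C"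
    then obtain a b where ab: "a \<in> carrier E" "\<pi> a = c" "b \<in> carrier E" "\<pi> b = d"
      by (elim E.add.h_E)
    then show "f (c \<otimes>\<^bsub>C\<^esub> d) = f c \<otimes>\<^bsub>C'\<^esub> f d" "f (c \<bullet>\<^bsub>C\<^esub> d) = f c \<bullet>\<^bsub>C'\<^esub> f d"
      using f[of "a \<otimes>\<^bsub>E\<^esub> b"] f[of "a \<bullet>\<^bsub>E\<^esub> b"] f[of a] f[of b] by auto
  qed (simp add: f_def E.sec)
  moreover have "bij_betw f (carrier C) (carrier C')"
  proof (intro bij_betw_imageI inj_onI)
    fix c d assume "c \<in> carrier C" "d \<in> carrier C" "f c = f d"
    then show "c = d"
      using eq[of "E.sec c" "E.sec d"] E.sec by (simp add: f_def)
  next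
    show "f ` carrier C = carrier C'"
      using f unfolding E.surj_pi[symmetric] E'.surj_pi[symmetric] by (auto simp: image_iff)
  qed
  ultimately have "f \<in> brace_iso C C'"
    by (simp add: brace_iso_def)
  moreover have "\<sigma>' (f c) = \<sigma> c \<and> \<tau>' (f c) = \<tau> c" if c: "c \<in> carrier C" for c
  proof -
    note sec = E.sec[OF c]
    have "E.add.sig (\<pi> (E.sec c)) = E'.add.sig (\<pi>' (E.sec c))"
      using sec P by (intro E.add.sig_transfer E'.add.prime_kernel_axioms) (auto simp: hom_def)
    moreover have "E.circ.sig (\<pi> (E.sec c)) = E'.circ.sig (\<pi>' (E.sec c))"
      using sec P by (intro E.circ.sig_transfer E'.circ.prime_kernel_axioms) (auto simp: hom_def)
    ultimately show ?thesis
      using assms sec by (simp add: ext_of_def f_def)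
  qed
  ultimately show ?thesis by blast
qed

text \<open>An isomorphism carries the unique subgroup of order \<open>p\<close> to the unique
  subgroup of order \<open>p\<close>.\<close>

lemma plain_p_iso:
  assumes "ext_of p E C \<pi> \<sigma> \<tau>" "skew_brace E'" "f \<in> brace_iso E' E"
  shows "plain_p p E' = plain_p p E"
proof -
  interpret E: brace_ext E C \<pi> p using assms(1) by (simp add: ext_of_def)
  obtain \<pi>' where "ext_of p E' C \<pi>' \<sigma> \<tau>"
    using ext_of_iso[OF assms] by blast
  then interpret E': brace_ext E' C \<pi>' p by (simp add: ext_of_def)
  interpret f: group_hom E' E f
    using brace_isoD(1)[OF assms(3)] by unfold_locales (simp add: brace_hom_def)
  note f = brace_isoD[OF assms(3)]
  note hom = brace_homD[OF f(1)]
  have P: "E.P = f ` E'.P"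
  proof (rule sym, rule E.add.subgroup_order_p)
    show "subgroup (f ` E'.P) E"
      by (rule f.subgroup_img_is_subgroup[OF E'.add.subgroup_P])
    show "card (f ` E'.P) = p"
      using E'.card_ker inj_on_subset[OF f(3)] E'.add.P_carrier by (subst card_image) auto
  qed
  have "plain E E.P \<longleftrightarrow> (\<forall>x\<in>E'.P. \<forall>b\<in>carrier E'. f x \<bullet>\<^bsub>E\<^esub> f b = f x \<otimes>\<^bsub>E\<^esub> f b)"
    unfolding plain_def P f(4)[symmetric] by simp
  also have "\<dots> \<longleftrightarrow> plain E' E'.P"
    unfolding plain_def
  proof (intro ball_cong refl)
    fix x b assume "x \<in> E'.P" "b \<in> carrier E'"
    then show "f x \<bullet>\<^bsub>E\<^esub> f b = f x \<otimes>\<^bsub>E\<^esub> f b \<longleftrightarrow> x \<bullet>\<^bsub>E'\<^esub> b = x \<otimes>\<^bsub>E'\<^esub> b"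
      using inj_on_eq_iff[OF f(3), of "x \<bullet>\<^bsub>E'\<^esub> b" "x \<otimes>\<^bsub>E'\<^esub> b"] E'.add.P_carrier
      by (simp add: hom)
  qed
  finally have "plain E E.P \<longleftrightarrow> plain E' E'.P" .
  then show ?thesis
    by (simp add: plain_p_def E.sub_p_eq E'.sub_p_eq)
qed

lemma (in brace_ext) plain_p_triv:
  "add.sig = triv_hom p C \<Longrightarrow> plain_p p E"
  using trivial_plain by (simp add: plain_p_def sub_p_eq)

text \<open>In the plain case both braces are isomorphic to one model. Otherwise their opposites are
  plain and share a model, and an isomorphism between opposites is one between the braces
  themselves.\<close>

lemma isomorphic_of_ext:
  fixes E :: "'a skew_brace" and E' :: "'b skew_brace" and C :: "'c skew_brace"
  assumes "ext_of p E C \<pi> \<sigma> \<tau>" "ext_of p E' C \<pi>' \<sigma> \<tau>" "plain_p p E = plain_p p E'"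
  shows "brace_isomorphic E E'"
proof -
  interpret E: brace_ext E C \<pi> p using assms(1) by (simp add: ext_of_def)
  interpret E': brace_ext E' C \<pi>' p using assms(2) by (simp add: ext_of_def)
  have sig: "E.add.sig = \<sigma>" "E'.add.sig = \<sigma>" "E.circ.sig = \<tau>" "E'.circ.sig = \<tau>"
    using assms by (simp_all add: ext_of_def)
  show ?thesis
  proof (cases "plain_p p E")
    case True
    then have pl: "plain E E.P" "plain E' E'.P"
      using assms(3) by (simp_all add: plain_p_def E.sub_p_eq E'.sub_p_eq)
    have "brace_isomorphic E (model p \<sigma> \<tau> C)" "brace_isomorphic E' (model p \<sigma> \<tau> C)"
      using E.iso_model[OF pl(1), of \<sigma> \<tau>] E'.iso_model[OF pl(2), of \<sigma> \<tau>]
      by (auto simp: sig brace_isomorphic_def)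
    then show ?thesis
      using brace_isomorphic_trans brace_isomorphic_sym[OF E'.brace_E] by blast
  next
    case False
    then have "\<not> plain E E.P" "\<not> plain E' E'.P"
      using assms(3) by (simp_all add: plain_p_def E.sub_p_eq E'.sub_p_eq)
    then have "twisted E E.P" "twisted E' E'.P"
      using E.plain_or_twisted E'.plain_or_twisted by blast+
    interpret op: brace_ext "op_brace E" "op_brace C" \<pi> p
      by (rule brace_ext_op_brace) (rule E.brace_ext_axioms)
    interpret op': brace_ext "op_brace E'" "op_brace C" \<pi>' p
      by (rule brace_ext_op_brace) (rule E'.brace_ext_axioms)
    \<comment> \<open>The opposite extension has \<sigma> after inversion as its additive action,
      and the same \<tau>.\<close>
    let ?M = "model p (\<lambda>c. \<sigma> (inv\<^bsub>C\<^esub> c)) \<tau> (op_brace C)"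
    have "(\<lambda>b. (op.r b mod int p, \<pi> b)) \<in> brace_iso (op_brace E) ?M"
      using \<open>twisted E E.P\<close> sig_op_brace[OF E.brace_ext_axioms]
      by (intro op.iso_model) (simp_all add: sig)
    moreover have "(\<lambda>b. (op'.r b mod int p, \<pi>' b)) \<in> brace_iso (op_brace E') ?M"
      using \<open>twisted E' E'.P\<close> sig_op_brace[OF E'.brace_ext_axioms]
      by (intro op'.iso_model) (simp_all add: sig)
    ultimately have "brace_isomorphic (op_brace E) ?M" "brace_isomorphic (op_brace E') ?M"
      by (auto simp: brace_isomorphic_def)
    then have "brace_isomorphic (op_brace E) (op_brace E')"
      using brace_isomorphic_trans brace_isomorphic_sym[OF op'.brace_E] by blast
    then show ?thesis
      by simp
  qed
qed

section \<open>The quotient brace and its additive structure\<close>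

lemma quot_brace_simps [simp]:
  "carrier (quot_brace E N) = rcosets\<^bsub>E\<^esub> N"
  "X \<otimes>\<^bsub>quot_brace E N\<^esub> Y = X <#>\<^bsub>E\<^esub> Y"
  "X \<bullet>\<^bsub>quot_brace E N\<^esub> Y = X <#>\<^bsub>circ_group E\<^esub> Y"
  "\<one>\<^bsub>quot_brace E N\<^esub> = N"
  by (simp_all add: quot_brace_def)

lemma (in normal) coset_eq_self_iff: "x \<in> carrier G \<Longrightarrow> H #> x = H \<longleftrightarrow> x \<in> H"
  using coset_join1[of H x] coset_join2[of x H] is_subgroup by blast

lemma (in normal) card_rcosets:
  assumes "card H = k" "k > 0"
  shows "card (rcosets H) = order G div k"
proof -
  have "card (rcosets H) * k = order G"
    using lagrange[OF is_subgroup] assms(1) by simp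
  then show ?thesis
    using assms(2) by (metis nonzero_mult_div_cancel_right not_gr_zero)
qed

text \<open>The quotient consists of additive cosets, while its second operation multiplies them
  setwise in the other group; equality of cosets is what makes the projection respect both.\<close>

lemma brace_ext_quot:
  assumes "skew_brace E" "finite (carrier E)" "prime p" "N \<lhd> E" "N \<lhd> circ_group E" "card N = p"
    and cosets: "\<And>a. a \<in> carrier E \<Longrightarrow> N #>\<^bsub>circ_group E\<^esub> a = N #>\<^bsub>E\<^esub> a"
    and "\<not> p dvd order E div p"
  shows "brace_ext E (quot_brace E N) (\<lambda>a. N #>\<^bsub>E\<^esub> a) p"
proof -
  interpret skew_brace E by fact
  interpret N: normal N E by fact
  interpret N': normal N "circ_group E" by fact
  let ?Q = "quot_brace E N" and ?\<pi> = "\<lambda>a. N #>\<^bsub>E\<^esub> a"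
  have hom: "?\<pi> \<in> brace_hom E ?Q"
  proof (rule brace_homI)
    fix a b assume ab: "a \<in> carrier E" "b \<in> carrier E"
    show "?\<pi> a \<in> carrier ?Q"
      using ab by (simp add: rcosetsI N.subset)
    show "?\<pi> (a \<otimes>\<^bsub>E\<^esub> b) = ?\<pi> a \<otimes>\<^bsub>?Q\<^esub> ?\<pi> b"
      using ab by (simp add: N.rcos_sum)
    show "?\<pi> (a \<bullet>\<^bsub>E\<^esub> b) = ?\<pi> a \<bullet>\<^bsub>?Q\<^esub> ?\<pi> b"
      using ab N'.rcos_sum[of a b] by (simp add: cosets)
  qed
  have img: "?\<pi> ` carrier E = carrier ?Q"
    by (auto simp: RCOSETS_def)
  have one: "\<one>\<^bsub>?Q\<^esub> = ?\<pi> \<one>\<^bsub>E\<^esub>"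
    using N.subset by simp
  have "kernel E ?Q ?\<pi> = N"
    using N.subset N.coset_eq_self_iff by (auto simp: kernel_def)
  moreover have "order ?Q = order E div p"
    using N.card_rcosets[OF assms(6)] prime_gt_0_nat[OF assms(3)] by (simp add: order_def)
  ultimately show ?thesis
    using skew_brace_image[OF assms(1) hom img one] assms hom img by (intro brace_ext.intro) simp_all
qed

lemma (in brace_ext) brace_ext_sub_p:
  "brace_ext E (quot_brace E (sub_p p E)) (\<lambda>a. sub_p p E #> a) p"
  unfolding sub_p_eq
proof (rule brace_ext_quot)
  show "P #>\<^bsub>circ_group E\<^esub> a = P #> a" if "a \<in> carrier E" for a
    using add.coset_P[OF that] circ.coset_P[of a] that by simp
  show "P \<lhd> circ_group E"
    using circ.normal_kernel by simp
  show "\<not> p dvd order E div p"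
    using add.order_G p_ndvd prime_gt_0_nat[OF prime_p] by simp
qed (use brace_E finite_E prime_p add.normal_kernel card_ker in auto)

text \<open>For the projection onto cosets the fibre over \<open>X\<close> is \<open>X\<close>
  itself, so the two descriptions become the same.\<close>

lemma sigma_of_eq:
  assumes "brace_ext E (quot_brace E (sub_p p E)) (\<lambda>a. sub_p p E #>\<^bsub>E\<^esub> a) p"
  shows "sigma_of p E = prime_kernel.sig E (quot_brace E (sub_p p E)) (\<lambda>a. sub_p p E #>\<^bsub>E\<^esub> a) p"
proof -
  let ?Q = "quot_brace E (sub_p p E)" and ?\<pi> = "\<lambda>a. sub_p p E #>\<^bsub>E\<^esub> a"
  interpret brace_ext E ?Q ?\<pi> p by fact
  have X: "{a \<in> carrier E. ?\<pi> a = X} = X" if "X \<in> carrier ?Q" for X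
  proof -
    obtain a where a: "a \<in> carrier E" "?\<pi> a = X"
      using \<open>X \<in> carrier ?Q\<close> by (rule add.h_E)
    show ?thesis
      using add.coset_P[OF a(1), folded sub_p_eq] unfolding a(2) ..
  qed
  show ?thesis
    unfolding sigma_of_def add.sig_def
  proof (rule restrict_ext)
    fix X assume "X \<in> carrier ?Q"
    then show "(THE k. k \<in> carrier (Zstar p) \<and>
        (\<forall>a\<in>X. \<forall>x\<in>sub_p p E. a \<otimes>\<^bsub>E\<^esub> x \<otimes>\<^bsub>E\<^esub> inv\<^bsub>E\<^esub> a = x [^]\<^bsub>E\<^esub> k)) =
      (THE k. k \<in> carrier (Zstar p) \<and> (\<forall>a\<in>{a \<in> carrier E. ?\<pi> a = X}. \<forall>x\<in>P.
         a \<otimes>\<^bsub>E\<^esub> x \<otimes>\<^bsub>E\<^esub> inv\<^bsub>E\<^esub> a = x [^]\<^bsub>E\<^esub> k))"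
      by (simp only: X sub_p_eq[symmetric])
  qed
qed

lemma (in brace_ext) ext_of_additive_pair:
  "\<exists>\<pi> \<tau>. ext_of p E (fst (additive_pair p E)) \<pi> (snd (additive_pair p E)) \<tau>"
  using brace_ext_sub_p sigma_of_eq[OF brace_ext_sub_p] by (auto simp: ext_of_def additive_pair_def)

text \<open>Translates isomorphism of additive structures into extension data. The action \<tau> is
  quantified away because an additive structure does not determine it.\<close>

lemma pair_isomorphic_iff:
  assumes "brace_ext E Q \<pi> p" "skew_brace C" "\<sigma> \<in> extensional (carrier C)"
  shows "pair_isomorphic (additive_pair p E) (C, \<sigma>) \<longleftrightarrow> (\<exists>\<pi> \<tau>. ext_of p E C \<pi> \<sigma> \<tau>)"
proof -
  interpret brace_ext E Q \<pi> p by fact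
  obtain \<pi>' \<tau>' where ext: "ext_of p E (fst (additive_pair p E)) \<pi>' (snd (additive_pair p E)) \<tau>'"
    using ext_of_additive_pair by blast
  then interpret Q: brace_ext E "fst (additive_pair p E)" \<pi>' p
    by (simp add: ext_of_def)
  show ?thesis
  proof
    assume "pair_isomorphic (additive_pair p E) (C, \<sigma>)"
    then obtain f where f: "f \<in> brace_iso (fst (additive_pair p E)) C"
      and \<sigma>: "\<And>x. x \<in> carrier (fst (additive_pair p E)) \<Longrightarrow> \<sigma> (f x) = snd (additive_pair p E) x"
      by (auto simp: pair_isomorphic_def split_beta)
    define g where "g = inv_into (carrier (fst (additive_pair p E))) f"
    have g: "g \<in> brace_iso C (fst (additive_pair p E))"
      unfolding g_def using f Q.brace_C by (intro brace_iso_inverse)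
    have fg: "f (g c) = c" "g c \<in> carrier (fst (additive_pair p E))" if "c \<in> carrier C" for c
      using that unfolding g_def brace_isoD(4)[OF f, symmetric] by (simp_all add: f_inv_into_f inv_into_into)
    have "\<exists>\<pi>''. ext_of p E C \<pi>'' \<sigma> (\<lambda>c\<in>carrier C. \<tau>' (g c))"
      using assms(3) \<sigma> fg by (intro ext_of_iso_quotient[OF ext assms(2) g]) (auto simp flip: \<sigma>)
    then show "\<exists>\<pi> \<tau>. ext_of p E C \<pi> \<sigma> \<tau>" by blast
  next
    assume "\<exists>\<pi> \<tau>. ext_of p E C \<pi> \<sigma> \<tau>"
    then show "pair_isomorphic (additive_pair p E) (C, \<sigma>)"
      using ext_of_unique[OF ext] by (fastforce simp: pair_isomorphic_def split_beta)
  qed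
qed

text \<open>The hypothesis on groups of order \<open>n * p\<close> concerns bare monoid records,
  whereas a skew brace carries a further field; normality depends on the common fields
  alone.\<close>

lemma normal_truncate:
  assumes "H \<lhd> \<lparr>carrier = carrier G, monoid.mult = monoid.mult G, one = one G\<rparr>" "group G"
  shows "H \<lhd> G"
proof -
  let ?G = "\<lparr>carrier = carrier G, monoid.mult = monoid.mult G, one = one G\<rparr>"
  interpret G: group G by fact
  interpret H: normal H ?G by fact
  have inv: "m_inv G = m_inv ?G"
    by (simp add: m_inv_def fun_eq_iff)
  show ?thesis
    unfolding G.normal_inv_iff
  proof (intro conjI ballI)
    show "subgroup H G"
      using H.is_subgroup by (simp add: subgroup_def inv)
    show "x \<otimes>\<^bsub>G\<^esub> h \<otimes>\<^bsub>G\<^esub> inv\<^bsub>G\<^esub> x \<in> H" if "x \<in> carrier G" "h \<in> H" for x h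
      using H.inv_op_closed2[of x h] that by (simp add: inv)
  qed
qed

lemma subgroup_order_prime_unique:
  assumes "N \<lhd> G" "finite (carrier G)" "prime p" "card N = p" "\<not> p dvd order G div p"
    and "subgroup K G" "card K = p"
  shows "K = N"
proof -
  interpret N: normal N G by fact
  have "prime_kernel G (G Mod N) (\<lambda>a. N #>\<^bsub>G\<^esub> a) p"
  proof (intro prime_kernel.intro group_hom.intro group_hom_axioms.intro prime_kernel_axioms.intro)
    show "(\<lambda>a. N #>\<^bsub>G\<^esub> a) \<in> hom G (G Mod N)"
      by (rule N.r_coset_hom_Mod)
    show "group (G Mod N)"
      by (rule N.factorgroup_is_group)
    show "(\<lambda>a. N #>\<^bsub>G\<^esub> a) ` carrier G = carrier (G Mod N)"
      by (simp add: carrier_FactGroup)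
    have "kernel G (G Mod N) (\<lambda>a. N #>\<^bsub>G\<^esub> a) = N"
      using N.subset N.coset_eq_self_iff by (auto simp: kernel_def)
    then show "card (kernel G (G Mod N) (\<lambda>a. N #>\<^bsub>G\<^esub> a)) = p"
      using assms(4) by simp
    have "order (G Mod N) = order G div p"
      using N.card_rcosets[OF assms(4)] prime_gt_0_nat[OF assms(3)] by (simp add: order_def FactGroup_def)
    then show "\<not> p dvd order (G Mod N)"
      using assms(5) by simp
  qed (use assms in auto)
  then interpret prime_kernel G "G Mod N" "\<lambda>a. N #>\<^bsub>G\<^esub> a" p .
  have "K = P" "N = P"
    using assms by (auto intro!: subgroup_order_p N.is_subgroup)
  then show ?thesis by simp
qed

text \<open>The hypothesis is applied to both groups. An additive normal \<open>N\<close> of order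
  \<open>p\<close> is the only subgroup of that order, so \<lambda> preserves it and it is a
  multiplicative subgroup; the multiplicative normal subgroup of order \<open>p\<close> must then be
  \<open>N\<close>.\<close>

lemma ex_brace_ext:
  fixes E :: "nat skew_brace"
  assumes hyp: "\<forall>G :: nat monoid. group G \<and> order G = n * p \<longrightarrow> (\<exists>H. H \<lhd> G \<and> card H = p)"
    and p: "prime p" and "n > 0" "\<not> p dvd n" and E: "E \<in> skew_braces (n * p)"
  shows "\<exists>(C :: nat set skew_brace) \<pi>. brace_ext E C \<pi> p"
proof -
  interpret skew_brace E using E by (simp add: skew_braces_def)
  have ord: "order E = n * p"
    using E by (simp add: skew_braces_def)
  have p0: "p > 0"
    using prime_gt_0_nat[OF p] .
  have fin: "finite (carrier E)"
    using ord p0 assms(3) by (simp flip: order_gt_0_iff_finite)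
  have ndvd: "\<not> p dvd order E div p"
    using ord assms(4) p0 by simp
  let ?E = "\<lparr>carrier = carrier E, monoid.mult = monoid.mult E, one = one E\<rparr>"
  have "group ?E"
    by (rule group_cong[OF is_group]) simp_all
  moreover have "order ?E = n * p"
    using ord by (simp add: order_def)
  ultimately obtain N where nN0: "N \<lhd> ?E" and cN: "card N = p"
    using hyp by blast
  have nN: "N \<lhd> E"
    using nN0 is_group by (rule normal_truncate)
  then interpret N: normal N E .
  have unique: "K = N" if "subgroup K E" "card K = p" for K
    using nN fin p cN ndvd that by (rule subgroup_order_prime_unique)
  have lamN: "lam a ` N = N" if a: "a \<in> carrier E" for a
  proof (rule unique)
    interpret l: group_hom E E "lam a"
      using lam_hom[OF a] by unfold_locales
    show "subgroup (lam a ` N) E"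
      by (rule l.subgroup_img_is_subgroup[OF N.is_subgroup])
    have "inj_on (lam a) N"
      using a lam_inj N.mem_carrier by (intro inj_onI) blast
    then show "card (lam a ` N) = p"
      by (simp add: card_image cN)
  qed
  have "subgroup N (circ_group E)"
  proof (rule subgroup.intro)
    fix a b assume ab: "a \<in> N" "b \<in> N"
    then have "lam a b \<in> N"
      using imageI[of b N "lam a"] lamN[of a] by simp
    then show "a \<otimes>\<^bsub>circ_group E\<^esub> b \<in> N"
      using ab by (simp add: circ_eq)
  next
    \<comment> \<open>As \<open>lam a\<close> maps \<open>N\<close> onto itself,
      \<open>a \<otimes> lam a b = \<one>\<close> has a solution \<open>b\<close> in
      \<open>N\<close>, and this is the multiplicative inverse.\<close>
    fix a assume a: "a \<in> N"
    then have "inv\<^bsub>E\<^esub> a \<in> lam a ` N"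
      using lamN[of a] by simp
    then obtain b where b: "b \<in> N" "lam a b = inv\<^bsub>E\<^esub> a"
      by (elim imageE) simp
    then have "a \<bullet>\<^bsub>E\<^esub> b = \<one>\<^bsub>E\<^esub>"
      using a by (simp add: circ_eq)
    then have "b = inv\<^bsub>circ_group E\<^esub> a"
      using a b circ.inv_unique'[of a b] circ.inv_comm[of a b] by simp
    then show "inv\<^bsub>circ_group E\<^esub> a \<in> N"
      using b by simp
  qed (use N.subset in auto)
  moreover obtain K where K: "K \<lhd> circ_group E" "card K = p"
    using hyp circ.is_group ord by fastforce
  ultimately have "N = K"
    using fin p ndvd cN by (intro subgroup_order_prime_unique[OF K(1)]) simp_all
  then have nN': "N \<lhd> circ_group E"
    using K by simp
  then interpret N': normal N "circ_group E" .
  have "N #>\<^bsub>circ_group E\<^esub> a = N #>\<^bsub>E\<^esub> a" if a: "a \<in> carrier E" for a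
  proof -
    \<comment> \<open>Left cosets agree because \<open>a \<bullet> x = a \<otimes> lam a x\<close>
      and \<open>lam a\<close> permutes \<open>N\<close>; normality in each group passes to right
      cosets.\<close>
    have "N #>\<^bsub>circ_group E\<^esub> a = a <#\<^bsub>circ_group E\<^esub> N"
      using N'.coset_eq a by simp
    also have "\<dots> = (\<lambda>x. a \<otimes>\<^bsub>E\<^esub> lam a x) ` N"
      using a by (auto simp: l_coset_def circ_eq)
    also have "\<dots> = (\<lambda>x. a \<otimes>\<^bsub>E\<^esub> x) ` lam a ` N"
      by (simp only: image_image)
    also have "\<dots> = a <#\<^bsub>E\<^esub> N"
      unfolding lamN[OF a] by (auto simp: l_coset_def)
    also have "\<dots> = N #>\<^bsub>E\<^esub> a"
      using N.coset_eq a by simp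
    finally show ?thesis .
  qed
  then have "brace_ext E (quot_brace E N) (\<lambda>a. N #>\<^bsub>E\<^esub> a) p"
    using nN nN' fin p cN ndvd skew_brace_axioms by (intro brace_ext_quot) auto
  then show ?thesis by blast
qed

section \<open>Realisation of prescribed actions\<close>

lemma comm_group_Zstar:
  assumes "prime p"
  shows "comm_group (Zstar p)"
proof -
  interpret residues_prime p "residue_ring (int p)"
    using assms by unfold_locales auto
  show ?thesis
    by (rule units_comm_group)
qed

lemma model_ext_of:
  assumes "model_data C \<sigma> \<tau> p"
  shows "ext_of p (model p \<sigma> \<tau> C) C snd (restrict \<sigma> (carrier C)) (restrict \<tau> (carrier C))"
    and "plain_p p (model p \<sigma> \<tau> C)"
proof -
  interpret model_data C \<sigma> \<tau> p by fact
  have "M.add.sig = restrict \<sigma> (carrier C)" "M.circ.sig = restrict \<tau> (carrier C)"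
    using M.add.sig_extensional M.circ.sig_extensional add_sig_M circ_sig_M
    by (auto intro!: extensionalityI[of _ "carrier C"])
  then show "ext_of p M C snd (restrict \<sigma> (carrier C)) (restrict \<tau> (carrier C))"
    using ext_M by (simp add: ext_of_def)
  show "plain_p p M"
    using plain_M by (simp add: plain_p_def M.sub_p_eq)
qed

lemma model_data_Hom:
  assumes "skew_brace C" "prime p" "\<not> p dvd order C" "finite (carrier C)"
    and "\<sigma> \<in> Hom_brace p C" "\<tau> \<in> Hom_circ p C"
  shows "model_data C \<sigma> \<tau> p"
  using assms by (auto simp: model_data_def model_data_axioms_def Hom_brace_def Hom_circ_def)

text \<open>Passing to opposites inverts the additive action, so the model is built over the
  opposite of \<open>C\<close> with \<sigma> after inversion; its opposite has the original
  \<open>C\<close> and \<sigma>, but is twisted. For \<sigma> \<noteq> 1 it is therefore not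
  plain.\<close>

lemma op_model_ext_of:
  fixes C :: "'a skew_brace"
  assumes "skew_brace C" "prime p" "\<not> p dvd order C" "finite (carrier C)"
    and "\<sigma> \<in> Hom_brace p C" "\<tau> \<in> Hom_circ p C" "\<sigma> \<noteq> triv_hom p C"
  defines "M \<equiv> op_brace (model p (\<lambda>c. \<sigma> (inv\<^bsub>C\<^esub> c)) \<tau> (op_brace C))"
  shows "ext_of p M C snd \<sigma> \<tau>" "\<not> plain_p p M"
proof -
  interpret C: skew_brace C by fact
  interpret Z: comm_group "Zstar p"
    using assms(2) by (rule comm_group_Zstar)
  have \<sigma>: "\<sigma> \<in> hom C (Zstar p)" "\<sigma> \<in> hom (circ_group C) (Zstar p)"
    using assms(5) by (auto simp: Hom_brace_def)
  interpret \<sigma>: group_hom C "Zstar p" \<sigma>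
    using \<sigma>(1) by unfold_locales
  let ?\<sigma> = "\<lambda>c. \<sigma> (inv\<^bsub>C\<^esub> c)"
  have "model_data (op_brace C) ?\<sigma> \<tau> p"
  proof (intro model_data.intro model_data_axioms.intro skew_brace_op_brace)
    show "?\<sigma> \<in> hom (op_brace C) (Zstar p)"
      by (rule homI) (simp_all add: C.inv_mult_group \<sigma>.hom_mult del: Zstar_mult \<sigma>.hom_inv)
    \<comment> \<open>Additive inversion need not respect \<bullet>, but \<sigma> turns it into
      inversion in a commutative group, which is a homomorphism.\<close>
    show "?\<sigma> \<in> hom (circ_group (op_brace C)) (Zstar p)"
    proof (rule homI)
      fix a b assume ab: "a \<in> carrier (circ_group (op_brace C))" "b \<in> carrier (circ_group (op_brace C))"
      then have "\<sigma> (inv\<^bsub>C\<^esub> (a \<bullet>\<^bsub>C\<^esub> b)) = inv\<^bsub>Zstar p\<^esub> (\<sigma> a \<otimes>\<^bsub>Zstar p\<^esub> \<sigma> b)"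
        using hom_mult[OF \<sigma>(2), of a b] by (simp del: Zstar_mult)
      then show "\<sigma> (inv\<^bsub>C\<^esub> (a \<otimes>\<^bsub>circ_group (op_brace C)\<^esub> b)) =
          \<sigma> (inv\<^bsub>C\<^esub> a) \<otimes>\<^bsub>Zstar p\<^esub> \<sigma> (inv\<^bsub>C\<^esub> b)"
        using ab by (simp add: Z.inv_mult del: Zstar_mult)
    qed simp
    show "\<tau> \<in> hom (circ_group (op_brace C)) (Zstar p)"
      using assms(6) by (simp add: Hom_circ_def)
  qed (use assms in auto)
  then interpret M: model_data "op_brace C" ?\<sigma> \<tau> p .
  have ext: "brace_ext M C snd p"
    using brace_ext_op_brace[OF M.ext_M] by (simp add: M_def)
  then interpret M': brace_ext M C snd p .
  have "M'.add.sig c = \<sigma> c" if "c \<in> carrier C" for c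
    using sig_op_brace[OF M.ext_M, of c] that M.add_sig_M[of "inv\<^bsub>C\<^esub> c"]
    by (simp add: M_def inv_op_brace[OF assms(1)])
  moreover have "M'.circ.sig c = \<tau> c" if "c \<in> carrier C" for c
    using M.circ_sig_M[of c] that by (simp add: M_def)
  ultimately have sig: "M'.add.sig = \<sigma>" "M'.circ.sig = \<tau>"
    using M'.add.sig_extensional M'.circ.sig_extensional assms(5,6)
    by (auto intro!: extensionalityI[of _ "carrier C"] simp: Hom_brace_def Hom_circ_def)
  then show "ext_of p M C snd \<sigma> \<tau>"
    using ext by (simp add: ext_of_def)
  have "twisted M M'.P"
    using M.plain_M by (simp add: M_def kernel_def)
  then show "\<not> plain_p p M"
    using M'.plain_twisted_trivial assms(7) sig by (auto simp: plain_p_def M'.sub_p_eq)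
qed

lemma ex_nat_ext_of:
  assumes "ext_of p M C \<pi> \<sigma> \<tau>"
  shows "\<exists>E\<in>skew_braces (order C * p). \<exists>\<pi>. ext_of p E C \<pi> \<sigma> \<tau> \<and> plain_p p E = plain_p p M"
proof -
  interpret M: brace_ext M C \<pi> p using assms by (simp add: ext_of_def)
  obtain E f where E: "E \<in> skew_braces (order M)" and f: "f \<in> brace_iso M E"
    using ex_nat_brace[OF M.brace_E M.finite_E] .
  have b: "skew_brace E"
    using E by (simp add: skew_braces_def)
  have g: "inv_into (carrier M) f \<in> brace_iso E M"
    using M.brace_E f by (rule brace_iso_inverse)
  show ?thesis
    using ext_of_iso[OF assms b g] plain_p_iso[OF assms b g] E M.add.order_G
    by (auto simp: mult.commute)
qed

text \<open>The Boolean \<open>t\<close> selects the case; for trivial \<sigma> only the plain one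
  occurs.\<close>

lemma ex_ext_of:
  fixes C :: "'a skew_brace"
  assumes "skew_brace C" "prime p" "\<not> p dvd order C" "finite (carrier C)"
    and "\<sigma> \<in> Hom_brace p C" "\<tau> \<in> Hom_circ p C" "t \<or> \<sigma> \<noteq> triv_hom p C"
  shows "\<exists>E\<in>skew_braces (order C * p). \<exists>\<pi>. ext_of p E C \<pi> \<sigma> \<tau> \<and> plain_p p E = t"
proof (cases t)
  case True
  have "restrict \<sigma> (carrier C) = \<sigma>" "restrict \<tau> (carrier C) = \<tau>"
    using assms(5,6) by (simp_all add: Hom_brace_def Hom_circ_def extensional_restrict)
  then show ?thesis
    using ex_nat_ext_of[of p "model p \<sigma> \<tau> C" C snd \<sigma> \<tau>]
      model_ext_of[OF model_data_Hom[OF assms(1-6)]] True by simp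
next
  case False
  then show ?thesis
    using ex_nat_ext_of[OF op_model_ext_of(1)[OF assms(1-6)]] op_model_ext_of(2)[OF assms(1-6)]
      assms(7) by simp
qed

section \<open>Counting isomorphism classes and orbits\<close>

text \<open>A relation takes the place of a map because the data matched to an object are unique
  only up to the equivalence encoded by \<open>G\<close>; the last premise makes it a bijection
  between classes.\<close>

lemma card_image_eq_of_matching:
  assumes "\<And>x. x \<in> X \<Longrightarrow> \<exists>y\<in>Y. M x y" "\<And>y. y \<in> Y \<Longrightarrow> \<exists>x\<in>X. M x y"
    and eq: "\<And>x x' y y'. \<lbrakk>x \<in> X; x' \<in> X; y \<in> Y; y' \<in> Y; M x y; M x' y'\<rbrakk> \<Longrightarrow> F x = F x' \<longleftrightarrow> G y = G y'"
  shows "card (F ` X) = card (G ` Y)"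
proof -
  obtain m where m: "\<And>x. x \<in> X \<Longrightarrow> m x \<in> Y \<and> M x (m x)"
    using assms(1) by metis
  have "bij_betw (\<lambda>u. G (m (inv_into X F u))) (F ` X) (G ` Y)"
  proof (rule bij_betw_imageI)
    show "inj_on (\<lambda>u. G (m (inv_into X F u))) (F ` X)"
    proof (rule inj_onI)
      fix u v assume uv: "u \<in> F ` X" "v \<in> F ` X" "G (m (inv_into X F u)) = G (m (inv_into X F v))"
      then have "F (inv_into X F u) = F (inv_into X F v)"
        using eq m inv_into_into by metis
      then show "u = v"
        using uv by (simp add: f_inv_into_f)
    qed
    show "(\<lambda>u. G (m (inv_into X F u))) ` F ` X = G ` Y"
    proof
      show "(\<lambda>u. G (m (inv_into X F u))) ` F ` X \<subseteq> G ` Y"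
        using m inv_into_into[of _ F X] by blast
      show "G ` Y \<subseteq> (\<lambda>u. G (m (inv_into X F u))) ` F ` X"
      proof
        fix w assume "w \<in> G ` Y"
        then obtain y where y: "y \<in> Y" "w = G y" by blast
        then obtain x where x: "x \<in> X" "M x y"
          using assms(2) by blast
        let ?x = "inv_into X F (F x)"
        have x': "?x \<in> X" "F ?x = F x"
          using x by (simp_all add: inv_into_into f_inv_into_f)
        then have "G (m ?x) = w"
          using eq[of ?x x "m ?x" y] m x y by simp
        then show "w \<in> (\<lambda>u. G (m (inv_into X F u))) ` F ` X"
          using x(1) by blast
      qed
    qed
  qed
  then show ?thesis
    by (rule bij_betw_same_card)
qed

lemma iso_classes_eq: "iso_classes R S = (\<lambda>x. {y \<in> S. R x y}) ` S"
  by (auto simp: iso_classes_def quotient_def)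

lemma iso_class_eq_iff:
  assumes "\<And>x. x \<in> S \<Longrightarrow> R x x" "\<And>x y. \<lbrakk>x \<in> S; y \<in> S; R x y\<rbrakk> \<Longrightarrow> R y x"
    and "\<And>x y z. \<lbrakk>x \<in> S; y \<in> S; z \<in> S; R x y; R y z\<rbrakk> \<Longrightarrow> R x z" and "x \<in> S" "y \<in> S"
  shows "{z \<in> S. R x z} = {z \<in> S. R y z} \<longleftrightarrow> R x y"
proof
  assume "{z \<in> S. R x z} = {z \<in> S. R y z}"
  then have "y \<in> {z \<in> S. R x z}"
    using assms(1)[OF assms(5)] assms(5) by simp
  then show "R x y" by simp
next
  assume "R x y"
  then have "R x z \<longleftrightarrow> R y z" if "z \<in> S" for z
    using assms(2,3) assms(4,5) that by metis
  then show "{z \<in> S. R x z} = {z \<in> S. R y z}"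
    by blast
qed

lemma card_iso_classes:
  assumes equiv: "\<And>x. x \<in> S \<Longrightarrow> R x x" "\<And>x y. \<lbrakk>x \<in> S; y \<in> S; R x y\<rbrakk> \<Longrightarrow> R y x"
      "\<And>x y z. \<lbrakk>x \<in> S; y \<in> S; z \<in> S; R x y; R y z\<rbrakk> \<Longrightarrow> R x z"
    and "\<And>x. x \<in> S \<Longrightarrow> \<exists>y\<in>Y. M x y" "\<And>y. y \<in> Y \<Longrightarrow> \<exists>x\<in>S. M x y"
    and "\<And>x x' y y'. \<lbrakk>x \<in> S; x' \<in> S; y \<in> Y; y' \<in> Y; M x y; M x' y'\<rbrakk> \<Longrightarrow> R x x' \<longleftrightarrow> G y = G y'"
  shows "card (iso_classes R S) = card (G ` Y)"
  unfolding iso_classes_eq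
proof (rule card_image_eq_of_matching[where M = M])
  fix x x' y y' assume "x \<in> S" "x' \<in> S" "y \<in> Y" "y' \<in> Y" "M x y" "M x' y'"
  then show "{y \<in> S. R x y} = {y \<in> S. R x' y} \<longleftrightarrow> G y = G y'"
    using iso_class_eq_iff[of S R x x'] equiv assms(6)[of x x' y y'] by blast
qed (rule assms(4,5), assumption)+

lemma representatives_iso_classes:
  assumes "representatives Q (iso_classes R S)"
    and equiv: "\<And>x. x \<in> S \<Longrightarrow> R x x" "\<And>x y. \<lbrakk>x \<in> S; y \<in> S; R x y\<rbrakk> \<Longrightarrow> R y x"
      "\<And>x y z. \<lbrakk>x \<in> S; y \<in> S; z \<in> S; R x y; R y z\<rbrakk> \<Longrightarrow> R x z"
  shows "Q \<subseteq> S" "x \<in> S \<Longrightarrow> \<exists>q\<in>Q. R x q" "\<lbrakk>q \<in> Q; q' \<in> Q; R q q'\<rbrakk> \<Longrightarrow> q = q'"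
proof -
  have ex1: "\<exists>!y. y \<in> {y \<in> S. R x y} \<and> y \<in> Q" if "x \<in> S" for x
  proof -
    have "{y \<in> S. R x y} \<in> iso_classes R S"
      unfolding iso_classes_eq using that by (rule imageI)
    then show ?thesis
      using assms(1) by (simp only: representatives_def)
  qed
  have "\<Union> (iso_classes R S) \<subseteq> S"
    unfolding iso_classes_eq by auto
  then show sub: "Q \<subseteq> S"
    using assms(1) unfolding representatives_def by (elim conjE) (rule order_trans)
  show "\<exists>q\<in>Q. R x q" if "x \<in> S"
    using ex1[OF that] by blast
  show "q = q'" if "q \<in> Q" "q' \<in> Q" "R q q'"
    using ex1[of q] sub that equiv(1)[of q] by blast
qed

text \<open>For infinite \<open>A\<close> both sides are 0.\<close>

lemma card_Sigma_nonempty: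
  assumes "\<And>a. a \<in> A \<Longrightarrow> finite (B a) \<and> B a \<noteq> {}"
  shows "card (Sigma A B) = (\<Sum>a\<in>A. card (B a))"
proof (cases "finite A")
  case True
  then show ?thesis
    using assms by (simp add: card_SigmaI)
next
  case False
  have "fst ` Sigma A B = A"
    using assms by force
  then have "infinite (Sigma A B)"
    using False finite_imageI by metis
  then show ?thesis
    using False by simp
qed

section \<open>Right actions by composition and orbit counting\<close>

locale right_action =
  fixes S :: "'a set" and A :: "('a \<Rightarrow> 'a) set" and X :: "('a \<Rightarrow> 'b) set"
  assumes subgroup_A: "subgroup A (BijGroup S)"
    and X_ext: "X \<subseteq> extensional S"
    and X_closed: "\<lbrakk>g \<in> A; x \<in> X\<rbrakk> \<Longrightarrow> compose S x g \<in> X"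
begin

abbreviation K where "K \<equiv> BijGroup S\<lparr>carrier := A\<rparr>"
abbreviation \<rho> :: "('a \<Rightarrow> 'a) \<Rightarrow> ('a \<Rightarrow> 'b) \<Rightarrow> 'a \<Rightarrow> 'b" where "\<rho> \<equiv> \<lambda>g x. compose S x g"
text \<open>The left action by inverses has the same orbits and stabilizers.\<close>

abbreviation \<phi> where "\<phi> g \<equiv> \<lambda>x\<in>X. \<rho> (inv\<^bsub>K\<^esub> g) x"

lemma A_Bij: "g \<in> A \<Longrightarrow> g \<in> Bij S"
  using subgroup.subset[OF subgroup_A] by (auto simp: BijGroup_def)

lemma group_K: "group K"
  using subgroup_A group_BijGroup by (rule subgroup.subgroup_is_group)

lemma K_mult: "\<lbrakk>g \<in> A; h \<in> A\<rbrakk> \<Longrightarrow> g \<otimes>\<^bsub>K\<^esub> h = compose S g h"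
  using A_Bij by (simp add: BijGroup_def)

lemma K_inv: "g \<in> A \<Longrightarrow> inv\<^bsub>K\<^esub> g \<in> A" "g \<in> A \<Longrightarrow> compose S g (inv\<^bsub>K\<^esub> g) = (\<lambda>x\<in>S. x)"
    "g \<in> A \<Longrightarrow> compose S (inv\<^bsub>K\<^esub> g) g = (\<lambda>x\<in>S. x)"
proof -
  interpret group K by (rule group_K)
  show inv: "inv\<^bsub>K\<^esub> g \<in> A" if "g \<in> A"
    using inv_closed[of g] that by simp
  show "compose S g (inv\<^bsub>K\<^esub> g) = (\<lambda>x\<in>S. x)" if "g \<in> A"
    using r_inv[of g] that K_mult[OF that inv[OF that]] by (simp add: BijGroup_def)
  show "compose S (inv\<^bsub>K\<^esub> g) g = (\<lambda>x\<in>S. x)" if "g \<in> A"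
    using l_inv[of g] that K_mult[OF inv[OF that] that] by (simp add: BijGroup_def)
qed

lemma rho_rho: "\<lbrakk>g \<in> A; h \<in> A\<rbrakk> \<Longrightarrow> \<rho> h (\<rho> g x) = \<rho> (compose S g h) x"
  using A_Bij Bij_imp_funcset by (auto simp: compose_def fun_eq_iff Pi_iff)

lemma rho_id: "x \<in> X \<Longrightarrow> \<rho> (\<lambda>s\<in>S. s) x = x"
  using X_ext by (auto simp: compose_def fun_eq_iff extensional_def)

lemma rho_inv: "\<lbrakk>g \<in> A; x \<in> X\<rbrakk> \<Longrightarrow> \<rho> (inv\<^bsub>K\<^esub> g) (\<rho> g x) = x" "\<lbrakk>g \<in> A; x \<in> X\<rbrakk> \<Longrightarrow> \<rho> g (\<rho> (inv\<^bsub>K\<^esub> g) x) = x"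
  using K_inv by (simp_all add: rho_rho rho_id)

lemma phi_Bij: "g \<in> A \<Longrightarrow> \<phi> g \<in> Bij X"
  unfolding Bij_def
proof (intro IntI CollectI bij_betw_byWitness[where f' = "\<lambda>x. \<rho> g x"])
  assume "g \<in> A"
  then show "\<forall>x\<in>X. \<rho> g (\<phi> g x) = x" "\<forall>x\<in>X. \<phi> g (\<rho> g x) = x" "\<phi> g ` X \<subseteq> X" "\<rho> g ` X \<subseteq> X"
    using rho_inv X_closed K_inv(1) by auto
qed auto

lemma group_action: "group_action K X \<phi>"
proof (intro group_action.intro group_hom.intro group_hom_axioms.intro group_K group_BijGroup homI)
  fix g assume g: "g \<in> carrier K"
  then show "\<phi> g \<in> carrier (BijGroup X)"
    using phi_Bij by (simp add: BijGroup_def)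
  fix h assume h: "h \<in> carrier K"
  interpret group K by (rule group_K)
  have gh: "g \<in> A" "h \<in> A" "inv\<^bsub>K\<^esub> g \<in> A" "inv\<^bsub>K\<^esub> h \<in> A"
    using g h K_inv(1) by auto
  \<comment> \<open>A right action reverses products and so does inversion; together they give a
    homomorphism.\<close>
  have "inv\<^bsub>K\<^esub> (g \<otimes>\<^bsub>K\<^esub> h) = compose S (inv\<^bsub>K\<^esub> h) (inv\<^bsub>K\<^esub> g)"
    using inv_mult_group[OF g h] K_mult[OF gh(4,3)] by simp
  then have "\<phi> (g \<otimes>\<^bsub>K\<^esub> h) x = compose X (\<phi> g) (\<phi> h) x" for x
    using gh X_closed by (simp add: compose_def[of X] rho_rho[OF gh(4,3)])
  then show "\<phi> (g \<otimes>\<^bsub>K\<^esub> h) = \<phi> g \<otimes>\<^bsub>BijGroup X\<^esub> \<phi> h"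
    using phi_Bij[OF gh(1)] phi_Bij[OF gh(2)] by (simp add: BijGroup_def fun_eq_iff)
qed

lemma orbit_phi: "x \<in> X \<Longrightarrow> orbit K \<phi> x = orbit K \<rho> x"
proof -
  interpret group K by (rule group_K)
  have inv_inv: "inv\<^bsub>K\<^esub> (inv\<^bsub>K\<^esub> g) = g" if "g \<in> A" for g
    using inv_inv[of g] that by simp
  show "orbit K \<phi> x = orbit K \<rho> x" if x: "x \<in> X"
  proof
    show "orbit K \<phi> x \<subseteq> orbit K \<rho> x"
      using x K_inv(1) by (auto simp: orbit_def)
    show "orbit K \<rho> x \<subseteq> orbit K \<phi> x"
    proof
      fix y assume "y \<in> orbit K \<rho> x"
      then obtain g where g: "g \<in> A" "y = \<rho> g x"
        by (auto simp: orbit_def)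
      then have "y = \<phi> (inv\<^bsub>K\<^esub> g) x"
        using inv_inv x by simp
      then show "y \<in> orbit K \<phi> x"
        using K_inv(1)[OF g(1)] unfolding orbit_def by auto
    qed
  qed
qed

lemma orbits_phi: "orbits K X \<phi> = orbits K X \<rho>"
  using orbit_phi unfolding orbits_def by blast

lemma stabilizer_phi: "x \<in> X \<Longrightarrow> stabilizer K \<phi> x = stabilizer K \<rho> x"
  using rho_inv unfolding stabilizer_def by (auto, metis, metis)

lemma orbit_eq_iff:
  assumes "x \<in> X" "y \<in> X"
  shows "orbit K \<rho> x = orbit K \<rho> y \<longleftrightarrow> (\<exists>g\<in>A. compose S y g = x)"
proof -
  interpret group_action K X \<phi> by (rule group_action)
  have "orbit K \<phi> x = orbit K \<phi> y \<longleftrightarrow> x \<in> orbit K \<phi> y"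
  proof
    show "orbit K \<phi> x = orbit K \<phi> y \<Longrightarrow> x \<in> orbit K \<phi> y"
      using orbit_refl[OF assms(1)] by simp
    assume x: "x \<in> orbit K \<phi> y"
    have "orbit K \<phi> x \<in> orbits K X \<phi>" "orbit K \<phi> y \<in> orbits K X \<phi>"
      using assms unfolding orbits_def by blast+
    then show "orbit K \<phi> x = orbit K \<phi> y"
      using disjoint_union orbit_refl[OF assms(1)] x by blast
  qed
  then show ?thesis
    using assms by (auto simp: orbit_phi) (auto simp: orbit_def)
qed

text \<open>Applied to the stabilizer of \<sigma> in the brace automorphisms, which is the carrier
  of \<open>A_group\<close>.\<close>

lemma subgroup_stabilizer:
  assumes "x \<in> X"
  shows "subgroup {g \<in> A. compose S x g = x} (BijGroup S)"
proof -
  interpret group_action K X \<phi> by (rule group_action)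
  have "subgroup (stabilizer K \<rho> x) K"
    using stabilizer_subgroup[OF assms] stabilizer_phi[OF assms] by simp
  then have "subgroup (stabilizer K \<rho> x) (BijGroup S)"
    using group.incl_subgroup[OF group_BijGroup subgroup_A] by blast
  then show ?thesis
    by (simp add: stabilizer_def)
qed

text \<open>The orbit counting lemma with stabilizers in place of fixed points: by orbit-stabilizer,
  each orbit contributes the group order to the sum.\<close>

lemma card_orbits:
  assumes "finite A" "finite X"
  shows "real (card (orbits K X \<rho>)) =
    1 / real (order K) * (\<Sum>x\<in>X. real (card (stabilizer K \<rho> x)))"
proof -
  interpret group_action K X \<phi> by (rule group_action)
  have "(\<Sum>x\<in>X. card (stabilizer K \<rho> x)) = (\<Sum>x\<in>X. card (stabilizer K \<phi> x))"
    by (intro sum.cong refl) (simp add: stabilizer_phi)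
  also have "\<dots> = (\<Sum>orb\<in>orbits K X \<phi>. \<Sum>x\<in>orb. card (stabilizer K \<phi> x))"
    by (rule disjoint_sum[OF assms(2), symmetric])
  also have "\<dots> = (\<Sum>orb\<in>orbits K X \<phi>. order K)"
    using assms card_stablizer_sum by (intro sum.cong refl) simp
  finally have "(\<Sum>x\<in>X. card (stabilizer K \<rho> x)) = card (orbits K X \<rho>) * order K"
    by (simp add: orbits_phi)
  moreover have "order K > 0"
    using monoid.order_gt_0_iff_finite[OF group.is_monoid[OF group_K]] assms(1) by simp
  ultimately show ?thesis
    by (simp flip: of_nat_sum)
qed

end

context skew_brace
begin

lemma brace_aut_eq: "brace_aut B = auto B \<inter> auto (circ_group B)"
  by (auto simp: brace_aut_def brace_hom_def auto_def)

lemma subgroup_brace_aut: "subgroup (brace_aut B) (BijGroup (carrier B))"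
  unfolding brace_aut_eq
  using group.subgroups_Inter_pair[OF group_BijGroup subgroup_auto] circ.subgroup_auto by simp

lemma brace_aut_brace_iso: "g \<in> brace_aut B \<Longrightarrow> g \<in> brace_iso B B"
  by (simp add: brace_aut_def brace_iso_def Bij_def)

lemma restrict_brace_aut:
  assumes "f \<in> brace_iso B B"
  shows "restrict f (carrier B) \<in> brace_aut B"
proof -
  note hom = brace_homD[OF brace_isoD(1)[OF assms]]
  have "restrict f (carrier B) \<in> brace_hom B B"
    using hom by (intro brace_homI) auto
  moreover have "bij_betw (restrict f (carrier B)) (carrier B) (carrier B)"
    using brace_isoD(2)[OF assms] by simp
  ultimately show ?thesis
    by (simp add: brace_aut_def Bij_def)
qed

text \<open>Automorphisms that are counted are extensional while isomorphisms are not; a condition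
  on values in the carrier does not notice the difference.\<close>

lemma ex_brace_aut_iff:
  "(\<exists>g\<in>brace_aut B. \<forall>b\<in>carrier B. Q (g b) b) \<longleftrightarrow> (\<exists>f\<in>brace_iso B B. \<forall>b\<in>carrier B. Q (f b) b)"
proof
  assume "\<exists>f\<in>brace_iso B B. \<forall>b\<in>carrier B. Q (f b) b"
  then obtain f where f: "f \<in> brace_iso B B" "\<forall>b\<in>carrier B. Q (f b) b"
    by blast
  then have "\<forall>b\<in>carrier B. Q (restrict f (carrier B) b) b"
    by simp
  then show "\<exists>g\<in>brace_aut B. \<forall>b\<in>carrier B. Q (g b) b"
    using restrict_brace_aut[OF f(1)] by blast
qed (use brace_aut_brace_iso in blast)

lemma compose_Hom_brace:
  assumes "g \<in> brace_aut B" "x \<in> Hom_brace p B"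
  shows "compose (carrier B) x g \<in> Hom_brace p B"
proof -
  have g: "g \<in> brace_hom B B"
    using assms(1) by (simp add: brace_aut_def)
  show ?thesis
    using assms(2) brace_homD[OF g] by (auto simp: Hom_brace_def hom_def compose_def Pi_iff)
qed

lemma compose_Hom_circ:
  assumes "g \<in> brace_aut B" "x \<in> Hom_circ p B"
  shows "compose (carrier B) x g \<in> Hom_circ p B"
proof -
  have g: "g \<in> brace_hom B B"
    using assms(1) by (simp add: brace_aut_def)
  show ?thesis
    using assms(2) brace_homD[OF g] by (auto simp: Hom_circ_def hom_def compose_def Pi_iff)
qed

lemma right_action_Aut: "right_action (carrier B) (brace_aut B) (Hom_brace p B)"
  using subgroup_brace_aut compose_Hom_brace
  by (intro right_action.intro) (auto simp: Hom_brace_def)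

lemma A_group_carrier: "brace_aut B \<inter> Sigma_set B \<sigma> = {g \<in> brace_aut B. compose (carrier B) \<sigma> g = \<sigma>}"
  by (auto simp: Sigma_set_def ract_def brace_aut_eq)

lemma right_action_A:
  assumes "\<sigma> \<in> Hom_brace p B"
  shows "right_action (carrier B) (brace_aut B \<inter> Sigma_set B \<sigma>) (Hom_circ p B)"
  unfolding A_group_carrier
  using right_action.subgroup_stabilizer[OF right_action_Aut assms] compose_Hom_circ
  by (intro right_action.intro) (auto simp: Hom_circ_def)

lemma ract_eq: "ract B = (\<lambda>g x. compose (carrier B) x g)"
  by (simp add: ract_def fun_eq_iff)

lemma compose_eq_iff:
  assumes "x \<in> extensional (carrier B)"
  shows "compose (carrier B) y g = x \<longleftrightarrow> (\<forall>b\<in>carrier B. y (g b) = x b)"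
  using assms by (auto simp: compose_def fun_eq_iff extensional_def)

lemma orbit_Aut_eq_iff:
  assumes "\<sigma> \<in> Hom_brace p B" "\<sigma>' \<in> Hom_brace p B"
  shows "orbit (Aut_brace B) (ract B) \<sigma> = orbit (Aut_brace B) (ract B) \<sigma>' \<longleftrightarrow>
    (\<exists>f\<in>brace_iso B B. \<forall>b\<in>carrier B. \<sigma>' (f b) = \<sigma> b)"
proof -
  have "orbit (Aut_brace B) (ract B) \<sigma> = orbit (Aut_brace B) (ract B) \<sigma>' \<longleftrightarrow>
      (\<exists>g\<in>brace_aut B. \<forall>b\<in>carrier B. \<sigma>' (g b) = \<sigma> b)"
    using right_action.orbit_eq_iff[OF right_action_Aut assms] assms
    by (simp add: Aut_brace_def ract_eq compose_eq_iff Hom_brace_def)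
  also have "\<dots> \<longleftrightarrow> (\<exists>f\<in>brace_iso B B. \<forall>b\<in>carrier B. \<sigma>' (f b) = \<sigma> b)"
    by (rule ex_brace_aut_iff)
  finally show ?thesis .
qed

lemma orbit_A_eq_iff:
  assumes "\<sigma> \<in> Hom_brace p B" "\<tau> \<in> Hom_circ p B" "\<tau>' \<in> Hom_circ p B"
  shows "orbit (A_group B \<sigma>) (ract B) \<tau> = orbit (A_group B \<sigma>) (ract B) \<tau>' \<longleftrightarrow>
    (\<exists>f\<in>brace_iso B B. \<forall>b\<in>carrier B. \<sigma> (f b) = \<sigma> b \<and> \<tau>' (f b) = \<tau> b)"
proof -
  have "orbit (A_group B \<sigma>) (ract B) \<tau> = orbit (A_group B \<sigma>) (ract B) \<tau>' \<longleftrightarrow>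
      (\<exists>g\<in>brace_aut B \<inter> Sigma_set B \<sigma>. \<forall>b\<in>carrier B. \<tau>' (g b) = \<tau> b)"
    using right_action.orbit_eq_iff[OF right_action_A assms(2,3)] assms
    by (simp add: A_group_def ract_eq compose_eq_iff Hom_circ_def)
  also have "\<dots> \<longleftrightarrow> (\<exists>g\<in>brace_aut B. \<forall>b\<in>carrier B. \<sigma> (g b) = \<sigma> b \<and> \<tau>' (g b) = \<tau> b)"
    using assms(1) by (auto simp: A_group_carrier compose_eq_iff Hom_brace_def)
  also have "\<dots> \<longleftrightarrow> (\<exists>f\<in>brace_iso B B. \<forall>b\<in>carrier B. \<sigma> (f b) = \<sigma> b \<and> \<tau>' (f b) = \<tau> b)"
    by (rule ex_brace_aut_iff)
  finally show ?thesis .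
qed

lemma finite_brace_aut:
  assumes "finite (carrier B)"
  shows "finite (brace_aut B)"
proof (rule finite_subset)
  show "brace_aut B \<subseteq> carrier B \<rightarrow>\<^sub>E carrier B"
    unfolding PiE_def brace_aut_def using Bij_imp_funcset Bij_imp_extensional by blast
qed (use assms in \<open>intro finite_PiE\<close>)

lemma finite_Hom:
  assumes "finite (carrier B)" "prime p"
  shows "finite (Hom_brace p B)" "finite (Hom_circ p B)"
proof -
  have "finite (carrier B \<rightarrow>\<^sub>E carrier (Zstar p))"
    using assms by (intro finite_PiE) (simp_all add: Zstar_carrier)
  moreover have "Hom_brace p B \<subseteq> carrier B \<rightarrow>\<^sub>E carrier (Zstar p)" "Hom_circ p B \<subseteq> carrier B \<rightarrow>\<^sub>E carrier (Zstar p)"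
    unfolding PiE_def by (auto simp: Hom_brace_def Hom_circ_def hom_def)
  ultimately show "finite (Hom_brace p B)" "finite (Hom_circ p B)"
    using finite_subset by blast+
qed

lemma card_orbits_Aut:
  assumes "finite (carrier B)" "prime p"
  shows "real (card (orbits (Aut_brace B) (Hom_brace p B) (ract B))) =
    1 / real (order (Aut_brace B)) *
      (\<Sum>\<sigma>\<in>Hom_brace p B. real (card (stabilizer (Aut_brace B) (ract B) \<sigma>)))"
  unfolding Aut_brace_def ract_eq
  by (rule right_action.card_orbits[OF right_action_Aut])
    (use assms finite_brace_aut finite_Hom in auto)

lemma card_orbits_A:
  assumes "finite (carrier B)" "prime p" "\<sigma> \<in> Hom_brace p B"
  shows "real (card (orbits (A_group B \<sigma>) (Hom_circ p B) (ract B))) =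
    1 / real (order (A_group B \<sigma>)) *
      (\<Sum>\<tau>\<in>Hom_circ p B. real (card (stabilizer (A_group B \<sigma>) (ract B) \<tau>)))"
  unfolding A_group_def ract_eq
  by (rule right_action.card_orbits[OF right_action_A[OF assms(3)]])
    (use assms finite_brace_aut finite_Hom in auto)

lemma triv_hom_Hom_brace: "prime p \<Longrightarrow> triv_hom p B \<in> Hom_brace p B"
  using prime_gt_1_nat[of p]
  by (auto simp: triv_hom_def Hom_brace_def hom_def Zstar_carrier)

lemma triv_hom_Hom_circ: "prime p \<Longrightarrow> triv_hom p B \<in> Hom_circ p B"
  using triv_hom_Hom_brace by (simp add: Hom_brace_def Hom_circ_def)

end

lemma orbits_eq_image: "orbits G E \<phi> = orbit G \<phi> ` E"
  by (auto simp: orbits_def)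

lemma pair_isomorphic_eq:
  "pair_isomorphic x y \<longleftrightarrow> (\<exists>f\<in>brace_iso (fst x) (fst y). \<forall>c\<in>carrier (fst x). snd y (f c) = snd x c)"
  by (simp add: pair_isomorphic_def split_beta)

lemma pair_isomorphic_refl: "pair_isomorphic x x"
  by (auto simp: pair_isomorphic_eq intro!: bexI[OF _ brace_iso_id])

lemma pair_isomorphic_sym:
  assumes "skew_brace (fst x)" "pair_isomorphic x y"
  shows "pair_isomorphic y x"
proof -
  obtain f where f: "f \<in> brace_iso (fst x) (fst y)" "\<forall>c\<in>carrier (fst x). snd y (f c) = snd x c"
    using assms(2) by (auto simp: pair_isomorphic_eq)
  let ?g = "inv_into (carrier (fst x)) f"
  have "?g \<in> brace_iso (fst y) (fst x)"
    using assms(1) f(1) by (rule brace_iso_inverse)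
  moreover have "snd x (?g d) = snd y d" if "d \<in> carrier (fst y)" for d
  proof -
    have "d \<in> f ` carrier (fst x)"
      using brace_isoD(4)[OF f(1)] that by simp
    then have "f (?g d) = d" "?g d \<in> carrier (fst x)"
      by (rule f_inv_into_f, rule inv_into_into)
    then show ?thesis
      using f(2) by metis
  qed
  ultimately show ?thesis
    by (auto simp: pair_isomorphic_eq)
qed

lemma pair_isomorphic_trans:
  assumes "pair_isomorphic x y" "pair_isomorphic y z"
  shows "pair_isomorphic x z"
proof -
  obtain f g where fg: "f \<in> brace_iso (fst x) (fst y)" "g \<in> brace_iso (fst y) (fst z)"
    and "\<forall>c\<in>carrier (fst x). snd y (f c) = snd x c" "\<forall>c\<in>carrier (fst y). snd z (g c) = snd y c"
    using assms by (auto simp: pair_isomorphic_eq)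
  then have "\<forall>c\<in>carrier (fst x). snd z (g (f c)) = snd x c"
    using brace_homD(1)[OF brace_isoD(1)[OF fg(1)]] by simp
  then show ?thesis
    using brace_iso_compose[OF fg] by (auto simp: pair_isomorphic_eq)
qed

section \<open>Skew braces of size np with a fixed quotient\<close>

locale size_np =
  fixes p n :: nat
  assumes prime_p: "prime p" and n_pos: "n > 0" and p_ndvd_n: "\<not> p dvd n"
    and normal_p: "\<forall>G :: nat monoid. group G \<and> order G = n * p \<longrightarrow> (\<exists>H. H \<lhd> G \<and> card H = p)"
begin

lemma finite_carrier: "order B = n \<Longrightarrow> finite (carrier B)"
  using n_pos by (simp add: order_def card_ge_0_finite)

lemma ex_ext:
  assumes "E \<in> skew_braces (n * p)"
  obtains C \<pi> where "brace_ext E (C :: nat set skew_brace) \<pi> p"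
  using ex_brace_ext[OF normal_p prime_p n_pos p_ndvd_n assms] by blast

lemma quot:
  assumes "E \<in> skew_braces (n * p)"
  shows "skew_brace (fst (additive_pair p E))" "order (fst (additive_pair p E)) = n"
    and "\<exists>\<pi> \<tau>. ext_of p E (fst (additive_pair p E)) \<pi> (snd (additive_pair p E)) \<tau>"
proof -
  obtain C \<pi> where "brace_ext E (C :: nat set skew_brace) \<pi> p"
    using ex_ext[OF assms] .
  then interpret brace_ext E C \<pi> p .
  show ex: "\<exists>\<pi> \<tau>. ext_of p E (fst (additive_pair p E)) \<pi> (snd (additive_pair p E)) \<tau>"
    by (rule ext_of_additive_pair)
  then obtain \<pi>' where "brace_ext E (fst (additive_pair p E)) \<pi>' p"
    by (auto simp: ext_of_def)
  then interpret Q: brace_ext E "fst (additive_pair p E)" \<pi>' p .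
  show "skew_brace (fst (additive_pair p E))"
    by (rule Q.brace_C)
  have "order E = n * p"
    using assms by (simp add: skew_braces_def)
  then show "order (fst (additive_pair p E)) = n"
    using Q.add.order_G prime_gt_0_nat[OF prime_p] by (simp add: mult.commute)
qed

lemma pair_iff:
  assumes "E \<in> skew_braces (n * p)" "skew_brace B" "\<sigma> \<in> Hom_brace p B"
  shows "pair_isomorphic (additive_pair p E) (B, \<sigma>) \<longleftrightarrow> (\<exists>\<pi> \<tau>. ext_of p E B \<pi> \<sigma> \<tau>)"
proof -
  obtain C \<pi> where "brace_ext E (C :: nat set skew_brace) \<pi> p"
    using ex_ext[OF assms(1)] .
  then show ?thesis
    using assms by (intro pair_isomorphic_iff) (auto simp: Hom_brace_def)
qed

lemma ex_E:
  fixes B :: "'b skew_brace"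
  assumes "skew_brace B" "order B = n" "\<sigma> \<in> Hom_brace p B" "\<tau> \<in> Hom_circ p B"
    "t \<or> \<sigma> \<noteq> triv_hom p B"
  shows "\<exists>E\<in>skew_braces (n * p). \<exists>\<pi>. ext_of p E B \<pi> \<sigma> \<tau> \<and> plain_p p E = t"
  using ex_ext_of[OF assms(1) prime_p _ finite_carrier[OF assms(2)] assms(3,4,5)] assms(2) p_ndvd_n
  by simp

lemma plain_of_triv:
  assumes "ext_of p E B \<pi> (triv_hom p B) \<tau>"
  shows "plain_p p E"
proof -
  interpret brace_ext E B \<pi> p using assms by (simp add: ext_of_def)
  show ?thesis
    using assms by (intro plain_p_triv) (simp add: ext_of_def)
qed

text \<open>An isomorphism changes the projection by an automorphism of \<open>B\<close> that fixes
  \<sigma> and relates \<tau> to \<tau>'. Conversely, such an automorphism presents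
  \<open>E'\<close> with the data of \<open>E\<close>, and equal data in the same case determine the
  brace.\<close>

lemma isomorphic_iff:
  fixes B :: "'b skew_brace"
  assumes E: "E \<in> skew_braces (n * p)" "E' \<in> skew_braces (n * p)"
    and ext: "ext_of p E B \<pi> \<sigma> \<tau>" "ext_of p E' B \<pi>' \<sigma> \<tau>'"
  shows "brace_isomorphic E E' \<longleftrightarrow>
    orbit (A_group B \<sigma>) (ract B) \<tau> = orbit (A_group B \<sigma>) (ract B) \<tau>' \<and> plain_p p E = plain_p p E'"
proof -
  interpret brace_ext E B \<pi> p using ext(1) by (simp add: ext_of_def)
  have b: "skew_brace E" "skew_brace E'"
    using E by (auto simp: skew_braces_def)
  note Hom = ext_of_Hom[OF ext(1)] ext_of_Hom(2)[OF ext(2)]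
  note orb = C.orbit_A_eq_iff[OF Hom]
  show ?thesis
  proof
    assume "brace_isomorphic E E'"
    then obtain f where f: "f \<in> brace_iso E E'"
      by (auto simp: brace_isomorphic_def)
    obtain \<pi>'' where "ext_of p E B \<pi>'' \<sigma> \<tau>'"
      using ext_of_iso[OF ext(2) b(1) f] by blast
    from ext_of_unique[OF ext(1) this] plain_p_iso[OF ext(2) b(1) f]
    show "orbit (A_group B \<sigma>) (ract B) \<tau> = orbit (A_group B \<sigma>) (ract B) \<tau>' \<and> plain_p p E = plain_p p E'"
      unfolding orb by blast
  next
    assume *: "orbit (A_group B \<sigma>) (ract B) \<tau> = orbit (A_group B \<sigma>) (ract B) \<tau>' \<and> plain_p p E = plain_p p E'"
    then obtain f where f: "f \<in> brace_iso B B" "\<forall>b\<in>carrier B. \<sigma> (f b) = \<sigma> b \<and> \<tau>' (f b) = \<tau> b"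
      unfolding orb by blast
    obtain \<pi>'' where "ext_of p E' B \<pi>'' \<sigma> \<tau>"
      using ext_of_iso_quotient[OF ext(2) brace_C f(1), of \<sigma> \<tau>] f(2) Hom
      by (auto simp: Hom_brace_def Hom_circ_def)
    then show "brace_isomorphic E E'"
      using isomorphic_of_ext[OF ext(1)] * by blast
  qed
qed

lemma card_classes_over:
  fixes B :: "'b skew_brace"
  assumes B: "skew_brace B" "order B = n" and \<sigma>: "\<sigma> \<in> Hom_brace p B"
  shows "card (iso_classes brace_isomorphic
      {E \<in> skew_braces (n * p). pair_isomorphic (additive_pair p E) (B, \<sigma>)}) =
    (if \<sigma> = triv_hom p B
     then card (orbits (A_group B \<sigma>) (Hom_circ p B) (ract B))
     else 2 * card (orbits (A_group B \<sigma>) (Hom_circ p B) (ract B)))"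
proof -
  \<comment> \<open>The possible values of \<open>plain_p\<close>: one for trivial \<sigma>, two
    otherwise. This is where the factor 2 is counted.\<close>
  define T where "T = (if \<sigma> = triv_hom p B then {True} else UNIV)"
  let ?o = "orbit (A_group B \<sigma>) (ract B)"
  let ?S = "{E \<in> skew_braces (n * p). pair_isomorphic (additive_pair p E) (B, \<sigma>)}"
  have "card (iso_classes brace_isomorphic ?S) = card (map_prod ?o id ` (Hom_circ p B \<times> T))"
  proof (rule card_iso_classes[where M = "\<lambda>E (\<tau>, t). (\<exists>\<pi>. ext_of p E B \<pi> \<sigma> \<tau>) \<and> plain_p p E = t"])
    fix E assume E: "E \<in> ?S"
    then obtain \<pi> \<tau> where ext: "ext_of p E B \<pi> \<sigma> \<tau>"
      using pair_iff[of E B \<sigma>] B \<sigma> by auto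
    moreover have "plain_p p E \<in> T"
      using plain_of_triv ext by (auto simp: T_def)
    ultimately show "\<exists>y\<in>Hom_circ p B \<times> T. case y of (\<tau>, t) \<Rightarrow> (\<exists>\<pi>. ext_of p E B \<pi> \<sigma> \<tau>) \<and> plain_p p E = t"
      using ext_of_Hom(2)[OF ext] by (intro bexI[of _ "(\<tau>, plain_p p E)"]) auto
  next
    fix y assume "y \<in> Hom_circ p B \<times> T"
    then obtain \<tau> t where y: "y = (\<tau>, t)" "\<tau> \<in> Hom_circ p B" "t \<in> T" by auto
    then have "t \<or> \<sigma> \<noteq> triv_hom p B"
      by (auto simp: T_def split: if_splits)
    from ex_E[OF B \<sigma> y(2) this]
    show "\<exists>E\<in>?S. case y of (\<tau>, t) \<Rightarrow> (\<exists>\<pi>. ext_of p E B \<pi> \<sigma> \<tau>) \<and> plain_p p E = t"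
      using pair_iff[OF _ B(1) \<sigma>] y by auto
  next
    fix E E' y y'
    assume E: "E \<in> ?S" "E' \<in> ?S"
      and "case y of (\<tau>, t) \<Rightarrow> (\<exists>\<pi>. ext_of p E B \<pi> \<sigma> \<tau>) \<and> plain_p p E = t"
      "case y' of (\<tau>, t) \<Rightarrow> (\<exists>\<pi>. ext_of p E' B \<pi> \<sigma> \<tau>) \<and> plain_p p E' = t"
    then obtain \<tau> \<pi> \<tau>' \<pi>' where y: "y = (\<tau>, plain_p p E)" "y' = (\<tau>', plain_p p E')"
      and ext: "ext_of p E B \<pi> \<sigma> \<tau>" "ext_of p E' B \<pi>' \<sigma> \<tau>'"
      by (cases y, cases y') auto
    have "E \<in> skew_braces (n * p)" "E' \<in> skew_braces (n * p)"
      using E by simp_all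
    from isomorphic_iff[OF this ext]
    show "brace_isomorphic E E' = (map_prod ?o id y = map_prod ?o id y')"
      by (simp add: y)
  qed (use brace_isomorphic_refl brace_isomorphic_sym brace_isomorphic_trans in
    \<open>auto simp: skew_braces_def\<close>)
  also have "map_prod ?o id ` (Hom_circ p B \<times> T) = orbits (A_group B \<sigma>) (Hom_circ p B) (ract B) \<times> T"
    by (force simp: orbits_eq_image)
  finally show ?thesis
    by (simp add: card_cartesian_product T_def card_UNIV_bool)
qed

end

context size_np
begin

lemma ex_ext_of_quot:
  assumes E: "E \<in> skew_braces (n * p)" and B: "skew_brace B"
    and "brace_isomorphic (fst (additive_pair p E)) B"
  shows "\<exists>\<pi> \<sigma> \<tau>. ext_of p E B \<pi> \<sigma> \<tau>"
proof -
  obtain \<pi> \<tau> where ext: "ext_of p E (fst (additive_pair p E)) \<pi> (snd (additive_pair p E)) \<tau>"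
    using quot(3)[OF E] by blast
  obtain g where g: "g \<in> brace_iso B (fst (additive_pair p E))"
    using brace_isomorphic_sym[OF quot(1)[OF E] assms(3)] by (auto simp: brace_isomorphic_def)
  have "\<exists>\<pi>'. ext_of p E B \<pi>' (\<lambda>b\<in>carrier B. snd (additive_pair p E) (g b)) (\<lambda>b\<in>carrier B. \<tau> (g b))"
    by (rule ext_of_iso_quotient[OF ext B g]) simp_all
  then show ?thesis by blast
qed

lemma pair_isomorphic_pairs_iff:
  assumes E: "E \<in> skew_braces (n * p)" "E' \<in> skew_braces (n * p)" and B: "skew_brace B"
    and iso: "pair_isomorphic (additive_pair p E) (B, \<sigma>)" "pair_isomorphic (additive_pair p E') (B, \<sigma>')"
    and \<sigma>: "\<sigma> \<in> Hom_brace p B" "\<sigma>' \<in> Hom_brace p B"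
  shows "pair_isomorphic (additive_pair p E) (additive_pair p E') \<longleftrightarrow>
    orbit (Aut_brace B) (ract B) \<sigma> = orbit (Aut_brace B) (ract B) \<sigma>'"
proof -
  have sym: "pair_isomorphic (B, \<sigma>) (additive_pair p E)" "pair_isomorphic (B, \<sigma>') (additive_pair p E')"
    using iso quot(1)[OF E(1)] quot(1)[OF E(2)] pair_isomorphic_sym by blast+
  have "pair_isomorphic (additive_pair p E) (additive_pair p E') \<longleftrightarrow> pair_isomorphic (B, \<sigma>) (B, \<sigma>')"
    using iso sym pair_isomorphic_trans by metis
  also have "\<dots> \<longleftrightarrow> (\<exists>f\<in>brace_iso B B. \<forall>b\<in>carrier B. \<sigma>' (f b) = \<sigma> b)"
    by (simp add: pair_isomorphic_eq)
  also have "\<dots> \<longleftrightarrow> orbit (Aut_brace B) (ract B) \<sigma> = orbit (Aut_brace B) (ract B) \<sigma>'"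
    using skew_brace.orbit_Aut_eq_iff[OF B \<sigma>] by simp
  finally show ?thesis .
qed

text \<open>An additive structure leaves \<tau> open, so the trivial \<tau> serves as a
  witness.\<close>

lemma ex_pair:
  fixes B :: "'b skew_brace"
  assumes B: "skew_brace B" "order B = n" and \<sigma>: "\<sigma> \<in> Hom_brace p B"
  shows "\<exists>E\<in>skew_braces (n * p). pair_isomorphic (additive_pair p E) (B, \<sigma>)"
  using ex_E[OF B \<sigma> skew_brace.triv_hom_Hom_circ[OF B(1) prime_p], of True] pair_iff[OF _ B(1) \<sigma>]
  by blast

theorem card_additive_structures_over:
  fixes B :: "'b skew_brace"
  assumes B: "skew_brace B" "order B = n"
  shows "card (additive_structures_over p (n * p) B) =
    card (orbits (Aut_brace B) (Hom_brace p B) (ract B))"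
  unfolding additive_structures_over_def orbits_eq_image
proof (rule card_iso_classes[where M = "\<lambda>x \<sigma>. pair_isomorphic x (B, \<sigma>)"])
  let ?S = "additive_pair p ` {E \<in> skew_braces (n * p). brace_isomorphic (quot_brace E (sub_p p E)) B}"
  have quot_eq: "quot_brace E (sub_p p E) = fst (additive_pair p E)" for E :: "nat skew_brace"
    by (simp add: additive_pair_def)
  fix x assume "x \<in> ?S"
  then obtain E where E: "x = additive_pair p E" "E \<in> skew_braces (n * p)" "brace_isomorphic (fst x) B"
    by (auto simp: quot_eq)
  show "pair_isomorphic x x"
    by (rule pair_isomorphic_refl)
  obtain \<pi> \<sigma> \<tau> where ext: "ext_of p E B \<pi> \<sigma> \<tau>"
    using ex_ext_of_quot[OF E(2) B(1)] E by blast
  then show "\<exists>\<sigma>\<in>Hom_brace p B. pair_isomorphic x (B, \<sigma>)"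
    using ext_of_Hom(1)[OF ext] pair_iff[OF E(2) B(1)] E(1) by blast
  fix y assume "y \<in> ?S"
  then obtain E' where E': "y = additive_pair p E'" "E' \<in> skew_braces (n * p)"
    by (auto simp: quot_eq)
  show "pair_isomorphic x y \<Longrightarrow> pair_isomorphic y x"
    using quot(1)[OF E(2)] pair_isomorphic_sym unfolding E(1) by blast
  show "pair_isomorphic x y \<Longrightarrow> pair_isomorphic y z \<Longrightarrow> pair_isomorphic x z" for z
    by (rule pair_isomorphic_trans)
  fix \<sigma> \<sigma>'
  assume "\<sigma> \<in> Hom_brace p B" "\<sigma>' \<in> Hom_brace p B" "pair_isomorphic x (B, \<sigma>)" "pair_isomorphic y (B, \<sigma>')"
  then show "pair_isomorphic x y \<longleftrightarrow>
      orbit (Aut_brace B) (ract B) \<sigma> = orbit (Aut_brace B) (ract B) \<sigma>'"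
    unfolding E(1) E'(1) using E(2) E'(2) B(1) by (intro pair_isomorphic_pairs_iff)
next
  fix \<sigma> assume \<sigma>: "\<sigma> \<in> Hom_brace p B"
  obtain E where E: "E \<in> skew_braces (n * p)" "pair_isomorphic (additive_pair p E) (B, \<sigma>)"
    using ex_pair[OF B \<sigma>] by blast
  then have "brace_isomorphic (quot_brace E (sub_p p E)) B"
    by (auto simp: pair_isomorphic_def additive_pair_def brace_isomorphic_def)
  then show "\<exists>x\<in>additive_pair p ` {E \<in> skew_braces (n * p). brace_isomorphic (quot_brace E (sub_p p E)) B}.
      pair_isomorphic x (B, \<sigma>)"
    using E by blast
qed

section \<open>Summation over representatives of the quotient braces\<close>

context
  fixes R :: "nat skew_brace set"
  assumes R: "representatives R (iso_classes brace_isomorphic (skew_braces n))"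
begin

lemma R_skew_braces: "B \<in> R \<Longrightarrow> skew_brace B" "B \<in> R \<Longrightarrow> order B = n"
  and R_ex: "C \<in> skew_braces n \<Longrightarrow> \<exists>B\<in>R. brace_isomorphic C B"
  and R_unique: "\<lbrakk>B \<in> R; B' \<in> R; brace_isomorphic B B'\<rbrakk> \<Longrightarrow> B = B'"
proof -
  have equiv: "\<And>x. x \<in> skew_braces n \<Longrightarrow> brace_isomorphic x x"
    "\<And>x y. \<lbrakk>x \<in> skew_braces n; y \<in> skew_braces n; brace_isomorphic x y\<rbrakk> \<Longrightarrow> brace_isomorphic y x"
    "\<And>x y z. \<lbrakk>x \<in> skew_braces n; y \<in> skew_braces n; z \<in> skew_braces n;
      brace_isomorphic x y; brace_isomorphic y z\<rbrakk> \<Longrightarrow> brace_isomorphic x z"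
    using brace_isomorphic_refl brace_isomorphic_sym brace_isomorphic_trans
    unfolding skew_braces_def by blast+
  have sub: "R \<subseteq> skew_braces n"
    by (rule representatives_iso_classes(1)[OF R]) (use equiv in blast)+
  then show "B \<in> R \<Longrightarrow> skew_brace B" "B \<in> R \<Longrightarrow> order B = n"
    by (auto simp: skew_braces_def)
  show "\<exists>B\<in>R. brace_isomorphic C B" if "C \<in> skew_braces n"
    by (rule representatives_iso_classes(2)[OF R]) (use equiv that in blast)+
  show "B = B'" if "B \<in> R" "B' \<in> R" "brace_isomorphic B B'"
    by (rule representatives_iso_classes(3)[OF R]) (use equiv that in blast)+
qed

lemma R_Hom:
  assumes "B \<in> R"
  shows "finite (Hom_brace p B)" "finite (Hom_circ p B)" "triv_hom p B \<in> Hom_brace p B"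
    "triv_hom p B \<in> Hom_circ p B"
  using skew_brace.finite_Hom[OF R_skew_braces(1) finite_carrier[OF R_skew_braces(2)] prime_p]
    skew_brace.triv_hom_Hom_brace[OF R_skew_braces(1) prime_p]
    skew_brace.triv_hom_Hom_circ[OF R_skew_braces(1) prime_p] assms by auto

text \<open>The quotient is a brace on sets of cosets, so it is first copied to the natural numbers,
  where \<open>R\<close> has its representatives.\<close>

lemma ex_R:
  assumes E: "E \<in> skew_braces (n * p)"
  shows "\<exists>B\<in>R. \<exists>\<pi> \<sigma> \<tau>. ext_of p E B \<pi> \<sigma> \<tau>"
proof -
  let ?Q = "fst (additive_pair p E)"
  note Q = quot(1,2)[OF E]
  obtain C f where C: "(C :: nat skew_brace) \<in> skew_braces (order ?Q)" "f \<in> brace_iso ?Q C"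
    using ex_nat_brace[OF Q(1) finite_carrier[OF Q(2)]] .
  then obtain B where B: "B \<in> R" "brace_isomorphic C B"
    using R_ex Q(2) by auto
  moreover have "brace_isomorphic ?Q C"
    using C(2) by (auto simp: brace_isomorphic_def)
  ultimately have "brace_isomorphic ?Q B"
    using brace_isomorphic_trans by blast
  then show ?thesis
    using ex_ext_of_quot[OF E R_skew_braces(1)[OF B(1)]] B(1) by blast
qed

theorem card_additive_structures:
  "real (card (additive_structures p (n * p))) =
    (\<Sum>B\<in>R. 1 / real (order (Aut_brace B)) *
      (\<Sum>\<sigma>\<in>Hom_brace p B. real (card (stabilizer (Aut_brace B) (ract B) \<sigma>))))"
proof -
  \<comment> \<open>The first component stays as it is, because distinct elements of
    \<open>R\<close> are not isomorphic; only the second is taken up to automorphisms.\<close>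
  let ?G = "\<lambda>(B, \<sigma>). (B, orbit (Aut_brace B) (ract B) \<sigma>)"
  let ?Y = "Sigma R (Hom_brace p)"
  have "card (additive_structures p (n * p)) = card (?G ` ?Y)"
    unfolding additive_structures_def
  proof (rule card_iso_classes[where M = pair_isomorphic])
    fix x assume "x \<in> additive_pair p ` skew_braces (n * p)"
    then obtain E where E: "x = additive_pair p E" "E \<in> skew_braces (n * p)"
      by blast
    show "pair_isomorphic x x"
      by (rule pair_isomorphic_refl)
    obtain B \<pi> \<sigma> \<tau> where B: "B \<in> R" and ext: "ext_of p E B \<pi> \<sigma> \<tau>"
      using ex_R[OF E(2)] by blast
    then have "pair_isomorphic x (B, \<sigma>)"
      using ext_of_Hom(1)[OF ext] pair_iff[OF E(2) R_skew_braces(1)[OF B]] E(1) by blast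
    then show "\<exists>y\<in>?Y. pair_isomorphic x y"
      using B ext_of_Hom(1)[OF ext] by blast
    fix y assume "y \<in> additive_pair p ` skew_braces (n * p)"
    then obtain E' where E': "y = additive_pair p E'" "E' \<in> skew_braces (n * p)"
      by blast
    show "pair_isomorphic x y \<Longrightarrow> pair_isomorphic y x"
      using quot(1)[OF E(2)] pair_isomorphic_sym unfolding E(1) by blast
    show "pair_isomorphic x y \<Longrightarrow> pair_isomorphic y z \<Longrightarrow> pair_isomorphic x z" for z
      by (rule pair_isomorphic_trans)
    fix u v assume u: "u \<in> ?Y" "pair_isomorphic x u" and v: "v \<in> ?Y" "pair_isomorphic y v"
    obtain B \<sigma> B' \<sigma>' where uv: "u = (B, \<sigma>)" "v = (B', \<sigma>')"
      by (cases u, cases v)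
    have B: "B \<in> R" "B' \<in> R" "\<sigma> \<in> Hom_brace p B" "\<sigma>' \<in> Hom_brace p B'"
      using u(1) v(1) by (auto simp: uv)
    show "pair_isomorphic x y \<longleftrightarrow> ?G u = ?G v"
    proof (cases "B = B'")
      case True
      then show ?thesis
        using pair_isomorphic_pairs_iff[OF E(2) E'(2) R_skew_braces(1)[OF B(1)], of \<sigma> \<sigma>'] u v B
        by (simp add: uv E(1) E'(1))
    next
      case False
      have "\<not> pair_isomorphic x y"
      proof
        assume xy: "pair_isomorphic x y"
        have "pair_isomorphic u x"
          using u(2) quot(1)[OF E(2)] E(1) pair_isomorphic_sym by blast
        then have "pair_isomorphic u v"
          by (rule pair_isomorphic_trans[OF _ pair_isomorphic_trans[OF xy v(2)]])
        then have "brace_isomorphic B B'"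
          by (auto simp: uv pair_isomorphic_def brace_isomorphic_def)
        then show False
          using R_unique B False by blast
      qed
      then show ?thesis
        using False by (simp add: uv)
    qed
  next
    fix y assume "y \<in> ?Y"
    then obtain B \<sigma> where y: "y = (B, \<sigma>)" "B \<in> R" "\<sigma> \<in> Hom_brace p B"
      by blast
    then show "\<exists>x\<in>additive_pair p ` skew_braces (n * p). pair_isomorphic x y"
      using ex_pair[OF R_skew_braces] by blast
  qed
  also have "?G ` ?Y = Sigma R (\<lambda>B. orbits (Aut_brace B) (Hom_brace p B) (ract B))"
    by (force simp: orbits_eq_image)
  also have "card \<dots> = (\<Sum>B\<in>R. card (orbits (Aut_brace B) (Hom_brace p B) (ract B)))"
  proof (rule card_Sigma_nonempty)
    fix B assume "B \<in> R"
    then show "finite (orbits (Aut_brace B) (Hom_brace p B) (ract B)) \<and>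
        orbits (Aut_brace B) (Hom_brace p B) (ract B) \<noteq> {}"
      using R_Hom[of B] by (auto simp: orbits_eq_image)
  qed
  finally have eq: "card (additive_structures p (n * p)) =
    (\<Sum>B\<in>R. card (orbits (Aut_brace B) (Hom_brace p B) (ract B)))" .
  show ?thesis
    unfolding eq of_nat_sum
  proof (rule sum.cong[OF refl])
    fix B assume "B \<in> R"
    note B = R_skew_braces[OF this]
    show "real (card (orbits (Aut_brace B) (Hom_brace p B) (ract B))) =
        1 / real (order (Aut_brace B)) *
          (\<Sum>\<sigma>\<in>Hom_brace p B. real (card (stabilizer (Aut_brace B) (ract B) \<sigma>)))"
      by (rule skew_brace.card_orbits_Aut[OF B(1) finite_carrier[OF B(2)] prime_p])
  qed
qed

context
  fixes S :: "nat skew_brace \<Rightarrow> (nat \<Rightarrow> int) set"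
  assumes S: "\<forall>B\<in>R. representatives (S B)
    (orbits (Aut_brace B) (Hom_brace p B) (ract B) - {{triv_hom p B}})"
begin

text \<open>Being a fixed point, the trivial homomorphism forms an orbit by itself. So removing its
  singleton removes one whole orbit, and adding it to \<open>S B\<close> yields representatives of
  all orbits.\<close>

lemma orbit_triv_hom:
  assumes "B \<in> R"
  shows "orbit (Aut_brace B) (ract B) (triv_hom p B) = {triv_hom p B}"
proof -
  interpret skew_brace B using R_skew_braces assms by blast
  have g: "compose (carrier B) (triv_hom p B) g = triv_hom p B" if "g \<in> brace_aut B" for g
    using that brace_homD(1)[of g B B] by (auto simp: compose_def triv_hom_def brace_aut_def)
  have "orbit (Aut_brace B) (ract B) (triv_hom p B) =
      (\<lambda>g. compose (carrier B) (triv_hom p B) g) ` brace_aut B"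
    by (auto simp: orbit_def ract_eq Aut_brace_def)
  also have "\<dots> = (\<lambda>_. triv_hom p B) ` brace_aut B"
    by (intro image_cong refl g)
  also have "\<dots> = {triv_hom p B}"
    using subgroup.one_closed[OF subgroup_brace_aut] by auto
  finally show ?thesis .
qed

lemma orbit_mem_iff:
  assumes B: "B \<in> R" and "\<sigma> \<in> Hom_brace p B"
  shows "\<sigma>' \<in> orbit (Aut_brace B) (ract B) \<sigma> \<longleftrightarrow>
    \<sigma>' \<in> Hom_brace p B \<and> orbit (Aut_brace B) (ract B) \<sigma>' = orbit (Aut_brace B) (ract B) \<sigma>"
proof -
  interpret skew_brace B using R_skew_braces B by blast
  have "\<sigma>' \<in> orbit (Aut_brace B) (ract B) \<sigma> \<longleftrightarrow> (\<exists>g\<in>brace_aut B. compose (carrier B) \<sigma> g = \<sigma>')"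
    by (auto simp: orbit_def ract_eq Aut_brace_def)
  then show ?thesis
    using right_action.orbit_eq_iff[OF right_action_Aut _ assms(2), of \<sigma>'] compose_Hom_brace assms(2)
    by (auto simp: Aut_brace_def ract_eq)
qed

lemma S_Hom: "\<lbrakk>B \<in> R; \<sigma> \<in> S B\<rbrakk> \<Longrightarrow> \<sigma> \<in> Hom_brace p B"
  and S_triv: "B \<in> R \<Longrightarrow> triv_hom p B \<notin> S B"
  and S_ex: "\<lbrakk>B \<in> R; \<sigma> \<in> Hom_brace p B\<rbrakk> \<Longrightarrow> \<exists>\<sigma>'\<in>insert (triv_hom p B) (S B).
    orbit (Aut_brace B) (ract B) \<sigma>' = orbit (Aut_brace B) (ract B) \<sigma>"
  and S_unique: "\<lbrakk>B \<in> R; \<sigma> \<in> insert (triv_hom p B) (S B); \<sigma>' \<in> insert (triv_hom p B) (S B);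
    orbit (Aut_brace B) (ract B) \<sigma> = orbit (Aut_brace B) (ract B) \<sigma>'\<rbrakk> \<Longrightarrow> \<sigma> = \<sigma>'"
proof -
  fix B assume B: "B \<in> R"
  let ?o = "orbit (Aut_brace B) (ract B)" and ?t = "triv_hom p B"
  let ?O = "orbits (Aut_brace B) (Hom_brace p B) (ract B)"
  have S1: "S B \<subseteq> \<Union>(?O - {{?t}})" and S2: "\<And>C. C \<in> ?O - {{?t}} \<Longrightarrow> \<exists>!x. x \<in> C \<and> x \<in> S B"
    using S B unfolding representatives_def by blast+
  note t = R_Hom(3)[OF B]
  have mem: "\<sigma> \<in> Hom_brace p B \<and> ?o \<sigma> \<in> ?O - {{?t}}" if "\<sigma> \<in> S B" for \<sigma>
  proof -
    obtain C where "C \<in> ?O - {{?t}}" "\<sigma> \<in> C"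
      using S1 \<open>\<sigma> \<in> S B\<close> by blast
    moreover then obtain \<sigma>0 where "\<sigma>0 \<in> Hom_brace p B" "C = ?o \<sigma>0"
      by (auto simp: orbits_eq_image)
    ultimately show ?thesis
      using orbit_mem_iff[OF B, of \<sigma>0 \<sigma>] by auto
  qed
  show Hom: "\<sigma> \<in> Hom_brace p B" if "\<sigma> \<in> S B" for \<sigma>
    using mem[OF that] by blast
  show triv: "?t \<notin> S B"
    using mem[of ?t] orbit_triv_hom[OF B] by auto
  show "\<exists>\<sigma>'\<in>insert ?t (S B). ?o \<sigma>' = ?o \<sigma>" if \<sigma>: "\<sigma> \<in> Hom_brace p B" for \<sigma>
  proof (cases "?o \<sigma> = {?t}")
    case True
    then show ?thesis
      using orbit_triv_hom[OF B] by auto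
  next
    case False
    then have "?o \<sigma> \<in> ?O - {{?t}}"
      using \<sigma> by (auto simp: orbits_eq_image)
    then obtain \<sigma>' where "\<sigma>' \<in> ?o \<sigma>" "\<sigma>' \<in> S B"
      using S2 by blast
    then show ?thesis
      using orbit_mem_iff[OF B \<sigma>] by blast
  qed
  show "\<sigma> = \<sigma>'" if "\<sigma> \<in> insert ?t (S B)" "\<sigma>' \<in> insert ?t (S B)" and eq: "?o \<sigma> = ?o \<sigma>'" for \<sigma> \<sigma>'
  proof -
    have *: "\<sigma> \<in> ?o \<sigma>" "\<sigma>' \<in> ?o \<sigma>"
      using orbit_mem_iff[OF B, of \<sigma>] orbit_mem_iff[OF B, of \<sigma>] that Hom t eq by auto
    show ?thesis
    proof (cases "\<sigma> \<in> S B")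
      case True
      then have "\<sigma>' \<noteq> ?t"
        using mem[OF True] eq orbit_triv_hom[OF B] by auto
      then show ?thesis
        using S2[of "?o \<sigma>"] mem[OF True] that * True by blast
    next
      case False
      then have "\<sigma> = ?t"
        using that(1) by simp
      then show ?thesis
        using *(2) orbit_triv_hom[OF B] by simp
    qed
  qed
qed

theorem card_skew_braces:
  "real (card (iso_classes brace_isomorphic (skew_braces (n * p)))) =
    (\<Sum>B\<in>R.
      1 / real (order (A_group B (triv_hom p B))) *
        (\<Sum>\<tau>\<in>Hom_circ p B. real (card (stabilizer (A_group B (triv_hom p B)) (ract B) \<tau>))) +
      2 * (\<Sum>\<sigma>\<in>S B. 1 / real (order (A_group B \<sigma>)) *
        (\<Sum>\<tau>\<in>Hom_circ p B. real (card (stabilizer (A_group B \<sigma>) (ract B) \<tau>)))))"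
proof -
  define T :: "nat skew_brace \<Rightarrow> (nat \<Rightarrow> int) \<Rightarrow> bool set"
    where "T B \<sigma> = (if \<sigma> = triv_hom p B then {True} else UNIV)" for B \<sigma>
  let ?I = "\<lambda>B. insert (triv_hom p B) (S B)"
  let ?O = "\<lambda>B \<sigma>. orbits (A_group B \<sigma>) (Hom_circ p B) (ract B)"
  \<comment> \<open>With \<sigma> restricted to chosen representatives, the freedom left for \<tau>
    is the stabilizer of \<sigma>; hence the orbits under \<open>A_group B \<sigma>\<close> in
    \<open>?G\<close>.\<close>
  let ?Y = "Sigma R (\<lambda>B. Sigma (?I B) (\<lambda>\<sigma>. Hom_circ p B \<times> T B \<sigma>))"
  let ?G = "\<lambda>(B, \<sigma>, \<tau>, t). (B, \<sigma>, orbit (A_group B \<sigma>) (ract B) \<tau>, t)"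
  let ?M = "\<lambda>E (B, \<sigma>, \<tau>, t). (\<exists>\<pi>. ext_of p E B \<pi> \<sigma> \<tau>) \<and> plain_p p E = t"
  have I_Hom: "\<sigma> \<in> Hom_brace p B" if "B \<in> R" "\<sigma> \<in> ?I B" for B \<sigma>
    using that S_Hom R_Hom(3) by auto
  have fin: "finite (?O B \<sigma> \<times> T B \<sigma>) \<and> ?O B \<sigma> \<times> T B \<sigma> \<noteq> {}" if "B \<in> R" for B \<sigma>
    using R_Hom(2,4)[OF that] by (auto simp: orbits_eq_image T_def intro!: finite_cartesian_product)
  have finI: "finite (?I B)" if "B \<in> R" for B
    by (rule finite_subset[OF _ R_Hom(1)[OF that]]) (use I_Hom[OF that] in blast)
  have sum: "card (Sigma (?I B) (\<lambda>\<sigma>. ?O B \<sigma> \<times> T B \<sigma>)) =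
      (\<Sum>\<sigma>\<in>?I B. card (?O B \<sigma>) * card (T B \<sigma>))" if "B \<in> R" for B
    using fin[OF that] by (subst card_Sigma_nonempty) (simp_all add: card_cartesian_product)
  have "card (iso_classes brace_isomorphic (skew_braces (n * p))) = card (?G ` ?Y)"
  proof (rule card_iso_classes[where M = ?M])
    fix E :: "nat skew_brace" assume E: "E \<in> skew_braces (n * p)"
    obtain B \<pi> \<sigma>0 \<tau>0 where B: "B \<in> R" and ext0: "ext_of p E B \<pi> \<sigma>0 \<tau>0"
      using ex_R[OF E] by blast
    note B' = R_skew_braces(1)[OF B]
    \<comment> \<open>An automorphism of \<open>B\<close> takes the action found to its chosen
      representative, and the multiplicative action must be pulled back along the same
      automorphism.\<close>
    obtain \<sigma> where \<sigma>: "\<sigma> \<in> ?I B" "orbit (Aut_brace B) (ract B) \<sigma> = orbit (Aut_brace B) (ract B) \<sigma>0"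
      using S_ex[OF B ext_of_Hom(1)[OF ext0]] by blast
    then obtain f where f: "f \<in> brace_iso B B" "\<forall>b\<in>carrier B. \<sigma>0 (f b) = \<sigma> b"
      using skew_brace.orbit_Aut_eq_iff[OF B' I_Hom[OF B \<sigma>(1)] ext_of_Hom(1)[OF ext0]] by blast
    obtain \<pi>' where ext: "ext_of p E B \<pi>' \<sigma> (\<lambda>b\<in>carrier B. \<tau>0 (f b))"
      using ext_of_iso_quotient[OF ext0 B' f(1), of \<sigma> "\<lambda>b\<in>carrier B. \<tau>0 (f b)"] f(2) I_Hom[OF B \<sigma>(1)]
      by (auto simp: Hom_brace_def)
    have "plain_p p E \<in> T B \<sigma>"
      using plain_of_triv ext by (auto simp: T_def)
    then show "\<exists>y\<in>?Y. ?M E y"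
      using B \<sigma>(1) ext ext_of_Hom(2)[OF ext]
      by (intro bexI[of _ "(B, \<sigma>, \<lambda>b\<in>carrier B. \<tau>0 (f b), plain_p p E)"]) auto
  next
    fix y assume "y \<in> ?Y"
    then obtain B \<sigma> \<tau> t where y: "y = (B, \<sigma>, \<tau>, t)" "B \<in> R" "\<sigma> \<in> ?I B" "\<tau> \<in> Hom_circ p B" "t \<in> T B \<sigma>"
      by (cases y) blast
    then have "t \<or> \<sigma> \<noteq> triv_hom p B"
      by (auto simp: T_def split: if_splits)
    from ex_E[OF R_skew_braces[OF y(2)] I_Hom[OF y(2,3)] y(4) this]
    show "\<exists>E\<in>skew_braces (n * p). ?M E y"
      by (simp add: y(1))
  next
    fix E E' :: "nat skew_brace" and y y'
    assume E: "E \<in> skew_braces (n * p)" "E' \<in> skew_braces (n * p)" and y: "y \<in> ?Y" "?M E y"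
      and y': "y' \<in> ?Y" "?M E' y'"
    obtain B \<sigma> \<tau> t where yeq: "y = (B, \<sigma>, \<tau>, t)" by (cases y)
    obtain B' \<sigma>' \<tau>' t' where yeq': "y' = (B', \<sigma>', \<tau>', t')" by (cases y')
    have B: "B \<in> R" "\<sigma> \<in> ?I B" "t = plain_p p E" "B' \<in> R" "\<sigma>' \<in> ?I B'" "t' = plain_p p E'"
      using y y' by (simp_all add: yeq yeq')
    obtain \<pi> \<pi>' where ext: "ext_of p E B \<pi> \<sigma> \<tau>" "ext_of p E' B' \<pi>' \<sigma>' \<tau>'"
      using y y' by (auto simp: yeq yeq')
    show "brace_isomorphic E E' \<longleftrightarrow> ?G y = ?G y'"
    proof (cases "B = B' \<and> \<sigma> = \<sigma>'")
      case True
      then show ?thesis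
        using isomorphic_iff[OF E ext(1), of \<pi>' \<tau>'] ext(2) B by (simp add: yeq yeq')
    next
      case False
      \<comment> \<open>An isomorphism would make \<open>B\<close> and \<open>B'\<close> isomorphic,
        hence equal, and would then put \<sigma> and \<sigma>' into one orbit.\<close>
      have "\<not> brace_isomorphic E E'"
      proof
        assume "brace_isomorphic E E'"
        then obtain f where "f \<in> brace_iso E E'"
          by (auto simp: brace_isomorphic_def)
        then obtain \<pi>'' where "ext_of p E B' \<pi>'' \<sigma>' \<tau>'"
          using ext_of_iso[OF ext(2), of E f] E(1) by (auto simp: skew_braces_def)
        from ext_of_unique[OF ext(1) this] obtain h
          where h: "h \<in> brace_iso B B'" "\<forall>b\<in>carrier B. \<sigma>' (h b) = \<sigma> b"
          by blast
        then have BB: "B = B'"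
          using R_unique[OF B(1,4)] by (auto simp: brace_isomorphic_def)
        then have "orbit (Aut_brace B) (ract B) \<sigma> = orbit (Aut_brace B) (ract B) \<sigma>'"
          using skew_brace.orbit_Aut_eq_iff[OF R_skew_braces(1)[OF B(1)], of \<sigma> p \<sigma>'] h I_Hom B by auto
        then have "\<sigma> = \<sigma>'"
          using S_unique[OF B(1,2)] B(5) BB by simp
        then show False
          using False BB by simp
      qed
      then show ?thesis
        using False by (auto simp: yeq yeq')
    qed
  qed (use brace_isomorphic_refl brace_isomorphic_sym brace_isomorphic_trans in
    \<open>auto simp: skew_braces_def\<close>)
  also have "?G ` ?Y = Sigma R (\<lambda>B. Sigma (?I B) (\<lambda>\<sigma>. ?O B \<sigma> \<times> T B \<sigma>))"
  proof
    show "?G ` ?Y \<subseteq> Sigma R (\<lambda>B. Sigma (?I B) (\<lambda>\<sigma>. ?O B \<sigma> \<times> T B \<sigma>))"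
      by (auto simp: orbits_eq_image)
    show "Sigma R (\<lambda>B. Sigma (?I B) (\<lambda>\<sigma>. ?O B \<sigma> \<times> T B \<sigma>)) \<subseteq> ?G ` ?Y"
    proof
      fix z assume "z \<in> Sigma R (\<lambda>B. Sigma (?I B) (\<lambda>\<sigma>. ?O B \<sigma> \<times> T B \<sigma>))"
      then obtain B \<sigma> C t where z: "z = (B, \<sigma>, C, t)" "B \<in> R" "\<sigma> \<in> ?I B" "C \<in> ?O B \<sigma>" "t \<in> T B \<sigma>"
        by blast
      then obtain \<tau> where "\<tau> \<in> Hom_circ p B" "C = orbit (A_group B \<sigma>) (ract B) \<tau>"
        by (auto simp: orbits_eq_image)
      then show "z \<in> ?G ` ?Y"
        using z by (intro image_eqI[of _ _ "(B, \<sigma>, \<tau>, t)"]) auto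
    qed
  qed
  also have "card \<dots> = (\<Sum>B\<in>R. card (Sigma (?I B) (\<lambda>\<sigma>. ?O B \<sigma> \<times> T B \<sigma>)))"
  proof (rule card_Sigma_nonempty, rule conjI)
    fix B assume B: "B \<in> R"
    show "finite (Sigma (?I B) (\<lambda>\<sigma>. ?O B \<sigma> \<times> T B \<sigma>))"
      by (rule finite_SigmaI[OF finI[OF B] conjunct1[OF fin[OF B]]])
    show "Sigma (?I B) (\<lambda>\<sigma>. ?O B \<sigma> \<times> T B \<sigma>) \<noteq> {}"
      using fin[OF B] by blast
  qed
  finally have "real (card (iso_classes brace_isomorphic (skew_braces (n * p)))) =
      (\<Sum>B\<in>R. real (card (Sigma (?I B) (\<lambda>\<sigma>. ?O B \<sigma> \<times> T B \<sigma>))))"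
    by simp
  also have "\<dots> =
    (\<Sum>B\<in>R. real (card (?O B (triv_hom p B))) + 2 * (\<Sum>\<sigma>\<in>S B. real (card (?O B \<sigma>))))"
  proof (rule sum.cong[OF refl])
    fix B assume B: "B \<in> R"
    have finS: "finite (S B)"
      by (rule finite_subset[OF _ R_Hom(1)[OF B]]) (use S_Hom[OF B] in blast)
    have card_T: "card (T B (triv_hom p B)) = 1"
      by (simp add: T_def)
    have "(\<Sum>\<sigma>\<in>S B. card (?O B \<sigma>) * card (T B \<sigma>)) = (\<Sum>\<sigma>\<in>S B. 2 * card (?O B \<sigma>))"
      using S_triv[OF B] by (intro sum.cong refl) (auto simp: T_def card_UNIV_bool)
    then have "card (Sigma (?I B) (\<lambda>\<sigma>. ?O B \<sigma> \<times> T B \<sigma>)) =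
        card (?O B (triv_hom p B)) + 2 * (\<Sum>\<sigma>\<in>S B. card (?O B \<sigma>))"
      using finS S_triv[OF B] card_T by (simp add: sum[OF B] sum_distrib_left)
    then show "real (card (Sigma (?I B) (\<lambda>\<sigma>. ?O B \<sigma> \<times> T B \<sigma>))) =
        real (card (?O B (triv_hom p B))) + 2 * (\<Sum>\<sigma>\<in>S B. real (card (?O B \<sigma>)))"
      by simp
  qed
  also have "\<dots> = (\<Sum>B\<in>R.
      1 / real (order (A_group B (triv_hom p B))) *
        (\<Sum>\<tau>\<in>Hom_circ p B. real (card (stabilizer (A_group B (triv_hom p B)) (ract B) \<tau>))) +
      2 * (\<Sum>\<sigma>\<in>S B. 1 / real (order (A_group B \<sigma>)) *
        (\<Sum>\<tau>\<in>Hom_circ p B. real (card (stabilizer (A_group B \<sigma>) (ract B) \<tau>)))))"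
  proof (intro sum.cong refl arg_cong2[of _ _ _ _ "(+)"] arg_cong2[of _ _ _ _ "(*)"])
    fix B assume B: "B \<in> R"
    note card = skew_brace.card_orbits_A[OF R_skew_braces(1)[OF B] finite_carrier[OF R_skew_braces(2)[OF B]] prime_p]
    show "real (card (?O B (triv_hom p B))) = 1 / real (order (A_group B (triv_hom p B))) *
        (\<Sum>\<tau>\<in>Hom_circ p B. real (card (stabilizer (A_group B (triv_hom p B)) (ract B) \<tau>)))"
      by (rule card) (rule I_Hom[OF B], simp)
    show "real (card (?O B \<sigma>)) = 1 / real (order (A_group B \<sigma>)) *
        (\<Sum>\<tau>\<in>Hom_circ p B. real (card (stabilizer (A_group B \<sigma>) (ract B) \<tau>)))" if "\<sigma> \<in> S B" for \<sigma>
      by (rule card) (rule I_Hom[OF B], use that in simp)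
  qed
  finally show ?thesis .
qed

end

end

section \<open>Trivial additive action and semidirect products\<close>

lemma semidirect_model_data:
  assumes "skew_brace B" "order B = n" "\<tau> \<in> Hom_circ p B"
  shows "model_data B (\<lambda>_. 1) \<tau> p"
proof -
  have "1 mod int p = 1"
    using prime_gt_1_nat[OF prime_p] by simp
  then show ?thesis
    using assms finite_carrier[OF assms(2)] prime_p p_ndvd_n prime_gt_1_nat[OF prime_p]
    by (auto simp: model_data_def model_data_axioms_def Hom_circ_def hom_def Zstar_carrier)
qed

theorem semidirect_brace:
  assumes B: "skew_brace B" "order B = n" and \<tau>: "\<tau> \<in> Hom_circ p B"
  shows "skew_brace (semidirect_brace p \<tau> B)" "order (semidirect_brace p \<tau> B) = n * p"
    "pair_isomorphic (additive_pair p (semidirect_brace p \<tau> B)) (B, triv_hom p B)"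
proof -
  interpret model_data B "\<lambda>_. 1" \<tau> p
    using semidirect_model_data[OF assms] .
  show "skew_brace (semidirect_brace p \<tau> B)"
    using skew_brace_M by (simp add: semidirect_brace_eq_model)
  show "order (semidirect_brace p \<tau> B) = n * p"
    using B(2) by (simp add: semidirect_brace_eq_model order_model)
  have "restrict (\<lambda>_. 1) (carrier B) = triv_hom p B"
    by (simp add: triv_hom_def)
  then have "ext_of p M B snd (triv_hom p B) (restrict \<tau> (carrier B))"
    using model_ext_of(1)[OF model_data_axioms] by simp
  then show "pair_isomorphic (additive_pair p (semidirect_brace p \<tau> B)) (B, triv_hom p B)"
    unfolding semidirect_brace_eq_model
    using pair_isomorphic_iff[OF ext_M B(1), of "triv_hom p B"] by (auto simp: triv_hom_def)
qed

text \<open>Trivial \<sigma> forces the plain case, where \<open>iso_model\<close> applies with the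
  constant 1 as additive action.\<close>

theorem isomorphic_semidirect_brace:
  assumes B: "skew_brace B" "order B = n" and E: "E \<in> skew_braces (n * p)"
    and "pair_isomorphic (additive_pair p E) (B, triv_hom p B)"
  shows "\<exists>\<tau>\<in>Hom_circ p B. brace_isomorphic E (semidirect_brace p \<tau> B)"
proof -
  obtain \<pi> \<tau> where ext: "ext_of p E B \<pi> (triv_hom p B) \<tau>"
    using pair_iff[OF E B(1) skew_brace.triv_hom_Hom_brace[OF B(1) prime_p]] assms(4) by blast
  then interpret brace_ext E B \<pi> p by (simp add: ext_of_def)
  have sig: "add.sig = triv_hom p B" "circ.sig = \<tau>"
    using ext by (simp_all add: ext_of_def)
  have "(\<lambda>b. (r b mod int p, \<pi> b)) \<in> brace_iso E (model p (\<lambda>_. 1) \<tau> B)"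
    using trivial_plain[OF sig(1)] by (rule iso_model) (simp_all add: sig triv_hom_def)
  then show ?thesis
    using ext_of_Hom(2)[OF ext] by (auto simp: brace_isomorphic_def semidirect_brace_eq_model)
qed

end

theorem theorem2p12:
  fixes p n :: nat
  assumes "prime p" and "odd p" and "n > 0" and "\<not> p dvd n"
    and "\<forall>G :: nat monoid. group G \<and> order G = n * p \<longrightarrow> (\<exists>H. H \<lhd> G \<and> card H = p)"
    and "\<not> p dvd theta n"
  shows
    "(\<forall>B :: 'b skew_brace. skew_brace B \<and> order B = n \<longrightarrow>
        card (additive_structures_over p (n * p) B) =
        card (orbits (Aut_brace B) (Hom_brace p B) (ract B))) \<and>
     (\<forall>R. representatives R (iso_classes brace_isomorphic (skew_braces n)) \<longrightarrow>
        real (card (additive_structures p (n * p))) =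
        (\<Sum>B\<in>R. 1 / real (order (Aut_brace B)) *
           (\<Sum>\<sigma>\<in>Hom_brace p B. real (card (stabilizer (Aut_brace B) (ract B) \<sigma>))))) \<and>
     (\<forall>(B :: 'b skew_brace) \<sigma>. skew_brace B \<and> order B = n \<and> \<sigma> \<in> Hom_brace p B \<longrightarrow>
        card (iso_classes brace_isomorphic
          {E \<in> skew_braces (n * p). pair_isomorphic (additive_pair p E) (B, \<sigma>)}) =
        (if \<sigma> = triv_hom p B
         then card (orbits (A_group B \<sigma>) (Hom_circ p B) (ract B))
         else 2 * card (orbits (A_group B \<sigma>) (Hom_circ p B) (ract B)))) \<and>
     (\<forall>R S. representatives R (iso_classes brace_isomorphic (skew_braces n)) \<and>
        (\<forall>B\<in>R. representatives (S B)
           (orbits (Aut_brace B) (Hom_brace p B) (ract B) - {{triv_hom p B}})) \<longrightarrow>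
        real (card (iso_classes brace_isomorphic (skew_braces (n * p)))) =
        (\<Sum>B\<in>R.
           1 / real (order (A_group B (triv_hom p B))) *
             (\<Sum>\<tau>\<in>Hom_circ p B.
                real (card (stabilizer (A_group B (triv_hom p B)) (ract B) \<tau>))) +
           2 * (\<Sum>\<sigma>\<in>S B. 1 / real (order (A_group B \<sigma>)) *
             (\<Sum>\<tau>\<in>Hom_circ p B. real (card (stabilizer (A_group B \<sigma>) (ract B) \<tau>)))))) \<and>
     (\<forall>B :: 'b skew_brace. skew_brace B \<and> order B = n \<longrightarrow>
        (\<forall>\<tau>\<in>Hom_circ p B.
           skew_brace (semidirect_brace p \<tau> B) \<and> order (semidirect_brace p \<tau> B) = n * p \<and>
           pair_isomorphic (additive_pair p (semidirect_brace p \<tau> B)) (B, triv_hom p B)) \<and>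
        (\<forall>E\<in>skew_braces (n * p). pair_isomorphic (additive_pair p E) (B, triv_hom p B) \<longrightarrow>
           (\<exists>\<tau>\<in>Hom_circ p B. brace_isomorphic E (semidirect_brace p \<tau> B))))"
proof -
  interpret size_np p n
    using assms by unfold_locales
  show ?thesis
    using card_additive_structures_over card_additive_structures card_classes_over card_skew_braces
      semidirect_brace isomorphic_semidirect_brace by (intro conjI allI impI ballI) blast+
qed

end
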